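(* Let $(\mathcal X,\Gamma,\mathsf d)$ be a metric local diffusion space, and let $\mu$ be a probability measure on $(\Upsilon,\Sigma_{\mathrm v})$ satisfying the closability assumption. If $(\Upsilon,\Gamma^{\Upsilon,\mu},\mathsf d_\Upsilon)$ satisfies the Rademacher property $(\mathsf{Rad}_{\mathsf d_\Upsilon,\mu})$ and the form $(\mathcal E^{\Upsilon,\mu},\mathscr D(\mathcal E^{\Upsilon,\mu}))$ is irreducible, then for all $\Xi,\Lambda\in\Sigma_{\mathrm v}$ with $\mu\Xi>0$, $\mu\Lambda>0$ and such that $\mathsf d_\Upsilon(\cdot,\Xi)$ is $\Sigma_{\mathrm v}$-measurable, one has $$\mathsf d_\Upsilon(\Lambda,\Xi)<\infty .$$
   Context: A metric local diffusion space $(\mathcal X,\Gamma,\mathsf d)$, $\mathcal X=(X,\tau,\Sigma,\mathsf m,\mathscr E_{\mathsf d})$, consists of: a non-empty complete separable metric space $(X,\mathsf d)$ with topology $\tau$; a $\sigma$-algebra $\Sigma$ with $\mathscr B_\tau\subset\Sigma\subset\mathscr B_\tau^{\mathsf m}$ (Borel $\sigma$-algebra and its $\mathsf m$-completion); a $\sigma$-finite atomless Radon measure $\mathsf m$ with full support, finite on every set of the ring $\mathscr E_{\mathsf d}$ of all $\mathsf d$-bounded sets in $\Sigma$; and a square field operator $(\Gamma,\mathcal D)$: $\mathcal D$ is an algebra of bounded continuous functions vanishing outside a $\mathsf d$-bounded set, generating $\tau$, with $\varphi\circ\mathbf f-\varphi(0)\in\mathcal D$ for $\mathbf f\in\mathcal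 D^k$, $\varphi\in\mathcal C_b^\infty(\mathbb R^k)$ (bounded smooth, all derivatives bounded); $\Gamma:\mathcal D\times\mathcal D\to L^\infty(\mathsf m)$ is symmetric, bilinear, non-negative definite, takes values in $\mathsf m$-classes of bounded $\Sigma$-measurable functions vanishing outside a set in $\mathscr E_{\mathsf d}$, and satisfies $\Gamma(\varphi\circ\mathbf f-\varphi(0),\psi\circ\mathbf g-\psi(0))=\sum_{i,j}(\partial_i\varphi)(\mathbf f)(\partial_j\psi)(\mathbf g)\Gamma(f_i,g_j)$ a.e.; the form $\int\Gamma(f,g)\,d\mathsf m$ on $\mathcal D$ is closable and densely defined in $L^2(\mathsf m)$, and its closure is a quasi-regular Dirichlet form. A strong lifting $\ell:L^\infty(\mathsf m)\to\mathcal L^\infty(\mathsf m)$ (bounded $\Sigma$-measurable functions; linear, multiplicative, order preserving, $\ell(1)=1$, $[\ell(f)]_{\mathsf m}=f$, $\ell(\varphi)=\varphi$ for $\varphi\in\mathcal C_b(X)$) is fixed. $\Upsilon$ is the set of all $\gamma=\sum_{i\le N}\delta_{x_i}$, $N\in\mathbb N_0\cup\{\infty\}$, $x_i\in X$ (repetitions allowed), finite on sets of $\mathscr E_{\mathsf d}$; $\Sigma_{\mathrm v}$ is generated by $\gamma\mapsto\gamma E$, $E\in\mathscr E_{\mathsf d}$, with $\mu$-completion $\Sigma_{\mathrm v}^\mu$. Put $f^\star\gamma=\int f\,d\gamma$. Cylinder functions are $u=F(f_1^\star,\dots,f_k^\star)$, $F\in\mathcal C_b^\infty(\mathbb R^k)$,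 $f_i\in\mathcal D$; for $u=F(f_1^\star,\dots,f_k^\star)$, $v=G(g_1^\star,\dots,g_m^\star)$, $\Gamma^\Upsilon(u,v)(\gamma)=\sum_{i,j}\partial_iF(f_1^\star\gamma,\dots)\,\partial_jG(g_1^\star\gamma,\dots)\int\ell(\Gamma(f_i,g_j))\,d\gamma$. Closability assumption on $\mu$: $\int\gamma E\,d\mu<\infty$ for all $E\in\mathscr E_{\mathsf d}$, and the pre-Dirichlet form $\mathcal E^{\Upsilon,\mu}(u,v)=\int\Gamma^\Upsilon(u,v)\,d\mu$ on $\mu$-classes of cylinder functions is closable on $L^2(\mu)$; its closure is $(\mathcal E^{\Upsilon,\mu},\mathscr D(\mathcal E^{\Upsilon,\mu}))$, with square field operator $\Gamma^{\Upsilon,\mu}$ and semigroup $T_t$. The form is irreducible if whenever $A\in\Sigma_{\mathrm v}$ satisfies $1_AT_tf=T_t(1_Af)$ for all $f\in L^2(\mu)$ and $t>0$, then $\mu A=0$ or $\mu A^c=0$. $\mathsf d_\Upsilon(\gamma,\eta)=\inf_q\big(\int_{X\times X}\mathsf d^2\,dq\big)^{1/2}\in[0,\infty]$, the infimum over measures $q$ on $X\times X$ with marginals $\gamma,\eta$ ($\inf\emptyset=+\infty$); $\mathsf d_\Upsilon(\gamma,\Xi)=\inf_{\eta\in\Xi}\mathsf d_\Upsilon(\gamma,\eta)$, $\mathsf d_\Upsilon(\Lambda,\Xi)=\inf_{\gamma\in\Lambda}\mathsf d_\Upsilon(\gamma,\Xi)$. $(\mathsf{Rad}_{\mathsf d_\Upsilon,\mu})$: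 every bounded $\Sigma_{\mathrm v}^\mu$-measurable $\mathsf d_\Upsilon$-Lipschitz $\hat u:\Upsilon\to\mathbb R$ with Lipschitz constant $L$ has $\mu$-class $u\in\mathscr D(\mathcal E^{\Upsilon,\mu})$ with $\Gamma^{\Upsilon,\mu}(u)\le L^2$ $\mu$-a.e. *)

theory Defs
  imports "HOL-Probability.Probability"
begin

(* Elements of L^2(M) and L^\<infinity>(M) are represented throughout by measurable functions, and identities
   between classes by almost-everywhere statements.  In the same way, an operator on classes is
   represented by an operator on functions that respects equality almost everywhere. *)

section \<open>Bounded smooth functions on Euclidean spaces of arbitrary dimension\<close>

(* The dimension k varies inside the statements, so a function on R^k is a function of real
   sequences that depends on the first k entries only. *)

definition pd :: "nat \<Rightarrow> ((nat \<Rightarrow> real) \<Rightarrow> real) \<Rightarrow> (nat \<Rightarrow> real) \<Rightarrow> real" where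
  "pd i \<phi> x = deriv (\<lambda>t. \<phi> (x(i := t))) (x i)"

(* Continuity refers to the product topology on nat => real; for functions of the first k entries
   this is continuity on R^k. *)
definition Cb_smooth :: "nat \<Rightarrow> ((nat \<Rightarrow> real) \<Rightarrow> real) set" where
  "Cb_smooth k = {\<phi>.
     (\<forall>x y. (\<forall>i<k. x i = y i) \<longrightarrow> \<phi> x = \<phi> y) \<and>
     (\<forall>js. set js \<subseteq> {..<k} \<longrightarrow>
        bounded (range (foldr pd js \<phi>)) \<and>
        continuous_on UNIV (foldr pd js \<phi>) \<and>
        (\<forall>i<k. \<forall>x. (\<lambda>t. foldr pd js \<phi> (x(i := t))) differentiable (at (x i))))}"

section \<open>Bilinear forms on \<open>L\<^sup>2\<close>\<close>

definition L2 :: "'b measure \<Rightarrow> ('b \<Rightarrow> real) set" where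
  "L2 M = {f \<in> borel_measurable M. integrable M (\<lambda>x. (f x)\<^sup>2)}"

definition sqnorm2 :: "'b measure \<Rightarrow> ('b \<Rightarrow> real) \<Rightarrow> real" where
  "sqnorm2 M f = (\<integral>x. (f x)\<^sup>2 \<partial>M)"

definition dense_L2 :: "'b measure \<Rightarrow> ('b \<Rightarrow> real) set \<Rightarrow> bool" where
  "dense_L2 M D \<longleftrightarrow>
     D \<subseteq> L2 M \<and> (\<forall>f\<in>L2 M. \<forall>e>0. \<exists>u\<in>D. sqnorm2 M (\<lambda>x. f x - u x) < e)"

type_synonym 'b form = "('b \<Rightarrow> real) \<Rightarrow> ('b \<Rightarrow> real) \<Rightarrow> real"

definition form_Cauchy :: "'b form \<Rightarrow> (nat \<Rightarrow> 'b \<Rightarrow> real) \<Rightarrow> bool" where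
  "form_Cauchy \<E> us \<longleftrightarrow>
     (\<forall>e>0. \<exists>N. \<forall>i\<ge>N. \<forall>j\<ge>N. \<E> (\<lambda>x. us i x - us j x) (\<lambda>x. us i x - us j x) < e)"

definition approximates ::
  "'b measure \<Rightarrow> ('b \<Rightarrow> real) set \<Rightarrow> 'b form \<Rightarrow> (nat \<Rightarrow> 'b \<Rightarrow> real) \<Rightarrow> ('b \<Rightarrow> real) \<Rightarrow> bool" where
  "approximates M D \<E> us u \<longleftrightarrow>
     (\<forall>n. us n \<in> D) \<and> form_Cauchy \<E> us \<and> (\<lambda>n. sqnorm2 M (\<lambda>x. us n x - u x)) \<longlonglongrightarrow> 0"

(* For a linear D this includes that E descends to classes: if u in D vanishes a.e., the constant
   sequence u approximates 0, whence E u u = 0. *)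
definition closable :: "'b measure \<Rightarrow> ('b \<Rightarrow> real) set \<Rightarrow> 'b form \<Rightarrow> bool" where
  "closable M D \<E> \<longleftrightarrow>
     (\<forall>us. approximates M D \<E> us (\<lambda>x. 0) \<longrightarrow> (\<lambda>n. \<E> (us n) (us n)) \<longlonglongrightarrow> 0)"

definition closure_dom :: "'b measure \<Rightarrow> ('b \<Rightarrow> real) set \<Rightarrow> 'b form \<Rightarrow> ('b \<Rightarrow> real) set" where
  "closure_dom M D \<E> = {u \<in> L2 M. \<exists>us. approximates M D \<E> us u}"

definition closure_form :: "'b measure \<Rightarrow> ('b \<Rightarrow> real) set \<Rightarrow> 'b form \<Rightarrow> 'b form" where
  "closure_form M D \<E> u v =
     (THE r. \<exists>us vs. approximates M D \<E> us u \<and> approximates M D \<E> vs v \<and>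
                     (\<lambda>n. \<E> (us n) (vs n)) \<longlonglongrightarrow> r)"

definition form1 :: "'b measure \<Rightarrow> 'b form \<Rightarrow> ('b \<Rightarrow> real) \<Rightarrow> real" where
  "form1 M \<E> u = \<E> u u + sqnorm2 M u"

definition dirichlet_form :: "'b measure \<Rightarrow> ('b \<Rightarrow> real) set \<Rightarrow> 'b form \<Rightarrow> bool" where
  "dirichlet_form M D \<E> \<longleftrightarrow>
     dense_L2 M D \<and>
     (\<forall>u\<in>D. \<forall>v\<in>L2 M. (AE x in M. u x = v x) \<longrightarrow> v \<in> D \<and> (\<forall>w\<in>D. \<E> u w = \<E> v w)) \<and>
     (\<forall>u\<in>D. \<forall>v\<in>D. \<forall>a b. (\<lambda>x. a * u x + b * v x) \<in> D \<and>
        (\<forall>w\<in>D. \<E> (\<lambda>x. a * u x + b * v x) w = a * \<E> u w + b * \<E> v w)) \<and>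
     (\<forall>u\<in>D. \<forall>v\<in>D. \<E> u v = \<E> v u) \<and>
     (\<forall>u\<in>D. 0 \<le> \<E> u u) \<and>
     (\<forall>us. (\<forall>n. us n \<in> D) \<and>
           (\<forall>e>0. \<exists>N. \<forall>i\<ge>N. \<forall>j\<ge>N. form1 M \<E> (\<lambda>x. us i x - us j x) < e) \<longrightarrow>
           (\<exists>u\<in>D. (\<lambda>n. form1 M \<E> (\<lambda>x. us n x - u x)) \<longlonglongrightarrow> 0)) \<and>
     (\<forall>u\<in>D. (\<lambda>x. min (max (u x) 0) 1) \<in> D \<and>
        \<E> (\<lambda>x. min (max (u x) 0) 1) (\<lambda>x. min (max (u x) 0) 1) \<le> \<E> u u)"

subsection \<open>Quasi-regularity (Ma and Roeckner)\<close>

definition nest ::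
  "'b::topological_space measure \<Rightarrow> ('b \<Rightarrow> real) set \<Rightarrow> 'b form \<Rightarrow> (nat \<Rightarrow> 'b set) \<Rightarrow> bool" where
  "nest M D \<E> F \<longleftrightarrow>
     (\<forall>k. closed (F k)) \<and> incseq F \<and>
     (\<forall>u\<in>D. \<forall>e>0. \<exists>v\<in>D. (\<exists>k. AE x in M. x \<notin> F k \<longrightarrow> v x = 0) \<and>
                           form1 M \<E> (\<lambda>x. u x - v x) < e)"

definition polar ::
  "'b::topological_space measure \<Rightarrow> ('b \<Rightarrow> real) set \<Rightarrow> 'b form \<Rightarrow> 'b set \<Rightarrow> bool" where
  "polar M D \<E> N \<longleftrightarrow> (\<exists>F. nest M D \<E> F \<and> N \<subseteq> (\<Inter>k. - F k))"

definition quasi_continuous ::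
  "'b::topological_space measure \<Rightarrow> ('b \<Rightarrow> real) set \<Rightarrow> 'b form \<Rightarrow> ('b \<Rightarrow> real) \<Rightarrow> bool" where
  "quasi_continuous M D \<E> f \<longleftrightarrow> (\<exists>F. nest M D \<E> F \<and> (\<forall>k. continuous_on (F k) f))"

definition quasi_regular ::
  "'b::topological_space measure \<Rightarrow> ('b \<Rightarrow> real) set \<Rightarrow> 'b form \<Rightarrow> bool" where
  "quasi_regular M D \<E> \<longleftrightarrow>
     (\<exists>F. nest M D \<E> F \<and> (\<forall>k. compact (F k))) \<and>
     (\<forall>u\<in>D. \<forall>e>0. \<exists>v\<in>D. form1 M \<E> (\<lambda>x. u x - v x) < e \<and>
        (\<exists>w. quasi_continuous M D \<E> w \<and> (AE x in M. w x = v x))) \<and>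
     (\<exists>us ws N. (\<forall>n::nat. us n \<in> D \<and> quasi_continuous M D \<E> (ws n) \<and>
                          (AE x in M. ws n x = us n x)) \<and>
        polar M D \<E> N \<and>
        (\<forall>x y. x \<notin> N \<and> y \<notin> N \<and> x \<noteq> y \<longrightarrow> (\<exists>n. ws n x \<noteq> ws n y)))"

subsection \<open>Semigroup and irreducibility\<close>

definition generates :: "'b measure \<Rightarrow> (real \<Rightarrow> ('b \<Rightarrow> real) \<Rightarrow> ('b \<Rightarrow> real)) \<Rightarrow>
    ('b \<Rightarrow> real) \<Rightarrow> ('b \<Rightarrow> real) \<Rightarrow> bool" where
  "generates M T u h \<longleftrightarrow>
     ((\<lambda>t. sqnorm2 M (\<lambda>x. (T t u x - u x) / t - h x)) \<longlongrightarrow> 0) (at_right 0)"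

(* T is the strongly continuous contraction semigroup on L^2(M) whose generator L is that of the
   closed form (E, D): u belongs to the domain of L with L u = h iff u belongs to D and
   E(u, v) = - (h, v) for all v in D.  This determines T uniquely. *)
definition semigroup_of_form :: "'b measure \<Rightarrow> ('b \<Rightarrow> real) set \<Rightarrow> 'b form \<Rightarrow>
    (real \<Rightarrow> ('b \<Rightarrow> real) \<Rightarrow> ('b \<Rightarrow> real)) \<Rightarrow> bool" where
  "semigroup_of_form M D \<E> T \<longleftrightarrow>
     (\<forall>t\<ge>0. \<forall>f\<in>L2 M. T t f \<in> L2 M \<and> sqnorm2 M (T t f) \<le> sqnorm2 M f) \<and>
     (\<forall>t\<ge>0. \<forall>f\<in>L2 M. \<forall>g\<in>L2 M. \<forall>a b.
        AE x in M. T t (\<lambda>y. a * f y + b * g y) x = a * T t f x + b * T t g x) \<and>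
     (\<forall>f\<in>L2 M. AE x in M. T 0 f x = f x) \<and>
     (\<forall>s\<ge>0. \<forall>t\<ge>0. \<forall>f\<in>L2 M. AE x in M. T (s + t) f x = T s (T t f) x) \<and>
     (\<forall>f\<in>L2 M. ((\<lambda>t. sqnorm2 M (\<lambda>x. T t f x - f x)) \<longlongrightarrow> 0) (at_right 0)) \<and>
     (\<forall>u\<in>L2 M. \<forall>h\<in>L2 M.
        generates M T u h \<longleftrightarrow> u \<in> D \<and> (\<forall>v\<in>D. \<E> u v = - (\<integral>x. h x * v x \<partial>M)))"

definition irreducible_semigroup ::
  "'b measure \<Rightarrow> (real \<Rightarrow> ('b \<Rightarrow> real) \<Rightarrow> ('b \<Rightarrow> real)) \<Rightarrow> bool" where
  "irreducible_semigroup M T \<longleftrightarrow>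
     (\<forall>A\<in>sets M.
        (\<forall>f\<in>L2 M. \<forall>t>0. AE x in M.
            indicator A x * T t f x = T t (\<lambda>y. indicator A y * f y) x) \<longrightarrow>
        emeasure M A = 0 \<or> emeasure M (space M - A) = 0)"

subsection \<open>Square field operator of the closure\<close>

(* h is a version of the square field of (u, v): the L^1-limit of the pre-square field G along
   approximating sequences. *)
definition square_field_version :: "'b measure \<Rightarrow> ('b \<Rightarrow> real) set \<Rightarrow> 'b form \<Rightarrow>
    (('b \<Rightarrow> real) \<Rightarrow> ('b \<Rightarrow> real) \<Rightarrow> ('b \<Rightarrow> real)) \<Rightarrow>
    ('b \<Rightarrow> real) \<Rightarrow> ('b \<Rightarrow> real) \<Rightarrow> ('b \<Rightarrow> real) \<Rightarrow> bool" where
  "square_field_version M D \<E> G u v h \<longleftrightarrow>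
     integrable M h \<and>
     (\<exists>us vs. approximates M D \<E> us u \<and> approximates M D \<E> vs v \<and>
        (\<lambda>n. \<integral>x. \<bar>G (us n) (vs n) x - h x\<bar> \<partial>M) \<longlonglongrightarrow> 0)"

section \<open>Metric local diffusion spaces\<close>

(* The \<sigma>-algebra \<Sigma> is \<open>sets m\<close>. *)

definition bounded_sets :: "'a::metric_space measure \<Rightarrow> 'a set set" where
  "bounded_sets m = {E \<in> sets m. bounded E}"

definition Linf :: "'a measure \<Rightarrow> ('a \<Rightarrow> real) set" where
  "Linf m = {f \<in> borel_measurable m. bounded (f ` space m)}"

definition base_form ::
  "'a measure \<Rightarrow> (('a \<Rightarrow> real) \<Rightarrow> ('a \<Rightarrow> real) \<Rightarrow> ('a \<Rightarrow> real)) \<Rightarrow> 'a form" where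
  "base_form m \<Gamma> f g = (\<integral>x. \<Gamma> f g x \<partial>m)"

(* \<open>distr m borel (\<lambda>x. x)\<close> is the restriction of m to the Borel \<sigma>-algebra. *)
locale metric_local_diffusion_space = sigma_finite_measure m
  for m :: "'a::polish_space measure" +
  fixes D :: "('a \<Rightarrow> real) set"
    and \<Gamma> :: "('a \<Rightarrow> real) \<Rightarrow> ('a \<Rightarrow> real) \<Rightarrow> ('a \<Rightarrow> real)"
  assumes space_m: "space m = UNIV"
    and borel_le: "sets borel \<subseteq> sets m"
    and le_completion: "sets m \<subseteq> sets (completion (distr m borel (\<lambda>x. x)))"
    and atomless: "\<And>A. A \<in> sets m \<Longrightarrow> 0 < emeasure m A \<Longrightarrow>
        \<exists>B\<in>sets m. B \<subseteq> A \<and> 0 < emeasure m B \<and> emeasure m B < emeasure m A"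
    and locally_finite: "\<And>x. \<exists>U. open U \<and> x \<in> U \<and> emeasure m U < \<infinity>"
    and inner_regular: "\<And>A. A \<in> sets m \<Longrightarrow>
        emeasure m A = (SUP K\<in>{K. compact K \<and> K \<subseteq> A}. emeasure m K)"
    and full_support: "\<And>U. open U \<Longrightarrow> U \<noteq> {} \<Longrightarrow> 0 < emeasure m U"
    and finite_bounded: "\<And>E. E \<in> bounded_sets m \<Longrightarrow> emeasure m E < \<infinity>"
    and D_bounded_continuous: "\<And>f. f \<in> D \<Longrightarrow> continuous_on UNIV f \<and> bounded (range f)"
    and D_bounded_support: "\<And>f. f \<in> D \<Longrightarrow> \<exists>B. bounded B \<and> (\<forall>x. x \<notin> B \<longrightarrow> f x = 0)"
    and D_zero: "(\<lambda>x. 0) \<in> D"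
    and D_lin: "\<And>f g a b. f \<in> D \<Longrightarrow> g \<in> D \<Longrightarrow> (\<lambda>x. a * f x + b * g x) \<in> D"
    and D_mult: "\<And>f g. f \<in> D \<Longrightarrow> g \<in> D \<Longrightarrow> (\<lambda>x. f x * g x) \<in> D"
    and D_generates: "\<And>S. open S \<longleftrightarrow>
        generate_topology {f -` U | f U. f \<in> D \<and> open U} S"
    and D_comp: "\<And>k \<phi> f. \<phi> \<in> Cb_smooth k \<Longrightarrow> (\<And>i. i < k \<Longrightarrow> f i \<in> D) \<Longrightarrow>
        (\<lambda>x. \<phi> (\<lambda>i. f i x) - \<phi> (\<lambda>i. 0)) \<in> D"
    and \<Gamma>_Linf: "\<And>f g. f \<in> D \<Longrightarrow> g \<in> D \<Longrightarrow> \<Gamma> f g \<in> Linf m"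
    and \<Gamma>_bounded_support: "\<And>f g. f \<in> D \<Longrightarrow> g \<in> D \<Longrightarrow>
        \<exists>E\<in>bounded_sets m. \<forall>x. x \<notin> E \<longrightarrow> \<Gamma> f g x = 0"
    and \<Gamma>_sym: "\<And>f g. f \<in> D \<Longrightarrow> g \<in> D \<Longrightarrow> AE x in m. \<Gamma> f g x = \<Gamma> g f x"
    and \<Gamma>_lin: "\<And>f g h a b. f \<in> D \<Longrightarrow> g \<in> D \<Longrightarrow> h \<in> D \<Longrightarrow>
        AE x in m. \<Gamma> (\<lambda>y. a * f y + b * g y) h x = a * \<Gamma> f h x + b * \<Gamma> g h x"
    and \<Gamma>_nonneg: "\<And>f. f \<in> D \<Longrightarrow> AE x in m. 0 \<le> \<Gamma> f f x"
    and \<Gamma>_diffusion: "\<And>k l \<phi> \<psi> f g. \<phi> \<in> Cb_smooth k \<Longrightarrow> \<psi> \<in> Cb_smooth l \<Longrightarrow>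
        (\<And>i. i < k \<Longrightarrow> f i \<in> D) \<Longrightarrow> (\<And>j. j < l \<Longrightarrow> g j \<in> D) \<Longrightarrow>
        AE x in m.
          \<Gamma> (\<lambda>y. \<phi> (\<lambda>i. f i y) - \<phi> (\<lambda>i. 0)) (\<lambda>y. \<psi> (\<lambda>j. g j y) - \<psi> (\<lambda>j. 0)) x =
          (\<Sum>i<k. \<Sum>j<l. pd i \<phi> (\<lambda>i'. f i' x) * pd j \<psi> (\<lambda>j'. g j' x) * \<Gamma> (f i) (g j) x)"
    and base_dense: "dense_L2 m D"
    and base_closable: "closable m D (base_form m \<Gamma>)"
    and base_dirichlet: "dirichlet_form m
        (closure_dom m D (base_form m \<Gamma>)) (closure_form m D (base_form m \<Gamma>))"
    and base_quasi_regular: "quasi_regular m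
        (closure_dom m D (base_form m \<Gamma>)) (closure_form m D (base_form m \<Gamma>))"

(* The first condition expresses that lft is defined on classes. *)
definition strong_lifting ::
  "'a::topological_space measure \<Rightarrow> (('a \<Rightarrow> real) \<Rightarrow> ('a \<Rightarrow> real)) \<Rightarrow> bool" where
  "strong_lifting m lft \<longleftrightarrow>
     (\<forall>f\<in>Linf m. \<forall>g\<in>Linf m. (AE x in m. f x = g x) \<longrightarrow> lft f = lft g) \<and>
     (\<forall>f\<in>Linf m. lft f \<in> Linf m) \<and>
     (\<forall>f\<in>Linf m. AE x in m. lft f x = f x) \<and>
     (\<forall>f\<in>Linf m. \<forall>g\<in>Linf m. \<forall>a b x.
        lft (\<lambda>y. a * f y + b * g y) x = a * lft f x + b * lft g x) \<and>
     (\<forall>f\<in>Linf m. \<forall>g\<in>Linf m. \<forall>x. lft (\<lambda>y. f y * g y) x = lft f x * lft g x) \<and>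
     (\<forall>f\<in>Linf m. \<forall>g\<in>Linf m. (AE x in m. f x \<le> g x) \<longrightarrow> (\<forall>x. lft f x \<le> lft g x)) \<and>
     (\<forall>x. lft (\<lambda>y. 1) x = 1) \<and>
     (\<forall>\<phi>. continuous_on UNIV \<phi> \<and> bounded (range \<phi>) \<longrightarrow> lft \<phi> = \<phi>)"

section \<open>Configuration spaces\<close>

definition configs :: "'a::metric_space measure \<Rightarrow> 'a measure set" where
  "configs m = {\<gamma>. sets \<gamma> = sets m \<and>
     (\<exists>(N::enat) (x::nat \<Rightarrow> 'a). \<forall>A\<in>sets m.
        emeasure \<gamma> A = (\<Sum>i. if enat i < N then indicator A (x i) else 0)) \<and>
     (\<forall>E\<in>bounded_sets m. emeasure \<gamma> E < \<infinity>)}"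

definition config_algebra :: "'a::metric_space measure \<Rightarrow> 'a measure measure" where
  "config_algebra m = sigma (configs m)
     {{\<gamma> \<in> configs m. emeasure \<gamma> E \<in> B} | E B. E \<in> bounded_sets m \<and> B \<in> sets borel}"

definition star :: "('a \<Rightarrow> real) \<Rightarrow> 'a measure \<Rightarrow> real" where
  "star f \<gamma> = (\<integral>x. f x \<partial>\<gamma>)"

(* The k-tuple (f_0, ..., f_(k-1)) and F represent the cylinder function u; only the values of u
   on configurations matter. *)
definition cyl_rep :: "'a::metric_space measure \<Rightarrow> ('a \<Rightarrow> real) set \<Rightarrow> nat \<Rightarrow>
    ((nat \<Rightarrow> real) \<Rightarrow> real) \<Rightarrow> (nat \<Rightarrow> 'a \<Rightarrow> real) \<Rightarrow> ('a measure \<Rightarrow> real) \<Rightarrow> bool" where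
  "cyl_rep m D k F f u \<longleftrightarrow>
     F \<in> Cb_smooth k \<and> (\<forall>i<k. f i \<in> D) \<and> (\<forall>\<gamma>\<in>configs m. u \<gamma> = F (\<lambda>i. star (f i) \<gamma>))"

definition cylinder_functions ::
  "'a::metric_space measure \<Rightarrow> ('a \<Rightarrow> real) set \<Rightarrow> ('a measure \<Rightarrow> real) set" where
  "cylinder_functions m D = {u. \<exists>k F f. cyl_rep m D k F f u}"

(* By the diffusion property of \<Gamma> and the multiplicativity of the lifting, the value does not
   depend on the representations of u and v. *)
definition config_square_field :: "'a::metric_space measure \<Rightarrow> ('a \<Rightarrow> real) set \<Rightarrow>
    (('a \<Rightarrow> real) \<Rightarrow> ('a \<Rightarrow> real) \<Rightarrow> ('a \<Rightarrow> real)) \<Rightarrow> (('a \<Rightarrow> real) \<Rightarrow> ('a \<Rightarrow> real)) \<Rightarrow>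
    ('a measure \<Rightarrow> real) \<Rightarrow> ('a measure \<Rightarrow> real) \<Rightarrow> 'a measure \<Rightarrow> real" where
  "config_square_field m D \<Gamma> lft u v \<gamma> =
     (THE r. \<exists>k F f l G g. cyl_rep m D k F f u \<and> cyl_rep m D l G g v \<and>
        r = (\<Sum>i<k. \<Sum>j<l. pd i F (\<lambda>i'. star (f i') \<gamma>) * pd j G (\<lambda>j'. star (g j') \<gamma>) *
                           star (lft (\<Gamma> (f i) (g j))) \<gamma>))"

definition config_form :: "'a::metric_space measure \<Rightarrow> ('a \<Rightarrow> real) set \<Rightarrow>
    (('a \<Rightarrow> real) \<Rightarrow> ('a \<Rightarrow> real) \<Rightarrow> ('a \<Rightarrow> real)) \<Rightarrow> (('a \<Rightarrow> real) \<Rightarrow> ('a \<Rightarrow> real)) \<Rightarrow>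
    'a measure measure \<Rightarrow> 'a measure form" where
  "config_form m D \<Gamma> lft \<mu> u v = (\<integral>\<gamma>. config_square_field m D \<Gamma> lft u v \<gamma> \<partial>\<mu>)"

definition closability_assumption :: "'a::metric_space measure \<Rightarrow> ('a \<Rightarrow> real) set \<Rightarrow>
    (('a \<Rightarrow> real) \<Rightarrow> ('a \<Rightarrow> real) \<Rightarrow> ('a \<Rightarrow> real)) \<Rightarrow> (('a \<Rightarrow> real) \<Rightarrow> ('a \<Rightarrow> real)) \<Rightarrow>
    'a measure measure \<Rightarrow> bool" where
  "closability_assumption m D \<Gamma> lft \<mu> \<longleftrightarrow>
     (\<forall>E\<in>bounded_sets m. (\<integral>\<^sup>+\<gamma>. emeasure \<gamma> E \<partial>\<mu>) < \<infinity>) \<and>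
     closable \<mu> (cylinder_functions m D) (config_form m D \<Gamma> lft \<mu>)"

definition config_dom :: "'a::metric_space measure \<Rightarrow> ('a \<Rightarrow> real) set \<Rightarrow>
    (('a \<Rightarrow> real) \<Rightarrow> ('a \<Rightarrow> real) \<Rightarrow> ('a \<Rightarrow> real)) \<Rightarrow> (('a \<Rightarrow> real) \<Rightarrow> ('a \<Rightarrow> real)) \<Rightarrow>
    'a measure measure \<Rightarrow> ('a measure \<Rightarrow> real) set" where
  "config_dom m D \<Gamma> lft \<mu> =
     closure_dom \<mu> (cylinder_functions m D) (config_form m D \<Gamma> lft \<mu>)"

definition config_closed_form :: "'a::metric_space measure \<Rightarrow> ('a \<Rightarrow> real) set \<Rightarrow>
    (('a \<Rightarrow> real) \<Rightarrow> ('a \<Rightarrow> real) \<Rightarrow> ('a \<Rightarrow> real)) \<Rightarrow> (('a \<Rightarrow> real) \<Rightarrow> ('a \<Rightarrow> real)) \<Rightarrow>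
    'a measure measure \<Rightarrow> 'a measure form" where
  "config_closed_form m D \<Gamma> lft \<mu> =
     closure_form \<mu> (cylinder_functions m D) (config_form m D \<Gamma> lft \<mu>)"

section \<open>The transport distance\<close>

definition ennreal_sqrt :: "ennreal \<Rightarrow> ennreal" where
  "ennreal_sqrt r = (if r = \<top> then \<top> else ennreal (sqrt (enn2real r)))"

definition couplings :: "'a measure \<Rightarrow> 'a measure \<Rightarrow> ('a \<times> 'a) measure set" where
  "couplings \<gamma> \<eta> =
     {q. sets q = sets (\<gamma> \<Otimes>\<^sub>M \<eta>) \<and> distr q \<gamma> fst = \<gamma> \<and> distr q \<eta> snd = \<eta>}"

definition dU :: "'a::metric_space measure \<Rightarrow> 'a measure \<Rightarrow> ennreal" where
  "dU \<gamma> \<eta> = (INF q\<in>couplings \<gamma> \<eta>. ennreal_sqrt (\<integral>\<^sup>+p. ennreal ((dist (fst p) (snd p))\<^sup>2) \<partial>q))"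

definition dU_point_set :: "'a::metric_space measure \<Rightarrow> 'a measure set \<Rightarrow> ennreal" where
  "dU_point_set \<gamma> \<Xi> = (INF \<eta>\<in>\<Xi>. dU \<gamma> \<eta>)"

definition dU_set_set :: "'a::metric_space measure set \<Rightarrow> 'a measure set \<Rightarrow> ennreal" where
  "dU_set_set \<Lambda> \<Xi> = (INF \<gamma>\<in>\<Lambda>. dU_point_set \<gamma> \<Xi>)"

section \<open>The Rademacher property\<close>

(* Measurability of w is with respect to the \<mu>-completion, whereas elements of the domain are
   measurable in the original sense; hence the passage to a representative u of the class of w. *)
definition rademacher :: "'a::metric_space measure \<Rightarrow> ('a \<Rightarrow> real) set \<Rightarrow>
    (('a \<Rightarrow> real) \<Rightarrow> ('a \<Rightarrow> real) \<Rightarrow> ('a \<Rightarrow> real)) \<Rightarrow> (('a \<Rightarrow> real) \<Rightarrow> ('a \<Rightarrow> real)) \<Rightarrow>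
    'a measure measure \<Rightarrow> bool" where
  "rademacher m D \<Gamma> lft \<mu> \<longleftrightarrow>
     (\<forall>w L. w \<in> borel_measurable (completion \<mu>) \<and> bounded (w ` configs m) \<and> 0 \<le> L \<and>
        (\<forall>\<gamma>\<in>configs m. \<forall>\<eta>\<in>configs m. ennreal \<bar>w \<gamma> - w \<eta>\<bar> \<le> ennreal L * dU \<gamma> \<eta>) \<longrightarrow>
        (\<exists>u h. u \<in> config_dom m D \<Gamma> lft \<mu> \<and> (AE \<gamma> in \<mu>. w \<gamma> = u \<gamma>) \<and>
           square_field_version \<mu> (cylinder_functions m D) (config_form m D \<Gamma> lft \<mu>)
             (config_square_field m D \<Gamma> lft) u u h \<and>
           (AE \<gamma> in \<mu>. h \<gamma> \<le> L\<^sup>2)))"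

end

theory Submission
  imports Defs
begin

text \<open>
  Let \<open>A\<close> be the set of all configurations at finite transport distance from \<open>\<Xi>\<close>.  Being at finite
  distance is an equivalence relation on configurations: symmetry is clear, and transitivity is the
  gluing of couplings, which is elementary because the middle configuration is purely atomic
  (\<open>dU_finite_trans\<close>).  Hence a configuration in \<open>A\<close> and one outside \<open>A\<close> have infinite distance, and
  the indicator of \<open>A\<close> is Lipschitz with every constant \<open>L > 0\<close> (\<open>indicator_Lipschitz\<close>).  The
  Rademacher property puts it into the domain of the form with square field at most \<open>L\<^sup>2\<close> for every
  \<open>L\<close>, so its energy is zero (\<open>zero_energy_approximation\<close>).

  A set whose indicator has zero energy is invariant, because the form is local.  Composing cylinder
  functions that approximate \<open>1\<^sub>A\<close> with \<open>sin (\<pi>/2 \<cdot>)\<close>, which fixes 0 and 1, gives cylinder functions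
  \<open>s\<^sub>n\<close> bounded by 1 that tend to \<open>1\<^sub>A\<close> almost everywhere with energies tending to 0.  By the Leibniz
  rule, multiplication by \<open>s\<^sub>n\<close> is symmetric for the form up to an error that vanishes in the limit;
  so multiplication by \<open>1\<^sub>A\<close> preserves the domain of the closure and is symmetric for the closed form
  (\<open>indicator_Dom\<close>, \<open>Form_indicator\<close>).  It therefore commutes with the generator and, by a
  differential inequality for the norm of the commutator, with the semigroup
  (\<open>indicator_commutes\<close>).  The last step needs the domain of the generator to be dense; this follows
  from strong continuity, since the means of \<open>T\<^sub>s f\<close> over small intervals lie in the domain
  (\<open>mean_in_generator_domain\<close>).  Irreducibility now says that \<open>A\<close> is null or has full measure.  As
  \<open>A\<close> contains \<open>\<Xi>\<close>, it has full measure and so meets \<open>\<Lambda>\<close>, which is the claim.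

  The argument uses bilinearity, positivity and the chain rule for the square field on cylinder
  functions, hence first of all that its value does not depend on the chosen representations.  This
  comes from an intrinsic formula (\<open>square_field_eq_moves\<close>): moving a single point \<open>x\<^sub>i\<close> of a
  configuration to a variable position \<open>y\<close> turns a cylinder function into an element of the base
  algebra \<open>D\<close>, and the square field of two cylinder functions is the sum over \<open>i\<close> of the lifted base
  square fields of these elements, evaluated at \<open>x\<^sub>i\<close>.
\<close>

section \<open>Semi-inner products on spaces of functions\<close>

text \<open>
  The quadratic form of a bilinear form.
\<close>

abbreviation (input) quad :: "'b form \<Rightarrow> ('b \<Rightarrow> real) \<Rightarrow> real" where
  "quad B u \<equiv> B u u"

lemma tendsto_0_by_bound:
  fixes a b :: "nat \<Rightarrow> real"
  assumes "\<And>n. 0 \<le> a n" "\<And>n. a n \<le> b n" "b \<longlonglongrightarrow> c" "c = 0"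
  shows "a \<longlonglongrightarrow> 0"
proof -
  have lim: "b \<longlonglongrightarrow> 0" using assms(3,4) by simp
  show ?thesis by (rule tendsto_sandwich[OF _ _ tendsto_const lim]) (use assms(1,2) in auto)
qed

lemma quadratic_nonneg_discriminant:
  fixes \<alpha> \<beta> \<delta> :: real
  assumes \<beta>: "0 \<le> \<beta>" and nonneg: "\<And>t. 0 \<le> \<alpha> + 2 * t * \<delta> + t\<^sup>2 * \<beta>"
  shows "\<delta>\<^sup>2 \<le> \<alpha> * \<beta>"
proof (cases "\<beta> = 0")
  case True
  have "\<delta> = 0"
  proof (rule ccontr)
    assume "\<delta> \<noteq> 0"
    then show False
      using nonneg[of "- (\<alpha> + 1) / (2 * \<delta>)"] True by (simp add: field_simps)
  qed
  then show ?thesis using True by simp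
next
  case False
  then have b: "\<beta> > 0" using \<beta> by simp
  have "0 \<le> \<alpha> - \<delta>\<^sup>2 / \<beta>"
    using nonneg[of "- \<delta> / \<beta>"] b by (simp add: power2_eq_square field_simps)
  then show ?thesis using b by (simp add: field_simps)
qed

text \<open>
  A vector space of functions with a symmetric positive semidefinite bilinear form.  It is
  instantiated with the pointwise square field, with the energy on cylinder functions, with the
  closed form and with the \<open>L\<^sup>2\<close> inner product.
\<close>

locale semi_inner =
  fixes V :: "('b \<Rightarrow> real) set" and B :: "'b form"
  assumes V_lin: "u \<in> V \<Longrightarrow> v \<in> V \<Longrightarrow> (\<lambda>x. a * u x + b * v x) \<in> V"
    and B_lin: "u \<in> V \<Longrightarrow> v \<in> V \<Longrightarrow> w \<in> V \<Longrightarrow>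
      B (\<lambda>x. a * u x + b * v x) w = a * B u w + b * B v w"
    and B_sym: "u \<in> V \<Longrightarrow> v \<in> V \<Longrightarrow> B u v = B v u"
    and B_nonneg: "u \<in> V \<Longrightarrow> 0 \<le> B u u"
begin

lemma V_diff: "u \<in> V \<Longrightarrow> v \<in> V \<Longrightarrow> (\<lambda>x. u x - v x) \<in> V"
  using V_lin[of u v 1 "- 1"] by simp

lemma V_add: "u \<in> V \<Longrightarrow> v \<in> V \<Longrightarrow> (\<lambda>x. u x + v x) \<in> V"
  using V_lin[of u v 1 1] by simp

lemma V_scale: "u \<in> V \<Longrightarrow> (\<lambda>x. a * u x) \<in> V"
  using V_lin[of u u a 0] by simp

lemma B_lin_right: "u \<in> V \<Longrightarrow> v \<in> V \<Longrightarrow> w \<in> V \<Longrightarrow>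
    B w (\<lambda>x. a * u x + b * v x) = a * B w u + b * B w v"
  using B_lin[of u v w a b] V_lin[of u v a b] B_sym by metis

lemma V_zero: "u \<in> V \<Longrightarrow> (\<lambda>x. 0) \<in> V"
  using V_lin[of u u 0 0] by simp

lemma B_zero: "w \<in> V \<Longrightarrow> u \<in> V \<Longrightarrow> B (\<lambda>x. 0) u = 0"
  using B_lin[of w w u 0 0] by simp

lemma B_diff: "u \<in> V \<Longrightarrow> v \<in> V \<Longrightarrow> w \<in> V \<Longrightarrow> B (\<lambda>x. u x - v x) w = B u w - B v w"
  using B_lin[of u v w 1 "- 1"] by simp

lemma B_diff_right: "u \<in> V \<Longrightarrow> v \<in> V \<Longrightarrow> w \<in> V \<Longrightarrow> B w (\<lambda>x. u x - v x) = B w u - B w v"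
  using B_lin_right[of u v w 1 "- 1"] by simp

lemma B_scale: "u \<in> V \<Longrightarrow> w \<in> V \<Longrightarrow> B (\<lambda>x. a * u x) w = a * B u w"
  using B_lin[of u u w a 0] by simp

lemma B_scale_right: "u \<in> V \<Longrightarrow> w \<in> V \<Longrightarrow> B w (\<lambda>x. a * u x) = a * B w u"
  using B_lin_right[of u u w a 0] by simp

lemma B_square_lin:
  assumes "u \<in> V" "v \<in> V"
  shows "quad B (\<lambda>x. a * u x + b * v x) =
    a\<^sup>2 * B u u + 2 * a * b * B u v + b\<^sup>2 * B v v"
  using assms B_sym[of u v]
  by (simp add: B_lin B_lin_right V_lin power2_eq_square algebra_simps)

lemma Cauchy_Schwarz: "u \<in> V \<Longrightarrow> v \<in> V \<Longrightarrow> (B u v)\<^sup>2 \<le> B u u * B v v"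
proof (rule quadratic_nonneg_discriminant)
  assume uv: "u \<in> V" "v \<in> V"
  show "0 \<le> B v v" by (rule B_nonneg[OF uv(2)])
  fix t
  show "0 \<le> B u u + 2 * t * B u v + t\<^sup>2 * B v v"
    using B_nonneg[OF V_lin[OF uv, of 1 t]] B_square_lin[OF uv, of 1 t] by simp
qed

lemma Cauchy_Schwarz_sqrt: "u \<in> V \<Longrightarrow> v \<in> V \<Longrightarrow> \<bar>B u v\<bar> \<le> sqrt (B u u) * sqrt (B v v)"
  using Cauchy_Schwarz[of u v] by (metis real_sqrt_abs real_sqrt_le_iff real_sqrt_mult)

lemma norm_triangle:
  assumes "u \<in> V" "v \<in> V"
  shows "sqrt (quad B (\<lambda>x. u x + v x)) \<le> sqrt (B u u) + sqrt (B v v)"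
proof (rule real_le_lsqrt)
  have "quad B (\<lambda>x. u x + v x) = B u u + 2 * B u v + B v v"
    using B_square_lin[OF assms, of 1 1] by simp
  also have "\<dots> \<le> B u u + 2 * (sqrt (B u u) * sqrt (B v v)) + B v v"
    using Cauchy_Schwarz_sqrt[OF assms] by auto
  also have "\<dots> = (sqrt (B u u) + sqrt (B v v))\<^sup>2"
    using assms by (simp add: power2_sum B_nonneg)
  finally show "quad B (\<lambda>x. u x + v x) \<le> (sqrt (B u u) + sqrt (B v v))\<^sup>2" .
qed (use assms in \<open>auto simp: B_nonneg\<close>)

lemma norm_diff_triangle:
  assumes "u \<in> V" "v \<in> V" "w \<in> V"
  shows "sqrt (quad B (\<lambda>x. u x - w x)) \<le>
    sqrt (quad B (\<lambda>x. u x - v x)) + sqrt (quad B (\<lambda>x. v x - w x))"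
  using norm_triangle[OF V_diff[OF assms(1,2)] V_diff[OF assms(2,3)]] by simp

lemma norm_diff_sym:
  assumes "u \<in> V" "v \<in> V"
  shows "quad B (\<lambda>x. u x - v x) = quad B (\<lambda>x. v x - u x)"
  using assms by (simp add: B_diff B_diff_right V_diff B_sym)

lemma norm_reverse_triangle:
  assumes "u \<in> V" "v \<in> V"
  shows "\<bar>sqrt (B u u) - sqrt (B v v)\<bar> \<le> sqrt (quad B (\<lambda>x. u x - v x))"
  using norm_triangle[OF V_diff[OF assms] assms(2)] norm_triangle[OF V_diff[OF assms(2,1)] assms(1)]
    norm_diff_sym[OF assms] by simp

lemma B_square_le:
  assumes "u \<in> V" "v \<in> V"
  shows "quad B (\<lambda>x. a * u x + b * v x) \<le> 2 * a\<^sup>2 * B u u + 2 * b\<^sup>2 * B v v"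
  using B_nonneg[OF V_lin[OF assms, of a "- b"]]
  by (simp add: B_square_lin[OF assms, of a b] B_square_lin[OF assms, of a "- b", simplified]
      algebra_simps)

lemma B_square_diff_le:
  assumes "u \<in> V" "v \<in> V"
  shows "quad B (\<lambda>x. u x - v x) \<le> 2 * B u u + 2 * B v v"
  using B_square_le[OF assms, of 1 "- 1"] by simp

lemma B_square_triangle_le:
  assumes "u \<in> V" "v \<in> V" "w \<in> V"
  shows "quad B (\<lambda>x. u x - w x) \<le>
    2 * quad B (\<lambda>x. u x - v x) + 2 * quad B (\<lambda>x. v x - w x)"
  using B_square_le[OF V_diff[OF assms(1,2)] V_diff[OF assms(2,3)], of 1 1] by simp

lemma B_tendsto_0:
  assumes "\<And>n::nat. us n \<in> V" "\<And>n. vs n \<in> V"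
    and "(\<lambda>n. B (us n) (us n)) \<longlonglongrightarrow> 0" "(\<lambda>n. B (vs n) (vs n)) \<longlonglongrightarrow> c"
  shows "(\<lambda>n. B (us n) (vs n)) \<longlonglongrightarrow> 0"
proof (rule tendsto_rabs_zero_cancel, rule tendsto_0_by_bound)
  show "(\<lambda>n. sqrt (B (us n) (us n)) * sqrt (B (vs n) (vs n))) \<longlonglongrightarrow> sqrt 0 * sqrt c"
    by (intro tendsto_mult tendsto_real_sqrt assms)
qed (use Cauchy_Schwarz_sqrt assms in auto)

lemma B_tendsto:
  assumes u: "\<And>n::nat. us n \<in> V" "u \<in> V" "(\<lambda>n. quad B (\<lambda>x. us n x - u x)) \<longlonglongrightarrow> 0"
    and v: "\<And>n. vs n \<in> V" "v \<in> V" "(\<lambda>n. quad B (\<lambda>x. vs n x - v x)) \<longlonglongrightarrow> 0"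
  shows "(\<lambda>n. B (us n) (vs n)) \<longlonglongrightarrow> B u v"
proof -
  have 1: "(\<lambda>n. B (\<lambda>x. us n x - u x) v) \<longlonglongrightarrow> 0"
    by (rule B_tendsto_0[OF _ _ u(3)]) (use u v in \<open>auto intro: V_diff\<close>)
  have 2: "(\<lambda>n. B (\<lambda>x. vs n x - v x) u) \<longlonglongrightarrow> 0"
    by (rule B_tendsto_0[OF _ _ v(3)]) (use u v in \<open>auto intro: V_diff\<close>)
  have 3: "(\<lambda>n. B (\<lambda>x. us n x - u x) (\<lambda>x. vs n x - v x)) \<longlonglongrightarrow> 0"
    by (rule B_tendsto_0[OF _ _ u(3) v(3)]) (use u v in \<open>auto intro: V_diff\<close>)
  have "B (us n) (vs n) = B (\<lambda>x. us n x - u x) v + B (\<lambda>x. vs n x - v x) u +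
      B (\<lambda>x. us n x - u x) (\<lambda>x. vs n x - v x) + B u v" for n
    using u(1)[of n] v(1)[of n] u(2) v(2) B_sym[of "vs n" u] B_sym[of u v]
    by (simp add: B_diff B_diff_right V_diff)
  then have "(\<lambda>n. B (us n) (vs n)) = (\<lambda>n. B (\<lambda>x. us n x - u x) v + B (\<lambda>x. vs n x - v x) u +
      B (\<lambda>x. us n x - u x) (\<lambda>x. vs n x - v x) + B u v)" by blast
  moreover have "\<dots> \<longlonglongrightarrow> 0 + 0 + 0 + B u v"
    by (intro tendsto_add 1 2 3 tendsto_const)
  ultimately show ?thesis by simp
qed

text \<open>
  The representing element is the limit of a minimizing sequence of \<open>B u u - 2 l u\<close>.  Since \<open>B\<close> may
  be degenerate, it is unique only up to elements of seminorm 0.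
\<close>

lemma Riesz_representation:
  assumes complete: "\<And>us. (\<And>n. us n \<in> V) \<Longrightarrow> form_Cauchy B us \<Longrightarrow>
      \<exists>u\<in>V. (\<lambda>n. quad B (\<lambda>x. us n x - u x)) \<longlonglongrightarrow> 0"
    and V0: "v0 \<in> V"
    and l_lin: "\<And>u v a b. u \<in> V \<Longrightarrow> v \<in> V \<Longrightarrow> l (\<lambda>x. a * u x + b * v x) = a * l u + b * l v"
    and l_bd: "\<And>u. u \<in> V \<Longrightarrow> \<bar>l u\<bar> \<le> K * sqrt (B u u)"
  shows "\<exists>v\<in>V. \<forall>w\<in>V. B v w = l w"
proof -
  define J where "J u = B u u - 2 * l u" for u
  have lower: "- K\<^sup>2 \<le> J u" if "u \<in> V" for u
  proof -
    have "0 \<le> (sqrt (B u u) - K)\<^sup>2" by simp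
    also have "\<dots> = B u u - 2 * (K * sqrt (B u u)) + K\<^sup>2"
      using that by (simp add: power2_diff B_nonneg)
    also have "\<dots> \<le> B u u - 2 * l u + K\<^sup>2" using l_bd[OF that] by linarith
    finally show ?thesis by (simp add: J_def)
  qed
  define c where "c = (INF u\<in>V. J u)"
  have bdd: "bdd_below (J ` V)" using lower by (auto intro!: bdd_belowI)
  have c: "c \<le> J u" if "u \<in> V" for u
    unfolding c_def using bdd that by (rule cINF_lower)
  have "\<exists>u\<in>V. J u < c + 1 / real (Suc n)" for n
  proof -
    have "c < c + 1 / real (Suc n)" by simp
    then show ?thesis unfolding c_def using V0 bdd by (subst (asm) cINF_less_iff) auto
  qed
  then obtain us where us: "\<And>n. us n \<in> V" "\<And>n. J (us n) < c + 1 / real (Suc n)" by metis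
  have J_lin: "J (\<lambda>x. a * u x + b * v x) = a\<^sup>2 * B u u + 2 * a * b * B u v + b\<^sup>2 * B v v
      - 2 * a * l u - 2 * b * l v" if "u \<in> V" "v \<in> V" for u v a b
    using that by (simp add: J_def B_square_lin l_lin)
  have diff: "quad B (\<lambda>x. us i x - us j x) \<le>
      2 * (1 / real (Suc i)) + 2 * (1 / real (Suc j))" for i j
  proof -
    have "quad B (\<lambda>x. us i x - us j x) =
        2 * J (us i) + 2 * J (us j) - 4 * J (\<lambda>x. (1/2) * us i x + (1/2) * us j x)"
      using B_square_lin[OF us(1)[of i] us(1)[of j], of 1 "- 1"] 
      unfolding J_lin[OF us(1)[of i] us(1)[of j]] by (simp add: J_def power2_eq_square field_simps)
    also have "\<dots> \<le> 2 * (c + 1 / real (Suc i)) + 2 * (c + 1 / real (Suc j)) - 4 * c"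
      using us(2)[of i] us(2)[of j] c[OF V_lin[OF us(1)[of i] us(1)[of j], of "1/2" "1/2"]]
      by argo
    finally show ?thesis by simp
  qed
  have "form_Cauchy B us"
    unfolding form_Cauchy_def
  proof (intro allI impI)
    fix e :: real assume "0 < e"
    then obtain N where N: "1 / real (Suc N) < e / 4"
      using nat_approx_posE[of "e / 4"] by auto
    show "\<exists>N. \<forall>i\<ge>N. \<forall>j\<ge>N. quad B (\<lambda>x. us i x - us j x) < e"
    proof (intro exI allI impI)
      fix i j assume "N \<le> i" "N \<le> j"
      then have "1 / real (Suc i) \<le> 1 / real (Suc N)" "1 / real (Suc j) \<le> 1 / real (Suc N)"
        by (auto intro!: divide_left_mono)
      then show "quad B (\<lambda>x. us i x - us j x) < e"
        using diff[of i j] N by linarith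
    qed
  qed
  from complete[OF us(1) this] obtain v where v: "v \<in> V"
    "(\<lambda>n. quad B (\<lambda>x. us n x - v x)) \<longlonglongrightarrow> 0" by blast
  have "B v w = l w" if w: "w \<in> V" for w
  proof -
    have "(B (us n) w - l w)\<^sup>2 \<le> (1 / real (Suc n)) * B w w" for n
    proof (rule quadratic_nonneg_discriminant)
      show "0 \<le> B w w" by (rule B_nonneg[OF w])
      fix t
      have "J (\<lambda>x. 1 * us n x + t * w x) = J (us n) + 2 * t * (B (us n) w - l w) + t\<^sup>2 * B w w"
        unfolding J_lin[OF us(1) w] by (simp add: J_def algebra_simps)
      moreover have "c \<le> J (\<lambda>x. 1 * us n x + t * w x)" by (intro c V_lin us w)
      ultimately show "0 \<le> 1 / real (Suc n) + 2 * t * (B (us n) w - l w) + t\<^sup>2 * B w w"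
        using us(2)[of n] by linarith
    qed
    moreover have "(\<lambda>n. (1 / real (Suc n)) * B w w) \<longlonglongrightarrow> 0 * B w w"
      by (intro tendsto_mult tendsto_const) (use LIMSEQ_inverse_real_of_nat in \<open>simp add: inverse_eq_divide\<close>)
    moreover have "(\<lambda>n. (B (us n) w - l w)\<^sup>2) \<longlonglongrightarrow> (B v w - l w)\<^sup>2"
      by (intro tendsto_intros B_tendsto us v w) (use w V_zero[OF w] B_zero[OF w] in simp)
    ultimately have "(B v w - l w)\<^sup>2 \<le> 0 * B w w"
      by (intro LIMSEQ_le) auto
    then show ?thesis by simp
  qed
  then show ?thesis using v(1) by blast
qed

end

section \<open>The space of square integrable functions\<close>

text \<open>
  The inner product of \<open>L\<^sup>2\<close>, on representatives.
\<close>

abbreviation ip :: "'b measure \<Rightarrow> 'b form" where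
  "ip M f g \<equiv> (\<integral>x. f x * g x \<partial>M)"

lemma sqnorm2_ip: "sqnorm2 M f = ip M f f"
  by (simp add: sqnorm2_def power2_eq_square)

lemma L2_measurable [measurable_dest]: "f \<in> L2 M \<Longrightarrow> f \<in> borel_measurable M"
  by (simp add: L2_def)

lemma L2_integrable_mult:
  assumes "f \<in> L2 M" "g \<in> L2 M"
  shows "integrable M (\<lambda>x. f x * g x)"
proof (rule Bochner_Integration.integrable_bound[where f = "\<lambda>x. (f x)\<^sup>2 + (g x)\<^sup>2"])
  show "integrable M (\<lambda>x. (f x)\<^sup>2 + (g x)\<^sup>2)" using assms by (auto simp: L2_def)
  show "(\<lambda>x. f x * g x) \<in> borel_measurable M" using assms by (auto simp: L2_def)
  show "AE x in M. norm (f x * g x) \<le> norm ((f x)\<^sup>2 + (g x)\<^sup>2)"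
  proof (rule AE_I2)
    fix x
    have "2 * \<bar>f x * g x\<bar> \<le> (f x)\<^sup>2 + (g x)\<^sup>2"
      using sum_squares_bound[of "\<bar>f x\<bar>" "\<bar>g x\<bar>"] by (simp add: abs_mult)
    then show "norm (f x * g x) \<le> norm ((f x)\<^sup>2 + (g x)\<^sup>2)" by simp
  qed
qed

lemma L2_lin:
  assumes "f \<in> L2 M" "g \<in> L2 M"
  shows "(\<lambda>x. a * f x + b * g x) \<in> L2 M"
proof -
  have "integrable M (\<lambda>x. a\<^sup>2 * (f x)\<^sup>2 + 2 * a * b * (f x * g x) + b\<^sup>2 * (g x)\<^sup>2)"
    using assms L2_integrable_mult[OF assms] by (auto simp: L2_def)
  moreover have "(\<lambda>x. a\<^sup>2 * (f x)\<^sup>2 + 2 * a * b * (f x * g x) + b\<^sup>2 * (g x)\<^sup>2) = (\<lambda>x. (a * f x + b * g x)\<^sup>2)"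
    by (auto simp: power2_eq_square algebra_simps)
  ultimately show ?thesis using assms by (auto simp: L2_def)
qed

lemma semi_inner_L2: "semi_inner (L2 M) (ip M)"
proof
  fix u v w :: "'a \<Rightarrow> real" and a b :: real
  assume uv: "u \<in> L2 M" "v \<in> L2 M"
  show "(\<lambda>x. a * u x + b * v x) \<in> L2 M" using uv by (rule L2_lin)
  show "ip M u v = ip M v u" by (simp add: mult.commute)
  assume w: "w \<in> L2 M"
  show "ip M (\<lambda>x. a * u x + b * v x) w = a * ip M u w + b * ip M v w"
    using L2_integrable_mult[OF uv(1) w] L2_integrable_mult[OF uv(2) w]
    by (simp add: distrib_right mult.assoc)
qed simp

interpretation L2: semi_inner "L2 M" "ip M" for M
  by (rule semi_inner_L2)

lemma sqnorm2_nonneg [simp]: "0 \<le> sqnorm2 M f"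
  by (simp add: sqnorm2_def)

lemma sqnorm2_cong_AE:
  assumes "f \<in> borel_measurable M" "g \<in> borel_measurable M" "AE x in M. f x = g x"
  shows "sqnorm2 M f = sqnorm2 M g"
  unfolding sqnorm2_def by (rule integral_cong_AE) (use assms in auto)

lemma sqnorm2_eq_0_iff:
  assumes "f \<in> L2 M"
  shows "sqnorm2 M f = 0 \<longleftrightarrow> (AE x in M. f x = 0)"
  using assms integral_nonneg_eq_0_iff_AE[of M "\<lambda>x. (f x)\<^sup>2"] by (auto simp: sqnorm2_def L2_def)

lemma L2_bounded_mult:
  assumes "f \<in> L2 M" and [measurable]: "g \<in> borel_measurable M" and "\<And>x. x \<in> space M \<Longrightarrow> \<bar>g x\<bar> \<le> K"
  shows "(\<lambda>x. g x * f x) \<in> L2 M" "sqnorm2 M (\<lambda>x. g x * f x) \<le> K\<^sup>2 * sqnorm2 M f"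
proof -
  have [measurable]: "f \<in> borel_measurable M" and i: "integrable M (\<lambda>x. (f x)\<^sup>2)"
    using assms(1) by (auto simp: L2_def)
  have le: "(g x * f x)\<^sup>2 \<le> K\<^sup>2 * (f x)\<^sup>2" if "x \<in> space M" for x
    using power_mono[OF assms(3)[OF that], of 2]
    by (auto simp: power_mult_distrib intro!: mult_right_mono)
  have i': "integrable M (\<lambda>x. K\<^sup>2 * (f x)\<^sup>2)" using i by simp
  have i2: "integrable M (\<lambda>x. (g x * f x)\<^sup>2)"
    by (rule Bochner_Integration.integrable_bound[OF i']) (use le in \<open>auto intro!: AE_I2\<close>)
  then show "(\<lambda>x. g x * f x) \<in> L2 M" by (simp add: L2_def)
  have "sqnorm2 M (\<lambda>x. g x * f x) \<le> (\<integral>x. K\<^sup>2 * (f x)\<^sup>2 \<partial>M)"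
    unfolding sqnorm2_def by (rule integral_mono[OF i2 i' le])
  then show "sqnorm2 M (\<lambda>x. g x * f x) \<le> K\<^sup>2 * sqnorm2 M f" by (simp add: sqnorm2_def)
qed

context prob_space
begin

lemma L2_bounded:
  assumes "f \<in> borel_measurable M" "\<And>x. x \<in> space M \<Longrightarrow> \<bar>f x\<bar> \<le> K"
  shows "f \<in> L2 M"
  using assms L2_bounded_mult(1)[of "\<lambda>x. 1" M f K] by (auto simp: L2_def)

lemma L2_integrable:
  assumes "f \<in> L2 M"
  shows "integrable M f"
  using L2_integrable_mult[OF assms, of "\<lambda>x. 1"] by (simp add: L2_def)

lemma L2_integral_abs_le:
  assumes "f \<in> L2 M"
  shows "(\<integral>x. \<bar>f x\<bar> \<partial>M) \<le> sqrt (sqnorm2 M f)"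
proof -
  have a: "(\<lambda>x. \<bar>f x\<bar>) \<in> L2 M" and 1: "(\<lambda>x. 1) \<in> L2 M" using assms by (auto simp: L2_def)
  show ?thesis
    using L2.Cauchy_Schwarz_sqrt[OF a 1] by (simp add: sqnorm2_ip prob_space)
qed

lemma L2_tendsto_AE_subseq:
  assumes "\<And>n. us n \<in> L2 M" "u \<in> L2 M" "(\<lambda>n. sqnorm2 M (\<lambda>x. us n x - u x)) \<longlonglongrightarrow> 0"
  shows "\<exists>r::nat \<Rightarrow> nat. strict_mono r \<and> (AE x in M. (\<lambda>n. us (r n) x) \<longlonglongrightarrow> u x)"
proof -
  have d: "(\<lambda>x. us n x - u x) \<in> L2 M" for n using assms L2.V_diff by blast
  have "(\<lambda>n. \<integral>x. norm (us n x - u x) \<partial>M) \<longlonglongrightarrow> 0"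
  proof (rule tendsto_0_by_bound)
    show "(\<lambda>n. sqrt (sqnorm2 M (\<lambda>x. us n x - u x))) \<longlonglongrightarrow> sqrt 0"
      by (intro tendsto_real_sqrt assms)
  qed (use L2_integral_abs_le[OF d] in auto)
  from tendsto_L1_AE_subseq[OF _ this] L2_integrable[OF d]
  obtain r :: "nat \<Rightarrow> nat" where "strict_mono r" "AE x in M. (\<lambda>n. us (r n) x - u x) \<longlonglongrightarrow> 0" by blast
  then show ?thesis by (auto simp: LIM_zero_iff)
qed

text \<open>
  A subsequence whose increments have norm at most \<open>2\<^sup>-\<^sup>n\<close> converges almost everywhere, because the
  sum of the absolute increments is integrable; Fatou's lemma shows that the limit is also the limit
  in norm.
\<close>

lemma L2_complete:
  assumes us: "\<And>n. us n \<in> L2 M" and cau: "form_Cauchy (ip M) us"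
  shows "\<exists>u\<in>L2 M. (\<lambda>n. sqnorm2 M (\<lambda>x. us n x - u x)) \<longlonglongrightarrow> 0"
proof -
  have [measurable]: "us n \<in> borel_measurable M" for n using us by (auto simp: L2_def)
  have "\<forall>n. \<exists>N. \<forall>i\<ge>N. \<forall>j\<ge>N. sqnorm2 M (\<lambda>x. us i x - us j x) < ((1/2)^n)\<^sup>2"
    using cau by (auto simp: form_Cauchy_def sqnorm2_ip)
  then obtain N where N: "\<And>n i j. N n \<le> i \<Longrightarrow> N n \<le> j \<Longrightarrow> sqnorm2 M (\<lambda>x. us i x - us j x) < ((1/2)^n)\<^sup>2"
    by metis
  define r where "r n = n + (\<Sum>k\<le>n. N k)" for n
  have rN: "N n \<le> r m" if "n \<le> m" for n m
    using member_le_sum[of n "{..m}" N] that by (auto simp: r_def)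
  have rn: "n \<le> r n" for n by (simp add: r_def)
  define d where "d n x = us (r (Suc n)) x - us (r n) x" for n x
  have dL2: "d n \<in> L2 M" for n unfolding d_def using us L2.V_diff by blast
  have [measurable]: "d n \<in> borel_measurable M" for n using dL2 by (auto simp: L2_def)
  have dle: "(\<integral>\<^sup>+x. ennreal \<bar>d n x\<bar> \<partial>M) \<le> ennreal ((1/2)^n)" for n
  proof -
    have "(\<integral>x. \<bar>d n x\<bar> \<partial>M) \<le> sqrt (sqnorm2 M (d n))" by (rule L2_integral_abs_le[OF dL2])
    also have "\<dots> \<le> sqrt (((1/2)^n)\<^sup>2)"
    proof -
      have "sqnorm2 M (d n) < ((1/2)^n)\<^sup>2" unfolding d_def by (intro N rN) auto
      then show ?thesis by (intro real_sqrt_le_mono) simp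
    qed
    finally have "(\<integral>x. \<bar>d n x\<bar> \<partial>M) \<le> (1/2)^n" by simp
    then show ?thesis
      using L2_integrable[OF dL2] by (subst nn_integral_eq_integral) (auto intro!: ennreal_leI)
  qed
  have "(\<integral>\<^sup>+x. (\<Sum>n. ennreal \<bar>d n x\<bar>) \<partial>M) = (\<Sum>n. \<integral>\<^sup>+x. ennreal \<bar>d n x\<bar> \<partial>M)"
    by (rule nn_integral_suminf) simp
  also have "\<dots> \<le> (\<Sum>n. ennreal ((1/2)^n))"
    by (intro suminf_le dle) auto
  also have "\<dots> = ennreal (\<Sum>n. (1/2)^n)"
    by (intro suminf_ennreal2 summable_geometric) auto
  also have "\<dots> < \<infinity>" by simp
  finally have "AE x in M. (\<Sum>n. ennreal \<bar>d n x\<bar>) \<noteq> \<infinity>"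
    by (intro nn_integral_PInf_AE) auto
  then have conv: "AE x in M. convergent (\<lambda>n. us (r n) x)"
  proof eventually_elim
    fix x assume "(\<Sum>n. ennreal \<bar>d n x\<bar>) \<noteq> \<infinity>"
    then have "summable (\<lambda>n. \<bar>d n x\<bar>)" by (intro summable_suminf_not_top) auto
    then have "summable (\<lambda>n. d n x)" by (rule summable_rabs_cancel)
    then have "convergent (\<lambda>n. \<Sum>i<n. d i x)" by (simp add: summable_iff_convergent)
    moreover have "(\<Sum>i<n. d i x) = us (r n) x - us (r 0) x" for n
      unfolding d_def by (induction n) auto
    ultimately have "convergent (\<lambda>n. us (r n) x - us (r 0) x + us (r 0) x)"
      by (intro convergent_add) (auto intro: convergent_const)
    then show "convergent (\<lambda>n. us (r n) x)" by simp
  qed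
  define u where "u x = lim (\<lambda>n. us (r n) x)" for x
  have [measurable]: "u \<in> borel_measurable M" unfolding u_def by simp
  have lim: "AE x in M. (\<lambda>n. us (r n) x) \<longlonglongrightarrow> u x"
    using conv by eventually_elim (simp add: u_def convergent_LIMSEQ_iff)
  have fat: "(\<integral>\<^sup>+x. ennreal ((us i x - u x)\<^sup>2) \<partial>M) \<le> ennreal (((1/2)^n)\<^sup>2)" if "N n \<le> i" for n i
  proof -
    have "(\<integral>\<^sup>+x. ennreal ((us i x - u x)\<^sup>2) \<partial>M) = (\<integral>\<^sup>+x. liminf (\<lambda>k. ennreal ((us i x - us (r k) x)\<^sup>2)) \<partial>M)"
    proof (rule nn_integral_cong_AE, use lim in eventually_elim)
      fix x assume "(\<lambda>n. us (r n) x) \<longlonglongrightarrow> u x"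
      then have "(\<lambda>k. ennreal ((us i x - us (r k) x)\<^sup>2)) \<longlonglongrightarrow> ennreal ((us i x - u x)\<^sup>2)"
        by (intro tendsto_ennrealI tendsto_intros)
      then show "ennreal ((us i x - u x)\<^sup>2) = liminf (\<lambda>k. ennreal ((us i x - us (r k) x)\<^sup>2))"
        by (intro lim_imp_Liminf[symmetric]) auto
    qed
    also have "\<dots> \<le> liminf (\<lambda>k. \<integral>\<^sup>+x. ennreal ((us i x - us (r k) x)\<^sup>2) \<partial>M)"
      by (rule nn_integral_liminf) simp
    also have "\<dots> \<le> limsup (\<lambda>k. \<integral>\<^sup>+x. ennreal ((us i x - us (r k) x)\<^sup>2) \<partial>M)"
      by (intro Liminf_le_Limsup) auto
    also have "\<dots> \<le> ennreal (((1/2)^n)\<^sup>2)"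
    proof (rule Limsup_bounded, rule eventually_sequentiallyI[of n])
      fix k assume k: "n \<le> k"
      have L: "(\<lambda>x. us i x - us (r k) x) \<in> L2 M" using us L2.V_diff by blast
      have "(\<integral>\<^sup>+x. ennreal ((us i x - us (r k) x)\<^sup>2) \<partial>M) = ennreal (sqnorm2 M (\<lambda>x. us i x - us (r k) x))"
        unfolding sqnorm2_def using L by (intro nn_integral_eq_integral) (auto simp: L2_def)
      also have "\<dots> \<le> ennreal (((1/2)^n)\<^sup>2)"
        using N[OF that rN[OF k]] by (intro ennreal_leI) auto
      finally show "(\<integral>\<^sup>+x. ennreal ((us i x - us (r k) x)\<^sup>2) \<partial>M) \<le> ennreal (((1/2)^n)\<^sup>2)" .
    qed
    finally show ?thesis .
  qed
  have dif: "(\<lambda>x. us i x - u x) \<in> L2 M" "sqnorm2 M (\<lambda>x. us i x - u x) \<le> ((1/2)^n)\<^sup>2" if "N n \<le> i" for n i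
  proof -
    have f: "(\<integral>\<^sup>+x. ennreal ((us i x - u x)\<^sup>2) \<partial>M) < \<infinity>"
      using fat[OF that] by (rule le_less_trans) simp
    then have int: "integrable M (\<lambda>x. (us i x - u x)\<^sup>2)" by (intro integrableI_nonneg) auto
    then show "(\<lambda>x. us i x - u x) \<in> L2 M" by (auto simp: L2_def)
    have "ennreal (sqnorm2 M (\<lambda>x. us i x - u x)) \<le> ennreal (((1/2)^n)\<^sup>2)"
      using fat[OF that] int unfolding sqnorm2_def by (subst (asm) nn_integral_eq_integral) auto
    then show "sqnorm2 M (\<lambda>x. us i x - u x) \<le> ((1/2)^n)\<^sup>2"
      by (subst (asm) ennreal_le_iff) auto
  qed
  have uL2: "u \<in> L2 M"
    using L2.V_diff[OF us[of "N 0"] dif(1)[of 0 "N 0"]] by simp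
  have "(\<lambda>n. sqnorm2 M (\<lambda>x. us n x - u x)) \<longlonglongrightarrow> 0"
  proof (rule LIMSEQ_I)
    fix e :: real assume "0 < e"
    then obtain n where n: "(1/4::real)^n < e" using real_arch_pow_inv[of e "1/4"] by auto
    have e4: "((1/2::real)^n)\<^sup>2 = (1/4)^n"
      by (simp add: power2_eq_square power_mult_distrib[symmetric])
    show "\<exists>n0. \<forall>n\<ge>n0. norm (sqnorm2 M (\<lambda>x. us n x - u x) - 0) < e"
      using dif(2)[of n] n e4 by (intro exI[of _ "N n"]) (auto intro: le_less_trans)
  qed
  then show ?thesis using uL2 by blast
qed

lemma L2_Riesz:
  assumes "\<And>u v a b. u \<in> L2 M \<Longrightarrow> v \<in> L2 M \<Longrightarrow> l (\<lambda>x. a * u x + b * v x) = a * l u + b * l v"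
    and "\<And>u. u \<in> L2 M \<Longrightarrow> \<bar>l u\<bar> \<le> K * sqrt (sqnorm2 M u)"
  shows "\<exists>v\<in>L2 M. \<forall>w\<in>L2 M. ip M v w = l w"
proof (rule L2.Riesz_representation[of M "\<lambda>x. 0" l K])
  fix us :: "nat \<Rightarrow> 'a \<Rightarrow> real"
  assume "\<And>n. us n \<in> L2 M" "form_Cauchy (ip M) us"
  from L2_complete[OF this]
  show "\<exists>u\<in>L2 M. (\<lambda>n. ip M (\<lambda>x. us n x - u x) (\<lambda>x. us n x - u x)) \<longlonglongrightarrow> 0"
    by (simp add: sqnorm2_ip)
qed (use assms in \<open>auto simp: sqnorm2_ip L2_def\<close>)

end

section \<open>The closure of a closable form\<close>

text \<open>
  A closable symmetric form on a subspace of \<open>L\<^sup>2\<close>.  \<open>Dom\<close> and \<open>Form\<close> denote its closure.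
\<close>

locale closable_form = semi_inner C \<E> for C :: "('b \<Rightarrow> real) set" and \<E> :: "'b form" +
  fixes M :: "'b measure"
  assumes C_L2: "C \<subseteq> L2 M"
    and closable: "closable M C \<E>"
    and C_zero: "(\<lambda>x. 0) \<in> C"
begin

abbreviation Dom :: "('b \<Rightarrow> real) set" where "Dom \<equiv> closure_dom M C \<E>"
abbreviation Form :: "'b form" where "Form \<equiv> closure_form M C \<E>"

lemma approximatesD:
  assumes "approximates M C \<E> us u"
  shows "us n \<in> C" "us n \<in> L2 M" "form_Cauchy \<E> us" "(\<lambda>n. sqnorm2 M (\<lambda>x. us n x - u x)) \<longlonglongrightarrow> 0"
  using assms C_L2 by (auto simp: approximates_def)

lemma form_Cauchy_iff_le:
  "form_Cauchy Q us \<longleftrightarrow>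
    (\<forall>e>0. \<exists>N. \<forall>i\<ge>N. \<forall>j\<ge>N. quad Q (\<lambda>x. us i x - us j x) \<le> e)"
proof
  assume *: "\<forall>e>0. \<exists>N. \<forall>i\<ge>N. \<forall>j\<ge>N. quad Q (\<lambda>x. us i x - us j x) \<le> e"
  show "form_Cauchy Q us"
    unfolding form_Cauchy_def
  proof (intro allI impI)
    fix e :: real assume "0 < e"
    then obtain N where N: "\<forall>i\<ge>N. \<forall>j\<ge>N. quad Q (\<lambda>x. us i x - us j x) \<le> e / 2"
      using *[rule_format, of "e / 2"] by auto
    show "\<exists>N. \<forall>i\<ge>N. \<forall>j\<ge>N. quad Q (\<lambda>x. us i x - us j x) < e"
    proof (intro exI[of _ N] allI impI)
      fix i j assume "N \<le> i" "N \<le> j"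
      then have "quad Q (\<lambda>x. us i x - us j x) \<le> e / 2" using N by simp
      then show "quad Q (\<lambda>x. us i x - us j x) < e" using \<open>0 < e\<close> by linarith
    qed
  qed
next
  assume *: "form_Cauchy Q us"
  show "\<forall>e>0. \<exists>N. \<forall>i\<ge>N. \<forall>j\<ge>N. quad Q (\<lambda>x. us i x - us j x) \<le> e"
  proof (intro allI impI)
    fix e :: real assume "0 < e"
    then obtain N where "\<forall>i\<ge>N. \<forall>j\<ge>N. quad Q (\<lambda>x. us i x - us j x) < e"
      using *[unfolded form_Cauchy_def, rule_format, of e] by auto
    then show "\<exists>N. \<forall>i\<ge>N. \<forall>j\<ge>N. quad Q (\<lambda>x. us i x - us j x) \<le> e"
      using less_imp_le by (intro exI[of _ N]) auto
  qed
qed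

lemma form_CauchyI_bound:
  assumes bd: "\<And>i j. quad Q (\<lambda>x. us i x - us j x) \<le> c i + c j"
    and c: "c \<longlonglongrightarrow> (0::real)"
  shows "form_Cauchy Q us"
  unfolding form_Cauchy_iff_le
proof (intro allI impI)
  fix e :: real assume "0 < e"
  with c have "\<forall>\<^sub>F n in sequentially. c n < e / 2" by (intro order_tendstoD(2)[OF c]) auto
  then obtain N where N: "\<And>n. N \<le> n \<Longrightarrow> c n < e / 2" by (auto simp: eventually_sequentially)
  then show "\<exists>N. \<forall>i\<ge>N. \<forall>j\<ge>N. quad Q (\<lambda>x. us i x - us j x) \<le> e"
  proof (intro exI[of _ N] allI impI)
    fix i j assume "N \<le> i" "N \<le> j"
    then show "quad Q (\<lambda>x. us i x - us j x) \<le> e"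
      using bd[of i j] N[of i] N[of j] by linarith
  qed
qed

lemma approximates_lin:
  assumes us: "approximates M C \<E> us u" and vs: "approximates M C \<E> vs v"
    and uv: "u \<in> L2 M" "v \<in> L2 M"
  shows "approximates M C \<E> (\<lambda>n x. a * us n x + b * vs n x) (\<lambda>x. a * u x + b * v x)"
proof -
  note u = approximatesD[OF us] and v = approximatesD[OF vs]
  have "form_Cauchy \<E> (\<lambda>n x. a * us n x + b * vs n x)"
    unfolding form_Cauchy_iff_le
  proof (intro allI impI)
    fix e :: real assume e: "0 < e"
    define d where "d = e / (2 * a\<^sup>2 + 2 * b\<^sup>2 + 1)"
    have pos: "2 * a\<^sup>2 + 2 * b\<^sup>2 + 1 > 0" by (intro add_nonneg_pos) auto
    have d: "d > 0" using e pos by (simp add: d_def)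
    obtain N1 where N1: "\<And>i j. N1 \<le> i \<Longrightarrow> N1 \<le> j \<Longrightarrow> quad \<E> (\<lambda>x. us i x - us j x) < d"
      using u(3) d unfolding form_Cauchy_def by blast
    obtain N2 where N2: "\<And>i j. N2 \<le> i \<Longrightarrow> N2 \<le> j \<Longrightarrow> quad \<E> (\<lambda>x. vs i x - vs j x) < d"
      using v(3) d unfolding form_Cauchy_def by blast
    show "\<exists>N. \<forall>i\<ge>N. \<forall>j\<ge>N. quad \<E> (\<lambda>x. a * us i x + b * vs i x - (a * us j x + b * vs j x)) \<le> e"
    proof (intro exI[of _ "max N1 N2"] allI impI)
      fix i j assume ij: "max N1 N2 \<le> i" "max N1 N2 \<le> j"
      have eq: "(\<lambda>x. a * us i x + b * vs i x - (a * us j x + b * vs j x)) =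
          (\<lambda>x. a * (us i x - us j x) + b * (vs i x - vs j x))" by (auto simp: algebra_simps)
      have "quad \<E> (\<lambda>x. a * us i x + b * vs i x - (a * us j x + b * vs j x)) \<le>
          2 * a\<^sup>2 * quad \<E> (\<lambda>x. us i x - us j x) +
          2 * b\<^sup>2 * quad \<E> (\<lambda>x. vs i x - vs j x)"
        unfolding eq by (rule B_square_le) (intro V_diff u v)+
      also have "\<dots> \<le> 2 * a\<^sup>2 * d + 2 * b\<^sup>2 * d"
        using N1[of i j] N2[of i j] ij by (intro add_mono mult_left_mono) auto
      also have "\<dots> \<le> (2 * a\<^sup>2 + 2 * b\<^sup>2 + 1) * d" using d by (simp add: algebra_simps)
      also have "\<dots> = e" using pos by (simp add: d_def)
      finally show "quad \<E> (\<lambda>x. a * us i x + b * vs i x - (a * us j x + b * vs j x)) \<le> e" .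
    qed
  qed
  moreover have "(\<lambda>n. sqnorm2 M (\<lambda>x. a * us n x + b * vs n x - (a * u x + b * v x))) \<longlonglongrightarrow> 0"
  proof (rule tendsto_0_by_bound)
    show "(\<lambda>n. 2 * a\<^sup>2 * sqnorm2 M (\<lambda>x. us n x - u x) + 2 * b\<^sup>2 * sqnorm2 M (\<lambda>x. vs n x - v x)) \<longlonglongrightarrow>
       2 * a\<^sup>2 * 0 + 2 * b\<^sup>2 * 0"
      by (intro tendsto_intros u v)
    show "sqnorm2 M (\<lambda>x. a * us n x + b * vs n x - (a * u x + b * v x))
       \<le> 2 * a\<^sup>2 * sqnorm2 M (\<lambda>x. us n x - u x) + 2 * b\<^sup>2 * sqnorm2 M (\<lambda>x. vs n x - v x)" for n
    proof -
      have eq: "(\<lambda>x. a * us n x + b * vs n x - (a * u x + b * v x)) =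
          (\<lambda>x. a * (us n x - u x) + b * (vs n x - v x))" by (auto simp: algebra_simps)
      show ?thesis
        unfolding eq sqnorm2_ip by (rule L2.B_square_le) (intro L2.V_diff u v uv)+
    qed
  qed auto
  ultimately show ?thesis
    unfolding approximates_def by (auto intro: V_lin u v)
qed

lemma approximates_diff_tendsto:
  assumes us: "approximates M C \<E> us u" and vs: "approximates M C \<E> vs u" and u: "u \<in> L2 M"
  shows "(\<lambda>n. quad \<E> (\<lambda>x. us n x - vs n x)) \<longlonglongrightarrow> 0"
  using closable approximates_lin[OF us vs u u, of 1 "- 1"] unfolding closable_def by simp

lemma approximates_square_convergent:
  assumes us: "approximates M C \<E> us u"
  shows "convergent (\<lambda>n. \<E> (us n) (us n))"
proof -
  note u = approximatesD[OF us]
  have "Cauchy (\<lambda>n. sqrt (\<E> (us n) (us n)))"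
  proof (rule metric_CauchyI)
    fix e :: real assume e: "0 < e"
    then obtain N where N: "\<And>i j. N \<le> i \<Longrightarrow> N \<le> j \<Longrightarrow> quad \<E> (\<lambda>x. us i x - us j x) < e\<^sup>2"
      using u(3) unfolding form_Cauchy_def by (meson zero_less_power)
    show "\<exists>N. \<forall>i\<ge>N. \<forall>j\<ge>N. dist (sqrt (\<E> (us i) (us i))) (sqrt (\<E> (us j) (us j))) < e"
    proof (intro exI[of _ N] allI impI)
      fix i j assume "N \<le> i" "N \<le> j"
      then have "sqrt (quad \<E> (\<lambda>x. us i x - us j x)) < e"
        using N e by (intro real_less_lsqrt) auto
      then show "dist (sqrt (\<E> (us i) (us i))) (sqrt (\<E> (us j) (us j))) < e"
        using norm_reverse_triangle[OF u(1)[of i] u(1)[of j]] by (simp add: dist_real_def)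
    qed
  qed
  then obtain l where "(\<lambda>n. sqrt (\<E> (us n) (us n))) \<longlonglongrightarrow> l"
    using real_Cauchy_convergent convergent_def by blast
  then have "(\<lambda>n. (sqrt (\<E> (us n) (us n)))\<^sup>2) \<longlonglongrightarrow> l\<^sup>2" by (intro tendsto_intros)
  then show ?thesis using u(1) by (auto simp: convergent_def B_nonneg)
qed

lemma approximates_convergent:
  assumes us: "approximates M C \<E> us u" and vs: "approximates M C \<E> vs v"
    and uv: "u \<in> L2 M" "v \<in> L2 M"
  shows "convergent (\<lambda>n. \<E> (us n) (vs n))"
proof -
  note u = approximatesD[OF us] and v = approximatesD[OF vs]
  note c = approximates_square_convergent[OF approximates_lin[OF us vs uv]]
  have "convergent (\<lambda>n. (1/4) * (quad \<E> (\<lambda>x. 1 * us n x + 1 * vs n x)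
    - quad \<E> (\<lambda>x. 1 * us n x + (-1) * vs n x)))"
    by (rule convergent_mult[OF convergent_const convergent_diff[OF c c]])
  moreover have "(1/4) * (quad \<E> (\<lambda>x. 1 * us n x + 1 * vs n x)
    - quad \<E> (\<lambda>x. 1 * us n x + (-1) * vs n x)) = \<E> (us n) (vs n)" for n
    unfolding B_square_lin[OF u(1) v(1)] by simp
  ultimately show ?thesis by simp
qed

text \<open>
  The definite description in \<open>closure_form\<close> denotes the limit along any approximating sequences; this
  is where closability enters.
\<close>

lemma closure_form_tendsto:
  assumes us: "approximates M C \<E> us u" and vs: "approximates M C \<E> vs v"
    and uv: "u \<in> L2 M" "v \<in> L2 M"
  shows "(\<lambda>n. \<E> (us n) (vs n)) \<longlonglongrightarrow> Form u v"
proof -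
  note u = approximatesD[OF us] and v = approximatesD[OF vs]
  obtain r where r: "(\<lambda>n. \<E> (us n) (vs n)) \<longlonglongrightarrow> r"
    using approximates_convergent[OF assms] unfolding convergent_def by auto
  have "Form u v = r"
    unfolding closure_form_def
  proof (rule the_equality)
    show "\<exists>us vs. approximates M C \<E> us u \<and> approximates M C \<E> vs v \<and> (\<lambda>n. \<E> (us n) (vs n)) \<longlonglongrightarrow> r"
      using us vs r by blast
    fix r' assume "\<exists>us vs. approximates M C \<E> us u \<and> approximates M C \<E> vs v \<and> (\<lambda>n. \<E> (us n) (vs n)) \<longlonglongrightarrow> r'"
    then obtain us' vs' where us': "approximates M C \<E> us' u" and vs': "approximates M C \<E> vs' v"
      and r': "(\<lambda>n. \<E> (us' n) (vs' n)) \<longlonglongrightarrow> r'" by blast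
    note u' = approximatesD[OF us'] and v' = approximatesD[OF vs']
    obtain c where c: "(\<lambda>n. \<E> (vs n) (vs n)) \<longlonglongrightarrow> c"
      using approximates_square_convergent[OF vs] unfolding convergent_def by auto
    obtain c' where c': "(\<lambda>n. \<E> (us' n) (us' n)) \<longlonglongrightarrow> c'"
      using approximates_square_convergent[OF us'] unfolding convergent_def by auto
    have "(\<lambda>n. \<E> (\<lambda>x. us n x - us' n x) (vs n)) \<longlonglongrightarrow> 0"
      by (intro B_tendsto_0[OF _ _ approximates_diff_tendsto[OF us us' uv(1)] c] V_diff u u' v)
    moreover have "(\<lambda>n. \<E> (\<lambda>x. vs n x - vs' n x) (us' n)) \<longlonglongrightarrow> 0"
      by (intro B_tendsto_0[OF _ _ approximates_diff_tendsto[OF vs vs' uv(2)] c'] V_diff v u' v')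
    ultimately have "(\<lambda>n. \<E> (\<lambda>x. us n x - us' n x) (vs n) + \<E> (\<lambda>x. vs n x - vs' n x) (us' n)) \<longlonglongrightarrow> 0 + 0"
      by (rule tendsto_add)
    moreover have "\<E> (\<lambda>x. us n x - us' n x) (vs n) + \<E> (\<lambda>x. vs n x - vs' n x) (us' n) =
        \<E> (us n) (vs n) - \<E> (us' n) (vs' n)" for n
      using B_sym[OF u'(1)[of n] v(1)[of n]] B_sym[OF u'(1)[of n] v'(1)[of n]]
      by (simp add: B_diff[OF u(1) u'(1) v(1)] B_diff[OF v(1) v'(1) u'(1)])
    ultimately have "(\<lambda>n. \<E> (us n) (vs n) - \<E> (us' n) (vs' n)) \<longlonglongrightarrow> 0" by simp
    moreover have "(\<lambda>n. \<E> (us n) (vs n) - \<E> (us' n) (vs' n)) \<longlonglongrightarrow> r - r'"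
      by (intro tendsto_diff r r')
    ultimately show "r' = r" using LIMSEQ_unique by fastforce
  qed
  then show ?thesis using r by simp
qed

lemma DomE:
  assumes "u \<in> Dom"
  obtains us where "approximates M C \<E> us u" "u \<in> L2 M"
  using assms by (auto simp: closure_dom_def)

lemma DomI: "approximates M C \<E> us u \<Longrightarrow> u \<in> L2 M \<Longrightarrow> u \<in> Dom"
  by (auto simp: closure_dom_def)

lemma Dom_L2: "u \<in> Dom \<Longrightarrow> u \<in> L2 M"
  by (auto simp: closure_dom_def)

lemma approximates_const: "u \<in> C \<Longrightarrow> approximates M C \<E> (\<lambda>n. u) u"
  using B_zero[OF C_zero C_zero] by (auto simp: approximates_def form_Cauchy_def sqnorm2_def)

lemma C_Dom: "u \<in> C \<Longrightarrow> u \<in> Dom"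
  using approximates_const C_L2 DomI by blast

lemma Form_eq:
  assumes "u \<in> C" "v \<in> C"
  shows "Form u v = \<E> u v"
proof -
  have "u \<in> L2 M" "v \<in> L2 M" using assms C_L2 by auto
  then have "(\<lambda>n::nat. \<E> u v) \<longlonglongrightarrow> Form u v"
    by (intro closure_form_tendsto approximates_const assms)
  then show ?thesis by (simp add: LIMSEQ_const_iff)
qed

lemma semi_inner_closure: "semi_inner Dom Form"
proof
  fix u v w :: "'b \<Rightarrow> real" and a b :: real
  assume "u \<in> Dom" "v \<in> Dom"
  then obtain us vs where us: "approximates M C \<E> us u" "u \<in> L2 M" and vs: "approximates M C \<E> vs v" "v \<in> L2 M"
    by (metis DomE)
  note uv = approximates_lin[OF us(1) vs(1) us(2) vs(2)]
  show "(\<lambda>x. a * u x + b * v x) \<in> Dom" by (rule DomI[OF uv L2_lin[OF us(2) vs(2)]])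
  note t = closure_form_tendsto[OF us(1) vs(1) us(2) vs(2)]
  have "(\<lambda>n. \<E> (us n) (vs n)) = (\<lambda>n. \<E> (vs n) (us n))"
    by (intro ext B_sym approximatesD(1)[OF us(1)] approximatesD(1)[OF vs(1)])
  with t have "(\<lambda>n. \<E> (vs n) (us n)) \<longlonglongrightarrow> Form u v" by simp
  then show "Form u v = Form v u"
    using closure_form_tendsto[OF vs(1) us(1) vs(2) us(2)] by (rule LIMSEQ_unique)
  assume "w \<in> Dom"
  then obtain ws where ws: "approximates M C \<E> ws w" "w \<in> L2 M" by (metis DomE)
  have "(\<lambda>n. \<E> (\<lambda>x. a * us n x + b * vs n x) (ws n)) \<longlonglongrightarrow> Form (\<lambda>x. a * u x + b * v x) w"
    by (intro closure_form_tendsto uv ws L2_lin us vs)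
  moreover have "(\<lambda>n. \<E> (\<lambda>x. a * us n x + b * vs n x) (ws n)) = (\<lambda>n. a * \<E> (us n) (ws n) + b * \<E> (vs n) (ws n))"
    using approximatesD(1)[OF us(1)] approximatesD(1)[OF vs(1)] approximatesD(1)[OF ws(1)]
    by (simp add: B_lin)
  moreover have "(\<lambda>n. a * \<E> (us n) (ws n) + b * \<E> (vs n) (ws n)) \<longlonglongrightarrow> a * Form u w + b * Form v w"
    by (intro tendsto_intros closure_form_tendsto us vs ws)
  ultimately show "Form (\<lambda>x. a * u x + b * v x) w = a * Form u w + b * Form v w"
    by (simp add: LIMSEQ_unique)
next
  fix u assume "u \<in> Dom"
  then obtain us where us: "approximates M C \<E> us u" "u \<in> L2 M" by (metis DomE)
  from closure_form_tendsto[OF us(1) us(1) us(2) us(2)] show "0 \<le> Form u u"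
    by (rule LIMSEQ_le_const) (simp add: B_nonneg approximatesD(1)[OF us(1)])
qed

sublocale closure: semi_inner Dom Form
  by (rule semi_inner_closure)

lemma approximates_Form_tendsto:
  assumes us: "approximates M C \<E> us u" and u: "u \<in> L2 M"
  shows "(\<lambda>n. quad Form (\<lambda>x. us n x - u x)) \<longlonglongrightarrow> 0"
proof (rule LIMSEQ_I)
  fix e :: real assume e: "0 < e"
  obtain N where N: "\<And>i j. N \<le> i \<Longrightarrow> N \<le> j \<Longrightarrow> quad \<E> (\<lambda>x. us i x - us j x) < e / 2"
    using approximatesD(3)[OF us] e unfolding form_Cauchy_def by (meson half_gt_zero)
  have uD: "u \<in> Dom" using us u by (rule DomI)
  show "\<exists>N. \<forall>n\<ge>N. norm (quad Form (\<lambda>x. us n x - u x) - 0) < e"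
  proof (intro exI[of _ N] allI impI)
    fix n assume n: "N \<le> n"
    have c: "us n \<in> C" "us n \<in> L2 M" using approximatesD[OF us] by auto
    have a: "approximates M C \<E> (\<lambda>m x. us n x - us m x) (\<lambda>x. us n x - u x)"
      using approximates_lin[OF approximates_const[OF c(1)] us c(2) u, of 1 "- 1"] by simp
    have "(\<lambda>m. quad \<E> (\<lambda>x. us n x - us m x)) \<longlonglongrightarrow> quad Form (\<lambda>x. us n x - u x)"
      by (intro closure_form_tendsto a L2.V_diff c u)
    then have "quad Form (\<lambda>x. us n x - u x) \<le> e / 2"
      by (rule LIMSEQ_le_const2) (use N n in \<open>auto intro!: exI[of _ N] less_imp_le\<close>)
    moreover have "0 \<le> quad Form (\<lambda>x. us n x - u x)"
      by (intro closure.B_nonneg closure.V_diff C_Dom c uD)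
    ultimately show "norm (quad Form (\<lambda>x. us n x - u x) - 0) < e" using e by simp
  qed
qed

text \<open>
  The closure is a closed form: each \<open>ws n\<close> is replaced by an element of the core whose
  squared distances to it, in energy and in \<open>L\<^sup>2\<close>, are below \<open>1 / (n + 1)\<close>; the resulting sequence
  approximates the limit.
\<close>

lemma Dom_closed:
  assumes ws: "\<And>n. ws n \<in> Dom" and cau: "form_Cauchy Form ws"
    and w: "w \<in> L2 M" "(\<lambda>n. sqnorm2 M (\<lambda>x. ws n x - w x)) \<longlonglongrightarrow> 0"
  shows "w \<in> Dom" "(\<lambda>n. quad Form (\<lambda>x. ws n x - w x)) \<longlonglongrightarrow> 0"
proof -
  have "\<exists>y\<in>C. quad Form (\<lambda>x. y x - ws n x) < inverse (real (Suc n)) \<and>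
      sqnorm2 M (\<lambda>x. y x - ws n x) < inverse (real (Suc n))" for n
  proof -
    obtain us where us: "approximates M C \<E> us (ws n)" "ws n \<in> L2 M" using ws DomE by metis
    have "\<forall>\<^sub>F k in sequentially. quad Form (\<lambda>x. us k x - ws n x) < inverse (real (Suc n)) \<and>
       sqnorm2 M (\<lambda>x. us k x - ws n x) < inverse (real (Suc n))"
      by (intro eventually_conj order_tendstoD(2)[OF approximates_Form_tendsto[OF us]]
        order_tendstoD(2)[OF approximatesD(4)[OF us(1)]]) auto
    then show ?thesis using approximatesD(1)[OF us(1)] by (auto simp: eventually_sequentially)
  qed
  then obtain y where y: "\<And>n. y n \<in> C"
    "\<And>n. quad Form (\<lambda>x. y n x - ws n x) < inverse (real (Suc n))"
    "\<And>n. sqnorm2 M (\<lambda>x. y n x - ws n x) < inverse (real (Suc n))" by metis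
  have yD: "y n \<in> Dom" and yL: "y n \<in> L2 M" and wsL: "ws n \<in> L2 M" for n
    using y(1) C_Dom ws Dom_L2 by auto
  have "form_Cauchy \<E> y"
    unfolding form_Cauchy_iff_le
  proof (intro allI impI)
    fix e :: real assume e: "0 < e"
    then obtain N1 where N1: "\<And>i j. N1 \<le> i \<Longrightarrow> N1 \<le> j \<Longrightarrow> quad Form (\<lambda>x. ws i x - ws j x) < e / 16"
      using cau unfolding form_Cauchy_def by (metis divide_pos_pos zero_less_numeral)
    have "\<forall>\<^sub>F n in sequentially. inverse (real (Suc n)) < e / 16"
      using e by (intro order_tendstoD(2)[OF LIMSEQ_inverse_real_of_nat]) auto
    then obtain N2 where N2: "\<And>n. N2 \<le> n \<Longrightarrow> inverse (real (Suc n)) < e / 16"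
      by (auto simp: eventually_sequentially)
    show "\<exists>N. \<forall>i\<ge>N. \<forall>j\<ge>N. quad \<E> (\<lambda>x. y i x - y j x) \<le> e"
    proof (intro exI[of _ "max N1 N2"] allI impI)
      fix i j assume ij: "max N1 N2 \<le> i" "max N1 N2 \<le> j"
      have "quad \<E> (\<lambda>x. y i x - y j x) = quad Form (\<lambda>x. y i x - y j x)"
        by (intro Form_eq[symmetric] V_diff y)
      also have "\<dots> \<le> 2 * quad Form (\<lambda>x. y i x - ws i x) + 2 * quad Form (\<lambda>x. ws i x - y j x)"
        by (intro closure.B_square_triangle_le yD ws)
      also have "quad Form (\<lambda>x. ws i x - y j x) \<le>
         2 * quad Form (\<lambda>x. ws i x - ws j x) + 2 * quad Form (\<lambda>x. ws j x - y j x)"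
        by (intro closure.B_square_triangle_le yD ws)
      also have "quad Form (\<lambda>x. ws j x - y j x) = quad Form (\<lambda>x. y j x - ws j x)"
        by (intro closure.norm_diff_sym yD ws)
      finally show "quad \<E> (\<lambda>x. y i x - y j x) \<le> e"
        using y(2)[of i] y(2)[of j] N1[of i j] N2[of i] N2[of j] ij e by auto
    qed
  qed
  moreover have "(\<lambda>n. sqnorm2 M (\<lambda>x. y n x - w x)) \<longlonglongrightarrow> 0"
  proof (rule tendsto_0_by_bound)
    show "(\<lambda>n. 2 * inverse (real (Suc n)) + 2 * sqnorm2 M (\<lambda>x. ws n x - w x)) \<longlonglongrightarrow> 2 * 0 + 2 * 0"
      by (intro tendsto_intros w LIMSEQ_inverse_real_of_nat)
    show "sqnorm2 M (\<lambda>x. y n x - w x) \<le> 2 * inverse (real (Suc n)) + 2 * sqnorm2 M (\<lambda>x. ws n x - w x)" for n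
    proof -
      show ?thesis
        using L2.B_square_triangle_le[OF yL[of n] wsL[of n] w(1)] y(3)[of n] by (simp add: sqnorm2_ip)
    qed
  qed auto
  ultimately have yw: "approximates M C \<E> y w" using y(1) by (simp add: approximates_def)
  then show wD: "w \<in> Dom" using w(1) by (rule DomI)
  show "(\<lambda>n. quad Form (\<lambda>x. ws n x - w x)) \<longlonglongrightarrow> 0"
  proof (rule tendsto_0_by_bound)
    show "(\<lambda>n. 2 * inverse (real (Suc n)) + 2 * quad Form (\<lambda>x. y n x - w x)) \<longlonglongrightarrow> 2 * 0 + 2 * 0"
      by (intro tendsto_intros LIMSEQ_inverse_real_of_nat approximates_Form_tendsto[OF yw w(1)])
    show "quad Form (\<lambda>x. ws n x - w x) \<le>
        2 * inverse (real (Suc n)) + 2 * quad Form (\<lambda>x. y n x - w x)" for n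
    proof -
      show ?thesis
        using closure.B_square_triangle_le[OF ws[of n] yD[of n] wD] y(2)[of n]
          closure.norm_diff_sym[OF ws[of n] yD[of n]] by simp
    qed
    show "0 \<le> quad Form (\<lambda>x. ws n x - w x)" for n
      by (intro closure.B_nonneg closure.V_diff ws wD)
  qed simp
qed

lemma approximates_AE:
  assumes us: "approximates M C \<E> us u" and "u \<in> L2 M" "v \<in> L2 M" "AE x in M. u x = v x"
  shows "approximates M C \<E> us v"
proof -
  have "sqnorm2 M (\<lambda>x. us n x - u x) = sqnorm2 M (\<lambda>x. us n x - v x)" for n
    using assms approximatesD(2)[OF us, of n] by (intro sqnorm2_cong_AE) (auto simp: L2_def)
  then show ?thesis using us by (simp add: approximates_def)
qed

end

section \<open>Sets of zero energy for forms with a square field\<close>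

text \<open>
  A closable form given by integrating a square field operator \<open>G\<close> on an algebra \<open>C\<close> of bounded
  functions.  Locality is the Leibniz rule; of the chain rule only the case of the sine is needed.
\<close>

locale diffusion_form = prob_space M for M :: "'b measure" +
  fixes C :: "('b \<Rightarrow> real) set" and G :: "('b \<Rightarrow> real) \<Rightarrow> ('b \<Rightarrow> real) \<Rightarrow> 'b \<Rightarrow> real"
  assumes C_measurable: "u \<in> C \<Longrightarrow> u \<in> borel_measurable M"
    and C_bounded: "u \<in> C \<Longrightarrow> \<exists>K. \<forall>x\<in>space M. \<bar>u x\<bar> \<le> K"
    and C_0: "(\<lambda>x. 0) \<in> C"
    and C_lin: "u \<in> C \<Longrightarrow> v \<in> C \<Longrightarrow> (\<lambda>x. a * u x + b * v x) \<in> C"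
    and C_mult: "u \<in> C \<Longrightarrow> v \<in> C \<Longrightarrow> (\<lambda>x. u x * v x) \<in> C"
    and C_sin: "u \<in> C \<Longrightarrow> (\<lambda>x. sin (u x)) \<in> C"
    and G_integrable: "u \<in> C \<Longrightarrow> v \<in> C \<Longrightarrow> integrable M (G u v)"
    and G_lin: "u \<in> C \<Longrightarrow> v \<in> C \<Longrightarrow> w \<in> C \<Longrightarrow> x \<in> space M \<Longrightarrow>
      G (\<lambda>y. a * u y + b * v y) w x = a * G u w x + b * G v w x"
    and G_sym: "u \<in> C \<Longrightarrow> v \<in> C \<Longrightarrow> x \<in> space M \<Longrightarrow> G u v x = G v u x"
    and G_nonneg: "u \<in> C \<Longrightarrow> x \<in> space M \<Longrightarrow> 0 \<le> G u u x"
    and G_mult: "u \<in> C \<Longrightarrow> v \<in> C \<Longrightarrow> w \<in> C \<Longrightarrow> x \<in> space M \<Longrightarrow>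
      G (\<lambda>y. u y * v y) w x = u x * G v w x + v x * G u w x"
    and G_sin: "u \<in> C \<Longrightarrow> w \<in> C \<Longrightarrow> x \<in> space M \<Longrightarrow>
      G (\<lambda>y. sin (u y)) w x = cos (u x) * G u w x"
    and closable_G: "closable M C (\<lambda>u v. \<integral>x. G u v x \<partial>M)"
begin

abbreviation En :: "'b form" where "En \<equiv> \<lambda>u v. \<integral>x. G u v x \<partial>M"

text \<open>
  For fixed \<open>x\<close> the square field is a semi-inner product.  Off the space nothing is assumed about \<open>G\<close>,
  and the form is taken to be zero.
\<close>

sublocale point: semi_inner C "\<lambda>u v. if x \<in> space M then G u v x else 0" for x
  by standard (auto intro: C_lin G_lin G_sym G_nonneg)

lemma En_closable_form: "closable_form C En M"
proof
  fix u v w :: "'b \<Rightarrow> real" and a b :: real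
  assume uv: "u \<in> C" "v \<in> C"
  show "(\<lambda>x. a * u x + b * v x) \<in> C" using uv by (rule C_lin)
  show "En u v = En v u" using uv G_sym by (intro Bochner_Integration.integral_cong) auto
  assume w: "w \<in> C"
  have "En (\<lambda>x. a * u x + b * v x) w = (\<integral>x. a * G u w x + b * G v w x \<partial>M)"
    using uv w G_lin by (intro Bochner_Integration.integral_cong) auto
  also have "\<dots> = a * En u w + b * En v w" using G_integrable uv w by simp
  finally show "En (\<lambda>x. a * u x + b * v x) w = a * En u w + b * En v w" .
next
  fix u assume "u \<in> C" then show "0 \<le> En u u" using G_nonneg by (intro integral_nonneg_AE) auto
next
  show "C \<subseteq> L2 M"
  proof
    fix u assume u: "u \<in> C"
    then obtain K where "\<forall>x\<in>space M. \<bar>u x\<bar> \<le> K" using C_bounded by blast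
    then show "u \<in> L2 M" using C_measurable[OF u] by (auto intro: L2_bounded)
  qed
qed (use closable_G C_0 in auto)

sublocale closable_form C En M
  by (rule En_closable_form)

lemma G_square_mult_le:
  assumes "u \<in> C" "v \<in> C" "x \<in> space M"
  shows "G (\<lambda>y. u y * v y) (\<lambda>y. u y * v y) x \<le> 2 * (v x)\<^sup>2 * G u u x + 2 * (u x)\<^sup>2 * G v v x"
proof -
  have m: "(\<lambda>y. u y * v y) \<in> C" using assms C_mult by blast
  have eq: "G (\<lambda>y. u y * v y) w x = G (\<lambda>y. v x * u y + u x * v y) w x" if "w \<in> C" for w
    using that assms by (simp add: G_mult G_lin)
  have l: "(\<lambda>y. v x * u y + u x * v y) \<in> C" using assms C_lin by blast
  have "G (\<lambda>y. u y * v y) (\<lambda>y. u y * v y) x = G (\<lambda>y. v x * u y + u x * v y) (\<lambda>y. v x * u y + u x * v y) x"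
    using eq[OF m] eq[OF l] G_sym[OF l m] assms(3) by simp
  also have "\<dots> \<le> 2 * (v x)\<^sup>2 * G u u x + 2 * (u x)\<^sup>2 * G v v x"
    using point.B_square_le[where x = x and a = "v x" and b = "u x", OF assms(1,2)] assms(3) by simp
  finally show ?thesis .
qed

lemma En_abs_le:
  assumes "u \<in> C" "v \<in> C"
  shows "(\<integral>x. \<bar>G u v x\<bar> \<partial>M) \<le> sqrt (En u u) * sqrt (En v v)"
proof -
  have [measurable]: "G u u \<in> borel_measurable M" "G v v \<in> borel_measurable M"
    using G_integrable assms by auto
  have L: "(\<lambda>x. sqrt (G w w x)) \<in> L2 M" "sqnorm2 M (\<lambda>x. sqrt (G w w x)) = En w w" if w: "w \<in> C" for w
  proof -
    have [measurable]: "G w w \<in> borel_measurable M" using G_integrable w by auto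
    have eq: "x \<in> space M \<Longrightarrow> (sqrt (G w w x))\<^sup>2 = G w w x" for x using G_nonneg w by simp
    show "sqnorm2 M (\<lambda>x. sqrt (G w w x)) = En w w"
      unfolding sqnorm2_def using eq by (intro Bochner_Integration.integral_cong) auto
    have "integrable M (\<lambda>x. (sqrt (G w w x))\<^sup>2) \<longleftrightarrow> integrable M (G w w)"
      using eq by (intro Bochner_Integration.integrable_cong) auto
    then show "(\<lambda>x. sqrt (G w w x)) \<in> L2 M" using G_integrable w by (auto simp: L2_def)
  qed
  have "(\<integral>x. \<bar>G u v x\<bar> \<partial>M) \<le> ip M (\<lambda>x. sqrt (G u u x)) (\<lambda>x. sqrt (G v v x))"
  proof (rule integral_mono)
    show "integrable M (\<lambda>x. \<bar>G u v x\<bar>)" using G_integrable assms by auto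
    show "integrable M (\<lambda>x. sqrt (G u u x) * sqrt (G v v x))"
      by (intro L2_integrable_mult L assms)
    fix x assume "x \<in> space M"
    then show "\<bar>G u v x\<bar> \<le> sqrt (G u u x) * sqrt (G v v x)"
      using point.Cauchy_Schwarz_sqrt[OF assms, of x] by simp
  qed
  also have "\<dots> \<le> sqrt (En u u) * sqrt (En v v)"
    using L2.Cauchy_Schwarz_sqrt[OF L(1)[OF assms(1)] L(1)[OF assms(2)]]
    unfolding sqnorm2_ip[symmetric] L(2)[OF assms(1)] L(2)[OF assms(2)] by linarith
  finally show ?thesis .
qed

text \<open>
  The assumption is the conclusion of the Rademacher property for the indicator of \<open>A\<close> with Lipschitz
  constant \<open>L\<close>.  The versions \<open>u\<close> and \<open>h\<close> may depend on \<open>L\<close>, but the energy of the indicator does not,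
  and it is at most \<open>L\<^sup>2\<close>.
\<close>

lemma zero_energy_approximation:
  assumes A: "A \<in> sets M"
    and L: "\<And>L. L > 0 \<Longrightarrow> \<exists>u h. u \<in> Dom \<and> (AE x in M. indicator A x = u x) \<and>
      square_field_version M C En G u u h \<and> (AE x in M. h x \<le> L\<^sup>2)"
  obtains us where "approximates M C En us (indicator A)" "(\<lambda>n. En (us n) (us n)) \<longlonglongrightarrow> 0"
proof -
  have eL2: "indicator A \<in> L2 M" using A by (intro L2_bounded[of _ 1]) (auto simp: indicator_def)
  have ex: "\<exists>us. approximates M C En us (indicator A) \<and> Form (indicator A) (indicator A) \<le> L\<^sup>2"
    if L0: "L > 0" for L
  proof -
    obtain u h where u: "u \<in> Dom" "AE x in M. indicator A x = u x" "square_field_version M C En G u u h"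
      "AE x in M. h x \<le> L\<^sup>2" using assms(2)[OF L0] by blast
    then obtain us vs where uv: "approximates M C En us u" "approximates M C En vs u"
      and h: "integrable M h" and lim: "(\<lambda>n. \<integral>x. \<bar>G (us n) (vs n) x - h x\<bar> \<partial>M) \<longlonglongrightarrow> 0"
      by (auto simp: square_field_version_def)
    have e: "approximates M C En us (indicator A)" "approximates M C En vs (indicator A)"
      using uv u(2) by (auto intro!: approximates_AE[OF _ Dom_L2[OF u(1)] eL2])
    have "(\<lambda>n. En (us n) (vs n)) \<longlonglongrightarrow> (\<integral>x. h x \<partial>M)"
    proof (rule LIM_zero_cancel, rule tendsto_rabs_zero_cancel, rule tendsto_0_by_bound[OF _ _ lim])
      show "\<bar>En (us n) (vs n) - (\<integral>x. h x \<partial>M)\<bar> \<le> (\<integral>x. \<bar>G (us n) (vs n) x - h x\<bar> \<partial>M)" for n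
      proof -
        have "integrable M (G (us n) (vs n))" using G_integrable approximatesD(1) e by blast
        then have "En (us n) (vs n) - (\<integral>x. h x \<partial>M) = (\<integral>x. G (us n) (vs n) x - h x \<partial>M)" using h by simp
        then show ?thesis
          using integral_abs_bound[of M "\<lambda>x. G (us n) (vs n) x - h x"] by simp
      qed
    qed auto
    then have "Form (indicator A) (indicator A) = (\<integral>x. h x \<partial>M)"
      using closure_form_tendsto[OF e eL2 eL2] LIMSEQ_unique by blast
    also have "\<dots> \<le> (\<integral>x. L\<^sup>2 \<partial>M)" using h u(4) by (intro integral_mono_AE) auto
    finally show ?thesis using e by (auto simp: prob_space)
  qed
  obtain us where us: "approximates M C En us (indicator A)" using ex[of 1] by auto
  have "Form (indicator A) (indicator A) \<le> 0 + L" if "L > 0" for L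
    using ex[of "sqrt L"] that by auto
  then have "Form (indicator A) (indicator A) \<le> 0" by (rule field_le_epsilon)
  moreover have "Form (indicator A) (indicator A) \<ge> 0" using us eL2 by (intro closure.B_nonneg DomI)
  ultimately have "Form (indicator A) (indicator A) = 0" by simp
  with that[OF us] closure_form_tendsto[OF us us eL2 eL2] show ?thesis by simp
qed

lemma zero_energy_bounded_approximation:
  assumes A: "A \<in> sets M"
    and L: "\<And>L. L > 0 \<Longrightarrow> \<exists>u h. u \<in> Dom \<and> (AE x in M. indicator A x = u x) \<and>
      square_field_version M C En G u u h \<and> (AE x in M. h x \<le> L\<^sup>2)"
  obtains s where "\<And>n::nat. s n \<in> C" "\<And>n x. \<bar>s n x\<bar> \<le> 1"
    "AE x in M. (\<lambda>n. s n x) \<longlonglongrightarrow> indicator A x" "(\<lambda>n. En (s n) (s n)) \<longlonglongrightarrow> 0"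
proof -
  obtain us where us: "approximates M C En us (indicator A)" and E0: "(\<lambda>n. En (us n) (us n)) \<longlonglongrightarrow> 0"
    using zero_energy_approximation[OF assms] by blast
  have eL2: "indicator A \<in> L2 M" using A by (intro L2_bounded[of _ 1]) (auto simp: indicator_def)
  note u = approximatesD[OF us]
  obtain r :: "nat \<Rightarrow> nat" where r: "strict_mono r" "AE x in M. (\<lambda>n. us (r n) x) \<longlonglongrightarrow> indicator A x"
    using L2_tendsto_AE_subseq[OF u(2) eL2 u(4)] by blast
  \<comment> \<open>The function \<open>sin ((\<pi>/2) \<cdot>)\<close> is bounded, Lipschitz and fixes the two values of an indicator.\<close>
  define w where "w n x = (pi / 2) * us (r n) x" for n x
  have wC: "w n \<in> C" for n unfolding w_def by (rule V_scale[OF u(1)])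
  have sC: "(\<lambda>x. sin (w n x)) \<in> C" for n by (rule C_sin[OF wC])
  have "AE x in M. (\<lambda>n. sin (w n x)) \<longlonglongrightarrow> indicator A x"
    using r(2)
  proof eventually_elim
    fix x assume "(\<lambda>n. us (r n) x) \<longlonglongrightarrow> indicator A x"
    then have "(\<lambda>n. sin (w n x)) \<longlonglongrightarrow> sin ((pi / 2) * indicator A x)"
      unfolding w_def by (intro tendsto_intros)
    then show "(\<lambda>n. sin (w n x)) \<longlonglongrightarrow> indicator A x" by (cases "x \<in> A") auto
  qed
  moreover have "(\<lambda>n. quad En (\<lambda>x. sin (w n x))) \<longlonglongrightarrow> 0"
  proof (rule tendsto_0_by_bound)
    show "(\<lambda>n. (pi / 2)\<^sup>2 * En (us (r n)) (us (r n))) \<longlonglongrightarrow> (pi / 2)\<^sup>2 * 0"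
      using LIMSEQ_subseq_LIMSEQ[OF E0 r(1)] by (intro tendsto_intros) (simp add: o_def)
    show "quad En (\<lambda>x. sin (w n x)) \<le> (pi / 2)\<^sup>2 * En (us (r n)) (us (r n))" for n
    proof -
      have "quad En (\<lambda>x. sin (w n x)) \<le> En (w n) (w n)"
      proof (intro integral_mono G_integrable sC wC)
        fix x assume x: "x \<in> space M"
        have "G (\<lambda>x. sin (w n x)) (\<lambda>x. sin (w n x)) x = (cos (w n x))\<^sup>2 * G (w n) (w n) x"
          using G_sin[OF wC sC x] G_sym[OF wC sC x] G_sin[OF wC wC x] by (simp add: power2_eq_square)
        also have "\<dots> \<le> 1 * G (w n) (w n) x"
          using G_nonneg[OF wC x] abs_cos_le_one by (intro mult_right_mono) (auto simp: abs_square_le_1)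
        finally show "G (\<lambda>x. sin (w n x)) (\<lambda>x. sin (w n x)) x \<le> G (w n) (w n) x" by simp
      qed
      also have "En (w n) (w n) = (pi / 2)\<^sup>2 * En (us (r n)) (us (r n))"
        using u(1)[of "r n"] wC[of n] unfolding w_def
        by (simp only: B_scale B_scale_right power2_eq_square mult.assoc)
      finally show ?thesis .
    qed
    show "0 \<le> quad En (\<lambda>x. sin (w n x))" for n by (rule B_nonneg[OF sC])
  qed simp
  ultimately show ?thesis using sC by (intro that[of "\<lambda>n x. sin (w n x)"]) auto
qed

end

text \<open>
  A set \<open>A\<close> of zero energy, given through uniformly bounded elements \<open>s n\<close> of the core that tend to its
  indicator almost everywhere and whose energies tend to 0.
\<close>

locale zero_energy_set = diffusion_form M C G
  for M :: "'b measure" and C :: "('b \<Rightarrow> real) set" and G +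
  fixes A :: "'b set" and s :: "nat \<Rightarrow> 'b \<Rightarrow> real"
  assumes A: "A \<in> sets M"
    and s_C: "s n \<in> C"
    and s_bound: "\<bar>s n x\<bar> \<le> 1"
    and s_lim: "AE x in M. (\<lambda>n. s n x) \<longlonglongrightarrow> indicator A x"
    and s_energy: "(\<lambda>n. En (s n) (s n)) \<longlonglongrightarrow> 0"
begin

lemma indicator_measurable [measurable]: "(indicator A :: 'b \<Rightarrow> real) \<in> borel_measurable M"
  using A by simp

lemma s_measurable [measurable]: "s n \<in> borel_measurable M"
  by (rule C_measurable[OF s_C])

lemma weighted_tendsto_0:
  assumes h: "integrable M h"
  shows "(\<lambda>n. \<integral>x. (s n x - indicator A x)\<^sup>2 * h x \<partial>M) \<longlonglongrightarrow> 0"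
    "integrable M (\<lambda>x. (s n x - indicator A x)\<^sup>2 * h x)"
proof -
  have [measurable]: "h \<in> borel_measurable M" using h by auto
  have bd: "norm ((s n x - indicator A x)\<^sup>2 * h x) \<le> norm (4 * h x)" for n x
  proof -
    have "\<bar>s n x - indicator A x\<bar> \<le> 2" using s_bound[of n x] by (auto simp: indicator_def abs_le_iff)
    then have "(s n x - indicator A x)\<^sup>2 \<le> 4" using power_mono[of "\<bar>s n x - indicator A x\<bar>" 2 2] by simp
    then have "\<bar>(s n x - indicator A x)\<^sup>2\<bar> * \<bar>h x\<bar> \<le> 4 * \<bar>h x\<bar>" by (intro mult_right_mono) auto
    then show ?thesis by (simp add: abs_mult)
  qed
  have "(\<lambda>n. \<integral>x. (s n x - indicator A x)\<^sup>2 * h x \<partial>M) \<longlonglongrightarrow> (\<integral>x. 0 \<partial>M)"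
  proof (rule integral_dominated_convergence[where w = "\<lambda>x. norm (4 * h x)"])
    show "AE x in M. (\<lambda>n. (s n x - indicator A x)\<^sup>2 * h x) \<longlonglongrightarrow> 0"
      using s_lim
    proof eventually_elim
      fix x assume "(\<lambda>n. s n x) \<longlonglongrightarrow> indicator A x"
      then have "(\<lambda>n. (s n x - indicator A x)\<^sup>2 * h x) \<longlonglongrightarrow> (indicator A x - indicator A x)\<^sup>2 * h x"
        by (intro tendsto_intros)
      then show "(\<lambda>n. (s n x - indicator A x)\<^sup>2 * h x) \<longlonglongrightarrow> 0" by simp
    qed
  qed (use bd h in auto)
  then show "(\<lambda>n. \<integral>x. (s n x - indicator A x)\<^sup>2 * h x \<partial>M) \<longlonglongrightarrow> 0" by simp
  show "integrable M (\<lambda>x. (s n x - indicator A x)\<^sup>2 * h x)"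
    by (rule Bochner_Integration.integrable_bound[where f = "\<lambda>x. 4 * h x"]) (use bd h in auto)
qed

lemma indicator_L2: "u \<in> L2 M \<Longrightarrow> (\<lambda>x. indicator A x * u x) \<in> L2 M"
  by (rule L2_bounded_mult[of _ _ _ 1], assumption, rule indicator_measurable) (auto simp: indicator_def)

lemma indicator_norm_le: "u \<in> L2 M \<Longrightarrow> sqnorm2 M (\<lambda>x. indicator A x * u x) \<le> sqnorm2 M u"
  using L2_bounded_mult(2)[of u M "indicator A" 1, OF _ indicator_measurable] by simp

text \<open>
  By the Leibniz rule the square field of \<open>(s i - s j) u\<close> is at most twice
  \<open>u\<^sup>2 G (s i - s j) + (s i - s j)\<^sup>2 G u\<close>.  The first term is small because the energies of the \<open>s n\<close> vanish
  and \<open>u\<close> is bounded, the second by dominated convergence.  This is why the \<open>s n\<close> must be uniformly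
  bounded: \<open>G u u\<close> is only integrable.
\<close>

lemma approximates_mult:
  assumes u: "u \<in> C"
  shows "approximates M C En (\<lambda>n x. s n x * u x) (\<lambda>x. indicator A x * u x)"
    "quad Form (\<lambda>x. indicator A x * u x) \<le> 2 * En u u"
proof -
  obtain K where K: "\<And>x. x \<in> space M \<Longrightarrow> \<bar>u x\<bar> \<le> K" using C_bounded[OF u] by blast
  have uL2: "u \<in> L2 M" using u C_L2 by blast
  have sq: "x \<in> space M \<Longrightarrow> (u x)\<^sup>2 \<le> K\<^sup>2" for x using power_mono[OF K, of x 2] by simp
  define c where "c n = (\<integral>x. (s n x - indicator A x)\<^sup>2 * G u u x \<partial>M)" for n
  have Guu: "integrable M (G u u)" by (rule G_integrable[OF u u])
  have c0: "c \<longlonglongrightarrow> 0" unfolding c_def by (rule weighted_tendsto_0[OF Guu])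
  have bound: "quad En (\<lambda>x. w x * u x) \<le> 2 * K\<^sup>2 * En w w + 2 * b"
    if w: "w \<in> C" and b: "\<And>x. x \<in> space M \<Longrightarrow> (w x)\<^sup>2 * G u u x \<le> g x" "integrable M g" "(\<integral>x. g x \<partial>M) \<le> b" for w g b
  proof -
    have "quad En (\<lambda>x. w x * u x) \<le> (\<integral>x. 2 * K\<^sup>2 * G w w x + 2 * g x \<partial>M)"
    proof (intro integral_mono G_integrable C_mult w u)
      show "integrable M (\<lambda>x. 2 * K\<^sup>2 * G w w x + 2 * g x)" using G_integrable[OF w w] b by auto
      fix x assume x: "x \<in> space M"
      have "G (\<lambda>x. w x * u x) (\<lambda>x. w x * u x) x \<le> 2 * (u x)\<^sup>2 * G w w x + 2 * (w x)\<^sup>2 * G u u x"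
        by (rule G_square_mult_le[OF w u x])
      also have "\<dots> \<le> 2 * K\<^sup>2 * G w w x + 2 * g x"
        using b(1)[OF x] sq[OF x] G_nonneg[OF w x] by (intro add_mono mult_right_mono) auto
      finally show "G (\<lambda>x. w x * u x) (\<lambda>x. w x * u x) x \<le> 2 * K\<^sup>2 * G w w x + 2 * g x" .
    qed
    also have "\<dots> = 2 * K\<^sup>2 * En w w + 2 * (\<integral>x. g x \<partial>M)" using G_integrable[OF w w] b by simp
    finally show ?thesis using b by simp
  qed
  have "form_Cauchy En (\<lambda>n x. s n x * u x)"
  proof (rule form_CauchyI_bound)
    fix i j
    have "quad En (\<lambda>x. (s i x - s j x) * u x) \<le>
        2 * K\<^sup>2 * quad En (\<lambda>x. s i x - s j x) + 2 * (2 * c i + 2 * c j)"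
    proof (rule bound)
      show "(\<lambda>x. s i x - s j x) \<in> C" by (intro V_diff s_C)
      show "integrable M (\<lambda>x. 2 * ((s i x - indicator A x)\<^sup>2 * G u u x) + 2 * ((s j x - indicator A x)\<^sup>2 * G u u x))"
        using weighted_tendsto_0(2)[OF Guu] by simp
      show "(\<integral>x. 2 * ((s i x - indicator A x)\<^sup>2 * G u u x) + 2 * ((s j x - indicator A x)\<^sup>2 * G u u x) \<partial>M) \<le> 2 * c i + 2 * c j"
        unfolding c_def using weighted_tendsto_0(2)[OF Guu] by simp
      fix x assume x: "x \<in> space M"
      have "(s i x - s j x)\<^sup>2 \<le> 2 * (s i x - indicator A x)\<^sup>2 + 2 * (s j x - indicator A x)\<^sup>2"
        using sum_squares_bound[of "s i x - indicator A x" "- (s j x - indicator A x)"]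
        by (simp add: power2_eq_square algebra_simps)
      from mult_right_mono[OF this G_nonneg[OF u x]]
      show "(s i x - s j x)\<^sup>2 * G u u x \<le> 2 * ((s i x - indicator A x)\<^sup>2 * G u u x) + 2 * ((s j x - indicator A x)\<^sup>2 * G u u x)"
        by (simp add: algebra_simps)
    qed
    also have "\<dots> \<le> 2 * K\<^sup>2 * (2 * En (s i) (s i) + 2 * En (s j) (s j)) + 2 * (2 * c i + 2 * c j)"
      by (intro add_mono mult_left_mono B_square_diff_le s_C) auto
    finally show "quad En (\<lambda>x. s i x * u x - s j x * u x) \<le>
      (4 * K\<^sup>2 * En (s i) (s i) + 4 * c i) + (4 * K\<^sup>2 * En (s j) (s j) + 4 * c j)"
      by (simp add: algebra_simps)
  next
    have "(\<lambda>n. 4 * K\<^sup>2 * En (s n) (s n) + 4 * c n) \<longlonglongrightarrow> 4 * K\<^sup>2 * 0 + 4 * 0"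
      by (intro tendsto_add tendsto_mult tendsto_const s_energy c0)
    then show "(\<lambda>n. 4 * K\<^sup>2 * En (s n) (s n) + 4 * c n) \<longlonglongrightarrow> 0" by simp
  qed
  moreover have "(\<lambda>n. sqnorm2 M (\<lambda>x. s n x * u x - indicator A x * u x)) \<longlonglongrightarrow> 0"
    using weighted_tendsto_0(1)[of "\<lambda>x. (u x)\<^sup>2"] uL2
    by (simp add: sqnorm2_def L2_def left_diff_distrib[symmetric] power_mult_distrib)
  ultimately show app: "approximates M C En (\<lambda>n x. s n x * u x) (\<lambda>x. indicator A x * u x)"
    by (auto simp: approximates_def intro!: C_mult s_C u)
  note eL2 = indicator_L2[OF uL2]
  show "quad Form (\<lambda>x. indicator A x * u x) \<le> 2 * En u u"
  proof (rule LIMSEQ_le[OF closure_form_tendsto[OF app app eL2 eL2]])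
    have "(\<lambda>n. 2 * K\<^sup>2 * En (s n) (s n) + 2 * En u u) \<longlonglongrightarrow> 2 * K\<^sup>2 * 0 + 2 * En u u"
      by (intro tendsto_add tendsto_mult tendsto_const s_energy)
    then show "(\<lambda>n. 2 * K\<^sup>2 * En (s n) (s n) + 2 * En u u) \<longlonglongrightarrow> 2 * En u u" by simp
    have "quad En (\<lambda>x. s n x * u x) \<le> 2 * K\<^sup>2 * En (s n) (s n) + 2 * En u u" for n
    proof (rule bound[OF s_C _ Guu])
      fix x assume x: "x \<in> space M"
      have "(s n x)\<^sup>2 \<le> 1" using s_bound[of n x] by (simp add: abs_square_le_1)
      from mult_right_mono[OF this G_nonneg[OF u x]] show "(s n x)\<^sup>2 * G u u x \<le> G u u x" by simp
    qed simp
    then show "\<exists>N. \<forall>n\<ge>N. quad En (\<lambda>x. s n x * u x) \<le> 2 * K\<^sup>2 * En (s n) (s n) + 2 * En u u"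
      by blast
  qed
qed

text \<open>
  The difference \<open>G (s u) v - G u (s v)\<close> equals \<open>u G s v - v G s u\<close>, whose integral is controlled by
  the energy of \<open>s\<close>.
\<close>

lemma Form_indicator_core:
  assumes u: "u \<in> C" and v: "v \<in> C"
  shows "Form (\<lambda>x. indicator A x * u x) v = Form u (\<lambda>x. indicator A x * v x)"
proof -
  obtain K where K: "\<And>x. x \<in> space M \<Longrightarrow> \<bar>u x\<bar> \<le> K" using C_bounded[OF u] by blast
  obtain K' where K': "\<And>x. x \<in> space M \<Longrightarrow> \<bar>v x\<bar> \<le> K'" using C_bounded[OF v] by blast
  have uL2: "u \<in> L2 M" and vL2: "v \<in> L2 M" using u v C_L2 by auto
  have 1: "(\<lambda>n. En (\<lambda>x. s n x * u x) v) \<longlonglongrightarrow> Form (\<lambda>x. indicator A x * u x) v"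
    by (intro closure_form_tendsto approximates_mult approximates_const u v indicator_L2 uL2 vL2)
  have 2: "(\<lambda>n. En u (\<lambda>x. s n x * v x)) \<longlonglongrightarrow> Form u (\<lambda>x. indicator A x * v x)"
    by (intro closure_form_tendsto approximates_mult approximates_const u v indicator_L2 uL2 vL2)
  have "(\<lambda>n. En (\<lambda>x. s n x * u x) v - En u (\<lambda>x. s n x * v x)) \<longlonglongrightarrow> 0"
  proof (rule tendsto_rabs_zero_cancel, rule tendsto_0_by_bound)
    show "(\<lambda>n. K * (sqrt (En (s n) (s n)) * sqrt (En v v)) + K' * (sqrt (En (s n) (s n)) * sqrt (En u u))) \<longlonglongrightarrow>
        K * (sqrt 0 * sqrt (En v v)) + K' * (sqrt 0 * sqrt (En u u))"
      by (intro tendsto_add tendsto_mult tendsto_const tendsto_real_sqrt s_energy)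
    show "\<bar>En (\<lambda>x. s n x * u x) v - En u (\<lambda>x. s n x * v x)\<bar> \<le>
        K * (sqrt (En (s n) (s n)) * sqrt (En v v)) + K' * (sqrt (En (s n) (s n)) * sqrt (En u u))" for n
    proof -
      have K0: "0 \<le> K" "0 \<le> K'" using K K' not_empty by (meson abs_ge_zero ex_in_conv order_trans)+
      have i: "integrable M (G (\<lambda>x. s n x * u x) v)" "integrable M (G u (\<lambda>x. s n x * v x))"
        "integrable M (G (s n) v)" "integrable M (G (s n) u)"
        by (intro G_integrable C_mult s_C u v)+
      have "En (\<lambda>x. s n x * u x) v - En u (\<lambda>x. s n x * v x) =
          (\<integral>x. G (\<lambda>x. s n x * u x) v x - G u (\<lambda>x. s n x * v x) x \<partial>M)" using i by simp
      also have "\<bar>\<dots>\<bar> \<le> (\<integral>x. \<bar>G (\<lambda>x. s n x * u x) v x - G u (\<lambda>x. s n x * v x) x\<bar> \<partial>M)"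
        by (rule integral_abs_bound)
      also have "\<dots> \<le> (\<integral>x. K * \<bar>G (s n) v x\<bar> + K' * \<bar>G (s n) u x\<bar> \<partial>M)"
      proof (rule integral_mono)
        fix x assume x: "x \<in> space M"
        have m: "(\<lambda>x. s n x * v x) \<in> C" by (intro C_mult s_C v)
        have "G (\<lambda>x. s n x * u x) v x - G u (\<lambda>x. s n x * v x) x = u x * G (s n) v x - v x * G (s n) u x"
          using G_mult[OF s_C u v x] G_sym[OF u m x] G_mult[OF s_C v u x] G_sym[OF u v x] by simp
        also have "\<bar>\<dots>\<bar> \<le> \<bar>u x\<bar> * \<bar>G (s n) v x\<bar> + \<bar>v x\<bar> * \<bar>G (s n) u x\<bar>"
          by (metis abs_mult abs_triangle_ineq4)
        also have "\<dots> \<le> K * \<bar>G (s n) v x\<bar> + K' * \<bar>G (s n) u x\<bar>"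
          using K[OF x] K'[OF x] by (intro add_mono mult_right_mono) auto
        finally show "\<bar>G (\<lambda>x. s n x * u x) v x - G u (\<lambda>x. s n x * v x) x\<bar> \<le> K * \<bar>G (s n) v x\<bar> + K' * \<bar>G (s n) u x\<bar>" .
      qed (use i in auto)
      also have "\<dots> = K * (\<integral>x. \<bar>G (s n) v x\<bar> \<partial>M) + K' * (\<integral>x. \<bar>G (s n) u x\<bar> \<partial>M)"
        using i by simp
      also have "\<dots> \<le> K * (sqrt (En (s n) (s n)) * sqrt (En v v)) + K' * (sqrt (En (s n) (s n)) * sqrt (En u u))"
        by (intro add_mono mult_left_mono En_abs_le s_C u v K0)
      finally show ?thesis .
    qed
  qed auto
  from LIMSEQ_unique[OF this tendsto_diff[OF 1 2]] show ?thesis by simp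
qed

lemma indicator_Dom_tendsto:
  assumes us: "approximates M C En us u" and u: "u \<in> L2 M"
  shows "(\<lambda>x. indicator A x * u x) \<in> Dom"
    "(\<lambda>n. quad Form (\<lambda>x. indicator A x * us n x - indicator A x * u x)) \<longlonglongrightarrow> 0"
    "(\<lambda>x. indicator A x * us n x) \<in> Dom"
proof -
  note a = approximatesD[OF us]
  show D: "(\<lambda>x. indicator A x * us n x) \<in> Dom" for n
    by (rule DomI[OF approximates_mult(1)[OF a(1)] indicator_L2[OF a(2)]])
  have "form_Cauchy Form (\<lambda>n x. indicator A x * us n x)"
    unfolding form_Cauchy_iff_le
  proof (intro allI impI)
    fix e :: real assume "0 < e"
    then have "0 < e / 2" by simp
    then obtain N where N: "\<forall>i\<ge>N. \<forall>j\<ge>N. quad En (\<lambda>x. us i x - us j x) < e / 2"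
      using a(3)[unfolded form_Cauchy_def, rule_format, of "e / 2"] by auto
    show "\<exists>N. \<forall>i\<ge>N. \<forall>j\<ge>N. quad Form (\<lambda>x. indicator A x * us i x - indicator A x * us j x) \<le> e"
    proof (intro exI[of _ N] allI impI)
      fix i j assume "N \<le> i" "N \<le> j"
      then have "quad En (\<lambda>x. us i x - us j x) < e / 2" using N by simp
      then show "quad Form (\<lambda>x. indicator A x * us i x - indicator A x * us j x) \<le> e"
        using approximates_mult(2)[OF V_diff[OF a(1)[of i] a(1)[of j]]]
        by (simp add: right_diff_distrib)
    qed
  qed
  moreover have "(\<lambda>n. sqnorm2 M (\<lambda>x. indicator A x * us n x - indicator A x * u x)) \<longlonglongrightarrow> 0"
  proof (rule tendsto_0_by_bound[OF _ _ a(4)])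
    show "sqnorm2 M (\<lambda>x. indicator A x * us n x - indicator A x * u x) \<le>
        sqnorm2 M (\<lambda>x. us n x - u x)" for n
    proof -
      show ?thesis
        using indicator_norm_le[OF L2.V_diff[OF a(2)[of n] u]] by (simp add: right_diff_distrib)
    qed
  qed auto
  ultimately show "(\<lambda>x. indicator A x * u x) \<in> Dom"
    "(\<lambda>n. quad Form (\<lambda>x. indicator A x * us n x - indicator A x * u x)) \<longlonglongrightarrow> 0"
    using Dom_closed[of "\<lambda>n x. indicator A x * us n x", OF D _ indicator_L2[OF u]] by auto
qed

lemma indicator_Dom: "u \<in> Dom \<Longrightarrow> (\<lambda>x. indicator A x * u x) \<in> Dom"
  using indicator_Dom_tendsto(1) DomE by blast

lemma Form_indicator:
  assumes "u \<in> Dom" "v \<in> Dom"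
  shows "Form (\<lambda>x. indicator A x * u x) v = Form u (\<lambda>x. indicator A x * v x)"
proof -
  obtain us where us: "approximates M C En us u" "u \<in> L2 M" using assms(1) by (rule DomE)
  obtain vs where vs: "approximates M C En vs v" "v \<in> L2 M" using assms(2) by (rule DomE)
  have usD: "us n \<in> Dom" and vsD: "vs n \<in> Dom" for n
    using approximatesD(1)[OF us(1)] approximatesD(1)[OF vs(1)] C_Dom by auto
  have 1: "(\<lambda>n. Form (\<lambda>x. indicator A x * us n x) (vs n)) \<longlonglongrightarrow> Form (\<lambda>x. indicator A x * u x) v"
    by (intro closure.B_tendsto indicator_Dom_tendsto[OF us] vsD assms approximates_Form_tendsto vs)
  have 2: "(\<lambda>n. Form (us n) (\<lambda>x. indicator A x * vs n x)) \<longlonglongrightarrow> Form u (\<lambda>x. indicator A x * v x)"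
    by (intro closure.B_tendsto indicator_Dom_tendsto[OF vs] usD assms approximates_Form_tendsto us)
  have "Form (\<lambda>x. indicator A x * us n x) (vs n) = Form (us n) (\<lambda>x. indicator A x * vs n x)" for n
    by (rule Form_indicator_core) (use approximatesD(1)[OF us(1)] approximatesD(1)[OF vs(1)] in auto)
  with 1 2 show ?thesis using LIMSEQ_unique by simp
qed

end

section \<open>Multiplication operators commuting with a generator\<close>

text \<open>
  The seminorm of \<open>L\<^sup>2\<close>.
\<close>

abbreviation nrm :: "'b measure \<Rightarrow> ('b \<Rightarrow> real) \<Rightarrow> real" where
  "nrm M f \<equiv> sqrt (sqnorm2 M f)"

lemma nrm_add_le: "f \<in> L2 M \<Longrightarrow> g \<in> L2 M \<Longrightarrow> nrm M (\<lambda>x. f x + g x) \<le> nrm M f + nrm M g"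
  using L2.norm_triangle by (simp add: sqnorm2_ip)

lemma nrm_diff_le: "f \<in> L2 M \<Longrightarrow> g \<in> L2 M \<Longrightarrow> nrm M (\<lambda>x. f x - g x) \<le> nrm M f + nrm M g"
  using nrm_add_le[of f M "\<lambda>x. - g x"] L2.V_scale[of g M "- 1"] by (simp add: sqnorm2_def)

lemma nrm_diff_triangle: "f \<in> L2 M \<Longrightarrow> g \<in> L2 M \<Longrightarrow> h \<in> L2 M \<Longrightarrow>
    nrm M (\<lambda>x. f x - h x) \<le> nrm M (\<lambda>x. f x - g x) + nrm M (\<lambda>x. g x - h x)"
  using L2.norm_diff_triangle by (simp add: sqnorm2_ip)

lemma nrm_diff_sym: "nrm M (\<lambda>x. f x - g x) = nrm M (\<lambda>x. g x - f x)"
  by (simp add: sqnorm2_def power2_commute)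

lemma nrm_reverse_triangle: "f \<in> L2 M \<Longrightarrow> g \<in> L2 M \<Longrightarrow> \<bar>nrm M f - nrm M g\<bar> \<le> nrm M (\<lambda>x. f x - g x)"
  using L2.norm_reverse_triangle by (simp add: sqnorm2_ip)

lemma nrm_scale: "nrm M (\<lambda>x. a * f x) = \<bar>a\<bar> * nrm M f"
  by (simp add: sqnorm2_def power_mult_distrib real_sqrt_mult)

lemma ip_abs_le: "f \<in> L2 M \<Longrightarrow> g \<in> L2 M \<Longrightarrow> \<bar>ip M f g\<bar> \<le> nrm M f * nrm M g"
  using L2.Cauchy_Schwarz_sqrt by (simp add: sqnorm2_ip)

lemma nrm_cong_AE: "f \<in> L2 M \<Longrightarrow> g \<in> L2 M \<Longrightarrow> AE x in M. f x = g x \<Longrightarrow> nrm M f = nrm M g"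
  using sqnorm2_cong_AE[of f M g] by (auto simp: L2_def)

text \<open>
  A continuous function that starts nonpositive and whose upper right Dini derivative is nowhere
  positive stays nonpositive.
\<close>

lemma Dini_nonpos:
  fixes \<psi> :: "real \<Rightarrow> real"
  assumes cont: "continuous_on {0..} \<psi>" and zero: "\<psi> 0 \<le> 0"
    and step: "\<And>t e. 0 \<le> t \<Longrightarrow> 0 < e \<Longrightarrow> \<exists>d>0. \<forall>r. 0 < r \<and> r < d \<longrightarrow> \<psi> (t + r) \<le> \<psi> t + e * r"
    and b: "0 \<le> b"
  shows "\<psi> b \<le> 0"
proof (rule field_le_epsilon)
  fix e :: real assume e: "0 < e"
  \<comment> \<open>The last time up to \<open>b\<close> at which \<open>\<psi>\<close> lies on or below the line of slope \<open>\<epsilon>\<close> must be \<open>b\<close> itself.\<close>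
  define \<epsilon> where "\<epsilon> = e / (b + 1)"
  have \<epsilon>: "0 < \<epsilon>" "\<epsilon> * b \<le> e" using e b by (auto simp: \<epsilon>_def field_simps)
  define Z where "Z = {t \<in> {0..b}. \<psi> t \<le> \<epsilon> * t}"
  have "continuous_on {0..b} \<psi>" using cont by (rule continuous_on_subset) auto
  then have "closed Z"
    unfolding Z_def by (intro continuous_on_closed_Collect_le continuous_intros) auto
  moreover have "bounded Z" unfolding Z_def by (rule bounded_subset[of "{0..b}"]) auto
  ultimately have "compact Z" by (simp add: compact_eq_bounded_closed)
  moreover have "0 \<in> Z" using zero b by (simp add: Z_def)
  ultimately have "\<exists>c\<in>Z. \<forall>t\<in>Z. t \<le> c" by (intro compact_attains_sup) auto
  then obtain c where c: "c \<in> Z" "\<And>t. t \<in> Z \<Longrightarrow> t \<le> c" by auto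
  have "c = b"
  proof (rule ccontr)
    assume "c \<noteq> b"
    then have cb: "0 \<le> c" "c < b" "\<psi> c \<le> \<epsilon> * c" using c(1) by (auto simp: Z_def)
    obtain d where d: "d > 0" "\<And>r. 0 < r \<Longrightarrow> r < d \<Longrightarrow> \<psi> (c + r) \<le> \<psi> c + \<epsilon> * r"
      using step[OF cb(1) \<epsilon>(1)] by blast
    define r where "r = min (d / 2) (b - c)"
    have r: "0 < r" "r < d" "c + r \<le> b" using d(1) cb by (auto simp: r_def)
    have "\<psi> (c + r) \<le> \<epsilon> * (c + r)" using d(2)[OF r(1,2)] cb(3) by (simp add: distrib_left)
    then have "c + r \<in> Z" using r cb by (auto simp: Z_def)
    then show False using c(2) r by fastforce
  qed
  then show "\<psi> b \<le> 0 + e" using c(1) \<epsilon> by (auto simp: Z_def)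
qed

text \<open>
  A strongly continuous contraction semigroup on \<open>L\<^sup>2\<close>, acting on representatives.
\<close>

locale L2_semigroup = prob_space M for M :: "'b measure" +
  fixes T :: "real \<Rightarrow> ('b \<Rightarrow> real) \<Rightarrow> ('b \<Rightarrow> real)"
  assumes T_L2: "0 \<le> t \<Longrightarrow> f \<in> L2 M \<Longrightarrow> T t f \<in> L2 M"
    and T_contr: "0 \<le> t \<Longrightarrow> f \<in> L2 M \<Longrightarrow> sqnorm2 M (T t f) \<le> sqnorm2 M f"
    and T_lin: "0 \<le> t \<Longrightarrow> f \<in> L2 M \<Longrightarrow> g \<in> L2 M \<Longrightarrow>
      AE x in M. T t (\<lambda>y. a * f y + b * g y) x = a * T t f x + b * T t g x"
    and T_0: "f \<in> L2 M \<Longrightarrow> AE x in M. T 0 f x = f x"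
    and T_add: "0 \<le> s \<Longrightarrow> 0 \<le> t \<Longrightarrow> f \<in> L2 M \<Longrightarrow> AE x in M. T (s + t) f x = T s (T t f) x"
    and T_cont: "f \<in> L2 M \<Longrightarrow> ((\<lambda>t. sqnorm2 M (\<lambda>x. T t f x - f x)) \<longlongrightarrow> 0) (at_right 0)"
begin

lemma T_contr_nrm: "0 \<le> t \<Longrightarrow> f \<in> L2 M \<Longrightarrow> nrm M (T t f) \<le> nrm M f"
  using T_contr by simp

lemma T_diff: "0 \<le> t \<Longrightarrow> f \<in> L2 M \<Longrightarrow> g \<in> L2 M \<Longrightarrow>
    AE x in M. T t (\<lambda>y. f y - g y) x = T t f x - T t g x"
  using T_lin[of t f g 1 "- 1"] by simp

lemma T_diff_nrm:
  assumes "0 \<le> t" "f \<in> L2 M" "g \<in> L2 M"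
  shows "nrm M (\<lambda>x. T t f x - T t g x) \<le> nrm M (\<lambda>x. f x - g x)"
proof -
  have "nrm M (\<lambda>x. T t f x - T t g x) = nrm M (T t (\<lambda>y. f y - g y))"
    using T_diff[OF assms] by (intro nrm_cong_AE T_L2 L2.V_diff assms) auto
  also have "\<dots> \<le> nrm M (\<lambda>x. f x - g x)" by (intro T_contr_nrm L2.V_diff assms)
  finally show ?thesis .
qed

lemma T_commute: "0 \<le> s \<Longrightarrow> 0 \<le> t \<Longrightarrow> f \<in> L2 M \<Longrightarrow> AE x in M. T s (T t f) x = T t (T s f) x"
  using T_add[of s t f] T_add[of t s f] by (auto simp: add.commute)

lemma T_cont_0:
  assumes f: "f \<in> L2 M" and e: "0 < e"
  obtains d where "d > 0" "\<And>r. 0 \<le> r \<Longrightarrow> r < d \<Longrightarrow> nrm M (\<lambda>x. T r f x - f x) < e"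
proof -
  have "((\<lambda>t. nrm M (\<lambda>x. T t f x - f x)) \<longlongrightarrow> sqrt 0) (at_right 0)"
    by (intro tendsto_real_sqrt T_cont f)
  then have "\<forall>\<^sub>F t in at_right 0. nrm M (\<lambda>x. T t f x - f x) < e"
    using e by (intro order_tendstoD(2)) auto
  then obtain d where d: "d > 0" "\<And>r. 0 < r \<Longrightarrow> r < d \<Longrightarrow> nrm M (\<lambda>x. T r f x - f x) < e"
    by (auto simp: eventually_at_right_field)
  have "nrm M (\<lambda>x. T 0 f x - f x) = nrm M (\<lambda>x. 0)"
    using T_0[OF f] L2.V_zero[OF f] by (intro nrm_cong_AE L2.V_diff T_L2 f) auto
  then have "nrm M (\<lambda>x. T 0 f x - f x) < e" using e by (simp add: sqnorm2_def)
  then show ?thesis using d by (intro that[OF d(1)]) (auto simp: order_le_less)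
qed

lemma T_increment:
  assumes "0 \<le> s" "0 \<le> t" "f \<in> L2 M"
  shows "nrm M (\<lambda>x. T s f x - T t f x) \<le> nrm M (\<lambda>x. T \<bar>s - t\<bar> f x - f x)"
proof -
  have *: "nrm M (\<lambda>x. T t f x - T s f x) \<le> nrm M (\<lambda>x. T (t - s) f x - f x)" if "0 \<le> s" "s \<le> t" for s t
  proof -
    have "nrm M (\<lambda>x. T t f x - T s f x) = nrm M (\<lambda>x. T s (T (t - s) f) x - T s f x)"
      using T_add[of s "t - s" f] that assms(3) by (intro nrm_cong_AE L2.V_diff T_L2) auto
    also have "\<dots> \<le> nrm M (\<lambda>x. T (t - s) f x - f x)" using that assms(3) by (intro T_diff_nrm T_L2) auto
    finally show ?thesis .
  qed
  show ?thesis
  proof (cases "s \<le> t")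
    case True
    then have "\<bar>s - t\<bar> = t - s" by simp
    then show ?thesis using *[of s t] True assms nrm_diff_sym[of M "T s f" "T t f"] by (simp only:)
  next
    case False
    then show ?thesis using *[of t s] assms by simp
  qed
qed

lemma T_ip_continuous:
  assumes f: "f \<in> L2 M" and w: "w \<in> L2 M"
  shows "continuous_on {0..} (\<lambda>s. ip M (T s f) w)"
  unfolding continuous_on_iff
proof (intro ballI allI impI)
  fix s e :: real assume s: "s \<in> {0..}" and e: "0 < e"
  define e' where "e' = e / (nrm M w + 1)"
  have n0: "nrm M w \<ge> 0" by simp
  then have p: "nrm M w + 1 > 0" by linarith
  have e': "0 < e'" "e' * nrm M w < e"
    using e p by (auto simp: e'_def pos_divide_less_eq distrib_left)
  obtain d where d: "d > 0" "\<And>r. 0 \<le> r \<Longrightarrow> r < d \<Longrightarrow> nrm M (\<lambda>x. T r f x - f x) < e'"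
    using T_cont_0[OF f e'(1)] by blast
  show "\<exists>d>0. \<forall>t\<in>{0..}. dist t s < d \<longrightarrow> dist (ip M (T t f) w) (ip M (T s f) w) < e"
  proof (intro exI[of _ d] conjI ballI impI d)
    fix t :: real assume t: "t \<in> {0..}" "dist t s < d"
    have L: "T s f \<in> L2 M" "T t f \<in> L2 M" using s t f T_L2 by auto
    have "dist (ip M (T t f) w) (ip M (T s f) w) = \<bar>ip M (\<lambda>x. T t f x - T s f x) w\<bar>"
      using L w by (simp add: dist_real_def L2.B_diff)
    also have "\<dots> \<le> nrm M (\<lambda>x. T t f x - T s f x) * nrm M w" by (intro ip_abs_le L2.V_diff L w)
    also have "\<dots> \<le> nrm M (\<lambda>x. T \<bar>t - s\<bar> f x - f x) * nrm M w"
      using s t f by (intro mult_right_mono T_increment) auto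
    also have "\<dots> \<le> e' * nrm M w"
      using t d(2)[of "\<bar>t - s\<bar>"] by (intro mult_right_mono) (auto simp: dist_real_def)
    also have "\<dots> < e" by (rule e')
    finally show "dist (ip M (T t f) w) (ip M (T s f) w) < e" .
  qed
qed

lemma T_nrm_continuous:
  assumes "f \<in> L2 M" "0 < e"
  obtains d where "d > 0" "\<And>s t. 0 \<le> s \<Longrightarrow> 0 \<le> t \<Longrightarrow> \<bar>s - t\<bar> < d \<Longrightarrow> nrm M (\<lambda>x. T s f x - T t f x) < e"
proof -
  obtain d where d: "d > 0" "\<And>r. 0 \<le> r \<Longrightarrow> r < d \<Longrightarrow> nrm M (\<lambda>x. T r f x - f x) < e"
    using T_cont_0[OF assms] by blast
  show ?thesis
  proof (rule that[OF d(1)])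
    fix s t :: real assume "0 \<le> s" "0 \<le> t" "\<bar>s - t\<bar> < d"
    then show "nrm M (\<lambda>x. T s f x - T t f x) < e"
      using le_less_trans[OF T_increment[OF _ _ assms(1)] d(2)[of "\<bar>s - t\<bar>"]] by simp
  qed
qed

text \<open>
  The element \<open>v\<close> is the mean of \<open>T\<^sub>s f\<close> over \<open>0 \<le> s \<le> \<delta>\<close>, defined weakly by the Riesz representation, so
  that only integrals of continuous real functions occur.
\<close>

lemma mean_in_generator_domain:
  assumes f: "f \<in> L2 M" and \<delta>: "0 < \<delta>"
  obtains v where "v \<in> L2 M" "generates M T v (\<lambda>x. (T \<delta> f x - f x) / \<delta>)"
    "\<And>w. w \<in> L2 M \<Longrightarrow> ip M v w = integral {0..\<delta>} (\<lambda>s. ip M (T s f) w) / \<delta>"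
proof -
  have cont: "continuous_on {a..b} (\<lambda>s. ip M (T s f) w)" if "0 \<le> a" "w \<in> L2 M" for a b w
    using T_ip_continuous[OF f that(2)] by (rule continuous_on_subset) (use that in auto)
  note int = integrable_continuous_real[OF cont]
  have "\<exists>v\<in>L2 M. \<forall>w\<in>L2 M. ip M v w = integral {0..\<delta>} (\<lambda>s. ip M (T s f) w) / \<delta>"
  proof (rule L2_Riesz[where K = "nrm M f"])
    fix u v :: "'b \<Rightarrow> real" and a b :: real
    assume uv: "u \<in> L2 M" "v \<in> L2 M"
    have "integral {0..\<delta>} (\<lambda>s. ip M (T s f) (\<lambda>x. a * u x + b * v x)) =
        integral {0..\<delta>} (\<lambda>s. a * ip M (T s f) u + b * ip M (T s f) v)"
      using uv f by (intro integral_cong L2.B_lin_right T_L2) auto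
    also have "\<dots> = a * integral {0..\<delta>} (\<lambda>s. ip M (T s f) u) + b * integral {0..\<delta>} (\<lambda>s. ip M (T s f) v)"
      using uv by (subst integral_add) (auto intro!: integrable_on_mult_right int)
    finally show "integral {0..\<delta>} (\<lambda>s. ip M (T s f) (\<lambda>x. a * u x + b * v x)) / \<delta> =
        a * (integral {0..\<delta>} (\<lambda>s. ip M (T s f) u) / \<delta>) + b * (integral {0..\<delta>} (\<lambda>s. ip M (T s f) v) / \<delta>)"
      by (simp add: add_divide_distrib)
  next
    fix u assume u: "u \<in> L2 M"
    have "norm (integral {0..\<delta>} (\<lambda>s. ip M (T s f) u)) \<le> (nrm M f * nrm M u) * (\<delta> - 0)"
    proof (rule integral_bound)
      fix t assume t: "t \<in> {0..\<delta>}"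
      then have "\<bar>ip M (T t f) u\<bar> \<le> nrm M (T t f) * nrm M u" using f u by (intro ip_abs_le T_L2) auto
      also have "\<dots> \<le> nrm M f * nrm M u" using t f by (intro mult_right_mono T_contr_nrm) auto
      finally show "norm (ip M (T t f) u) \<le> nrm M f * nrm M u" by simp
    qed (use \<delta> u in \<open>auto intro: cont\<close>)
    then show "\<bar>integral {0..\<delta>} (\<lambda>s. ip M (T s f) u) / \<delta>\<bar> \<le> nrm M f * nrm M u"
      using \<delta> by (simp add: field_simps)
  qed
  then obtain v where v: "v \<in> L2 M"
    "\<And>w. w \<in> L2 M \<Longrightarrow> ip M v w = integral {0..\<delta>} (\<lambda>s. ip M (T s f) w) / \<delta>" by blast
  have Tv: "ip M (T t v) w = integral {t..\<delta> + t} (\<lambda>s. ip M (T s f) w) / \<delta>" if t: "0 \<le> t" and w: "w \<in> L2 M" for t w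
  proof -
    \<comment> \<open>\<open>z\<close> is the image of \<open>w\<close> under the adjoint of \<open>T t\<close>.\<close>
    have "\<exists>z\<in>L2 M. \<forall>u\<in>L2 M. ip M z u = ip M (T t u) w"
    proof (rule L2_Riesz[where K = "nrm M w"])
      fix u v :: "'b \<Rightarrow> real" and a b :: real
      assume uv: "u \<in> L2 M" "v \<in> L2 M"
      have TL: "T t u \<in> L2 M" "T t v \<in> L2 M" "T t (\<lambda>x. a * u x + b * v x) \<in> L2 M"
        using uv t by (auto intro: T_L2 L2_lin)
      have "ip M (T t (\<lambda>x. a * u x + b * v x)) w = ip M (\<lambda>x. a * T t u x + b * T t v x) w"
        using T_lin[OF t uv, of a b] TL w by (intro integral_cong_AE) auto
      then show "ip M (T t (\<lambda>x. a * u x + b * v x)) w = a * ip M (T t u) w + b * ip M (T t v) w"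
        using TL w by (simp add: L2.B_lin)
    next
      fix u assume u: "u \<in> L2 M"
      have "\<bar>ip M (T t u) w\<bar> \<le> nrm M (T t u) * nrm M w" using t u w by (intro ip_abs_le T_L2) auto
      also have "\<dots> \<le> nrm M u * nrm M w" using t u by (intro mult_right_mono T_contr_nrm) auto
      finally show "\<bar>ip M (T t u) w\<bar> \<le> nrm M w * nrm M u" by (simp add: mult.commute)
    qed
    then obtain z where z: "z \<in> L2 M" "\<And>u. u \<in> L2 M \<Longrightarrow> ip M z u = ip M (T t u) w" by blast
    have "ip M (T t v) w = ip M v z" using z v by (simp add: mult.commute)
    also have "\<dots> = integral {0..\<delta>} (\<lambda>s. ip M (T s f) z) / \<delta>" by (rule v(2)[OF z(1)])
    also have "integral {0..\<delta>} (\<lambda>s. ip M (T s f) z) = integral {0..\<delta>} ((\<lambda>s. ip M (T s f) w) \<circ> ((+) t))"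
    proof (rule integral_cong)
      fix s assume s: "s \<in> {0..\<delta>}"
      then have L: "T s f \<in> L2 M" "T (t + s) f \<in> L2 M" "T t (T s f) \<in> L2 M" using f t by (auto intro: T_L2)
      have "ip M (T s f) z = ip M (T t (T s f)) w" using z(2)[OF L(1)] by (simp add: mult.commute)
      also have "\<dots> = ip M (T (t + s) f) w"
        using T_add[of t s f] s t f L w by (intro integral_cong_AE) auto
      finally show "ip M (T s f) z = ((\<lambda>s. ip M (T s f) w) \<circ> ((+) t)) s" by simp
    qed
    also have "\<dots> = integral {0 + t..\<delta> + t} (\<lambda>s. ip M (T s f) w)" by (rule integral_shift_Icc_real)
    finally show ?thesis by simp
  qed
  define h where "h x = (T \<delta> f x - f x) / \<delta>" for x
  have h: "h \<in> L2 M" unfolding h_def using L2_lin[OF T_L2[of \<delta> f] f, of "1 / \<delta>" "- 1 / \<delta>"] \<delta> f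
    by (simp add: diff_divide_distrib)
  have key: "nrm M (\<lambda>x. (T t v x - v x) / t - h x) \<le> 2 * e / \<delta>"
    if t: "0 < t" "t \<le> \<delta>" and e: "\<And>r. 0 \<le> r \<Longrightarrow> r \<le> t \<Longrightarrow> nrm M (\<lambda>x. T r f x - f x) \<le> e" for t e
  proof -
    \<comment> \<open>The norm of \<open>g\<close> is estimated by testing \<open>g\<close> against itself.\<close>
    define g where "g x = (T t v x - v x) / t - h x" for x
    have Tvl: "T t v \<in> L2 M" using t v by (auto intro: T_L2)
    have g_eq: "g = (\<lambda>x. (1 / t) * (T t v x - v x) + (- 1 / \<delta>) * (T \<delta> f x - f x))"
      by (auto simp: g_def h_def)
    have gL: "g \<in> L2 M" unfolding g_eq using \<delta> t f v by (intro L2_lin L2.V_diff T_L2) auto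
    let ?\<phi> = "\<lambda>s. ip M (T s f) g"
    have ip0: "ip M f g = ?\<phi> 0" using T_0[OF f] T_L2[of 0 f] f gL by (intro integral_cong_AE) auto
    have "ip M g g = (1 / t) * (ip M (T t v) g - ip M v g) + (- 1 / \<delta>) * (?\<phi> \<delta> - ip M f g)"
      (is "_ = ?R")
    proof -
      have "ip M (\<lambda>x. (1 / t) * (T t v x - v x) + (- 1 / \<delta>) * (T \<delta> f x - f x)) g = ?R"
        using Tvl v f gL T_L2[of \<delta> f] \<delta> by (simp only: L2.B_lin L2.V_diff L2.B_diff less_imp_le)
      moreover have "g x = (1 / t) * (T t v x - v x) + (- 1 / \<delta>) * (T \<delta> f x - f x)" for x
        by (simp add: g_def h_def)
      ultimately show ?thesis by (simp only:)
    qed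
    also have "ip M (T t v) g - ip M v g = (integral {t..\<delta> + t} ?\<phi> - integral {0..\<delta>} ?\<phi>) / \<delta>"
      using Tv[of t g] v(2)[of g] t gL by (simp add: diff_divide_distrib)
    also have "integral {t..\<delta> + t} ?\<phi> - integral {0..\<delta>} ?\<phi> = integral {\<delta>..\<delta> + t} ?\<phi> - integral {0..t} ?\<phi>"
      using Henstock_Kurzweil_Integration.integral_combine[of t \<delta> "\<delta> + t" ?\<phi>]
        Henstock_Kurzweil_Integration.integral_combine[of 0 t \<delta> ?\<phi>] int[OF _ gL] t by simp
    also have "\<dots> = (integral {\<delta>..\<delta> + t} (\<lambda>s. ?\<phi> s - ?\<phi> \<delta>) + t * ?\<phi> \<delta>) - (integral {0..t} (\<lambda>s. ?\<phi> s - ?\<phi> 0) + t * ?\<phi> 0)"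
      using int[OF _ gL] t \<delta> by (subst (1 2) Henstock_Kurzweil_Integration.integral_diff) auto
    also have "(1 / t) * (\<dots> / \<delta>) + (- 1 / \<delta>) * (?\<phi> \<delta> - ip M f g) =
        (integral {\<delta>..\<delta> + t} (\<lambda>s. ?\<phi> s - ?\<phi> \<delta>) - integral {0..t} (\<lambda>s. ?\<phi> s - ?\<phi> 0)) / (t * \<delta>)"
      unfolding ip0 using t \<delta> by (simp add: field_simps)
    also have "\<dots> \<le> (2 * (e * nrm M g) * t) / (t * \<delta>)"
    proof (rule divide_right_mono)
      have bd: "norm (?\<phi> (a + s) - ?\<phi> a) \<le> e * nrm M g" if "0 \<le> s" "s \<le> t" "0 \<le> a" for a s
      proof -
        have L: "T (a + s) f \<in> L2 M" "T a f \<in> L2 M" using that f by (auto intro: T_L2)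
        have "norm (?\<phi> (a + s) - ?\<phi> a) = \<bar>ip M (\<lambda>x. T (a + s) f x - T a f x) g\<bar>"
          using L gL by (simp add: L2.B_diff)
        also have "\<dots> \<le> nrm M (\<lambda>x. T (a + s) f x - T a f x) * nrm M g" by (intro ip_abs_le L2.V_diff L gL)
        also have "\<dots> \<le> e * nrm M g"
        proof (rule mult_right_mono)
          have "nrm M (\<lambda>x. T (a + s) f x - T a f x) \<le> nrm M (\<lambda>x. T s f x - f x)"
            using T_increment[of "a + s" a f] that f by simp
          then show "nrm M (\<lambda>x. T (a + s) f x - T a f x) \<le> e"
            using e[OF that(1,2)] by (rule order_trans)
        qed simp
        finally show ?thesis .
      qed
      have "norm (integral {\<delta>..\<delta> + t} (\<lambda>s. ?\<phi> s - ?\<phi> \<delta>)) \<le> (e * nrm M g) * (\<delta> + t - \<delta>)"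
      proof (rule integral_bound)
        fix s assume "s \<in> {\<delta>..\<delta> + t}"
        then show "norm (?\<phi> s - ?\<phi> \<delta>) \<le> e * nrm M g" using bd[of "s - \<delta>" \<delta>] \<delta> by simp
      qed (use t \<delta> gL in \<open>auto intro!: continuous_intros cont\<close>)
      moreover have "norm (integral {0..t} (\<lambda>s. ?\<phi> s - ?\<phi> 0)) \<le> (e * nrm M g) * (t - 0)"
      proof (rule integral_bound)
        fix s assume "s \<in> {0..t}"
        then show "norm (?\<phi> s - ?\<phi> 0) \<le> e * nrm M g" using bd[of s 0] by simp
      qed (use t gL in \<open>auto intro!: continuous_intros cont\<close>)
      ultimately show "integral {\<delta>..\<delta> + t} (\<lambda>s. ?\<phi> s - ?\<phi> \<delta>) - integral {0..t} (\<lambda>s. ?\<phi> s - ?\<phi> 0) \<le> 2 * (e * nrm M g) * t"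
        by (simp add: abs_le_iff)
    qed (use t \<delta> in simp)
    also have "\<dots> = (2 * e / \<delta>) * nrm M g" using t by simp
    finally have *: "(nrm M g)\<^sup>2 \<le> (2 * e / \<delta>) * nrm M g" by (simp add: sqnorm2_ip[symmetric])
    have e0: "0 \<le> e" using order_trans[OF real_sqrt_ge_zero[OF sqnorm2_nonneg] e[of 0]] t by simp
    show ?thesis
    proof (cases "nrm M g = 0")
      case True then show ?thesis using e0 \<delta> by (simp add: g_def[abs_def])
    next
      case False
      then have pos: "nrm M g > 0" using real_sqrt_ge_zero[OF sqnorm2_nonneg[of M g]] by linarith
      have "nrm M g * nrm M g \<le> (2 * e / \<delta>) * nrm M g"
        using * by (simp only: power2_eq_square)
      then have "nrm M g \<le> 2 * e / \<delta>" using pos by (rule mult_right_le_imp_le)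
      then show ?thesis by (simp add: g_def[abs_def])
    qed
  qed
  have "((\<lambda>t. nrm M (\<lambda>x. (T t v x - v x) / t - h x)) \<longlongrightarrow> 0) (at_right 0)"
  proof (rule order_tendstoI)
    fix a :: real assume "a < 0"
    then show "\<forall>\<^sub>F t in at_right 0. a < nrm M (\<lambda>x. (T t v x - v x) / t - h x)"
      by (intro always_eventually allI) (rule less_le_trans[of a 0], simp_all)
  next
    fix a :: real assume a: "0 < a"
    then have "0 < a * \<delta> / 4" using \<delta> by simp
    then obtain d where d: "d > 0" "\<And>r. 0 \<le> r \<Longrightarrow> r < d \<Longrightarrow> nrm M (\<lambda>x. T r f x - f x) < a * \<delta> / 4"
      using T_cont_0[OF f] by blast
    have "\<forall>\<^sub>F t in at_right 0. 0 < t \<and> t < min d \<delta>"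
      unfolding eventually_at_right_field using d(1) \<delta> by (intro exI[of _ "min d \<delta>"]) simp
    then show "\<forall>\<^sub>F t in at_right 0. nrm M (\<lambda>x. (T t v x - v x) / t - h x) < a"
    proof eventually_elim
      fix t assume t: "0 < t \<and> t < min d \<delta>"
      have "nrm M (\<lambda>x. (T t v x - v x) / t - h x) \<le> 2 * (a * \<delta> / 4) / \<delta>"
        by (rule key) (use t d(2) in \<open>auto intro!: less_imp_le\<close>)
      also have "\<dots> < a" using a \<delta> by simp
      finally show "nrm M (\<lambda>x. (T t v x - v x) / t - h x) < a" .
    qed
  qed
  then have "((\<lambda>t. (nrm M (\<lambda>x. (T t v x - v x) / t - h x))\<^sup>2) \<longlongrightarrow> 0\<^sup>2) (at_right 0)"
    by (rule tendsto_power)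
  then have "generates M T v h" unfolding generates_def by simp
  then show ?thesis by (intro that[OF v(1) _ v(2)]) (simp_all add: h_def[abs_def])
qed

lemma generator_domain_dense:
  assumes f: "f \<in> L2 M" and e: "0 < e"
  obtains u h where "u \<in> L2 M" "h \<in> L2 M" "generates M T u h" "nrm M (\<lambda>x. f x - u x) < e"
proof -
  obtain d where d: "d > 0" "\<And>r. 0 \<le> r \<Longrightarrow> r < d \<Longrightarrow> nrm M (\<lambda>x. T r f x - f x) < e / 2"
    using T_cont_0[OF f, of "e / 2"] e by auto
  define \<delta> where "\<delta> = d / 2"
  have \<delta>: "0 < \<delta>" "\<delta> < d" using d(1) by (auto simp: \<delta>_def)
  obtain v where v: "v \<in> L2 M" "generates M T v (\<lambda>x. (T \<delta> f x - f x) / \<delta>)"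
    "\<And>w. w \<in> L2 M \<Longrightarrow> ip M v w = integral {0..\<delta>} (\<lambda>s. ip M (T s f) w) / \<delta>"
    using mean_in_generator_domain[OF f \<delta>(1)] by blast
  have h: "(\<lambda>x. (T \<delta> f x - f x) / \<delta>) \<in> L2 M"
    using L2_lin[OF T_L2[of \<delta> f] f, of "1 / \<delta>" "- 1 / \<delta>"] \<delta> f by (simp add: diff_divide_distrib)
  define w where "w x = v x - f x" for x
  have w: "w \<in> L2 M" unfolding w_def by (intro L2.V_diff v f)
  have cont: "continuous_on {0..\<delta>} (\<lambda>s. ip M (T s f) w)"
    using T_ip_continuous[OF f w] by (rule continuous_on_subset) auto
  have "norm (integral {0..\<delta>} (\<lambda>s. ip M (T s f) w - ip M f w)) \<le> (e / 2 * nrm M w) * (\<delta> - 0)"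
  proof (rule integral_bound)
    show "continuous_on {0..\<delta>} (\<lambda>s. ip M (T s f) w - ip M f w)" by (intro continuous_intros cont)
    fix s assume s: "s \<in> {0..\<delta>}"
    then have L: "T s f \<in> L2 M" using f by (auto intro: T_L2)
    have "norm (ip M (T s f) w - ip M f w) = \<bar>ip M (\<lambda>x. T s f x - f x) w\<bar>"
      using L f w by (simp add: L2.B_diff)
    also have "\<dots> \<le> nrm M (\<lambda>x. T s f x - f x) * nrm M w" by (intro ip_abs_le L2.V_diff L f w)
    also have "\<dots> \<le> e / 2 * nrm M w" using d(2)[of s] s \<delta> by (intro mult_right_mono) auto
    finally show "norm (ip M (T s f) w - ip M f w) \<le> e / 2 * nrm M w" .
  qed (use \<delta> in simp)
  moreover have "integral {0..\<delta>} (\<lambda>s. ip M (T s f) w - ip M f w) = \<delta> * ip M w w"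
  proof -
    have "integral {0..\<delta>} (\<lambda>s. ip M (T s f) w - ip M f w) = \<delta> * ip M v w - \<delta> * ip M f w"
      using integrable_continuous_real[OF cont] v(3)[OF w] \<delta>
      by (subst Henstock_Kurzweil_Integration.integral_diff) auto
    also have "\<dots> = \<delta> * ip M (\<lambda>x. v x - f x) w" using v f w by (simp add: L2.B_diff right_diff_distrib)
    finally show ?thesis by (simp add: w_def)
  qed
  ultimately have "\<delta> * sqnorm2 M w \<le> \<delta> * (e / 2 * nrm M w)"
    by (simp add: sqnorm2_ip[symmetric] mult.commute abs_le_iff)
  then have *: "(nrm M w)\<^sup>2 \<le> e / 2 * nrm M w" using \<delta> by simp
  have "nrm M w < e"
  proof (rule ccontr)
    assume "\<not> nrm M w < e"
    then have "0 < nrm M w" "e / 2 < nrm M w" using e by linarith+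
    then have "e / 2 * nrm M w < nrm M w * nrm M w" by (intro mult_strict_right_mono)
    then show False using * by (simp add: power2_eq_square)
  qed
  then have "nrm M (\<lambda>x. f x - v x) < e" using nrm_diff_sym[of M v f] by (simp add: w_def[abs_def])
  then show ?thesis by (rule that[OF v(1) h v(2)])
qed

lemma generates_nrm:
  assumes "generates M T u h"
  shows "((\<lambda>t. nrm M (\<lambda>x. (T t u x - u x) / t - h x)) \<longlongrightarrow> 0) (at_right 0)"
  using tendsto_real_sqrt[OF assms[unfolded generates_def]] by simp

lemma generates_T:
  assumes u: "u \<in> L2 M" and h: "h \<in> L2 M" and g: "generates M T u h" and t: "0 \<le> t"
  shows "generates M T (T t u) (T t h)"
  unfolding generates_def
proof (rule tendsto_sandwich[OF _ _ tendsto_const g[unfolded generates_def]])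
  show "\<forall>\<^sub>F r in at_right 0. sqnorm2 M (\<lambda>x. (T r (T t u) x - T t u x) / r - T t h x) \<le>
      sqnorm2 M (\<lambda>x. (T r u x - u x) / r - h x)"
    using eventually_at_right_less[of "0::real"]
  proof eventually_elim
    fix r :: real assume r: "0 < r"
    have L: "T r u \<in> L2 M" "T t u \<in> L2 M" "T r (T t u) \<in> L2 M" "T t h \<in> L2 M" "T t (T r u) \<in> L2 M"
      using u h t r T_L2[OF t T_L2[of r u]] by (auto intro: T_L2)
    let ?q = "\<lambda>x. (1 / r) * (T r u x - u x) + (- 1) * h x"
    have q: "?q \<in> L2 M" by (intro L2_lin L2.V_diff L u h)
    have "sqnorm2 M (\<lambda>x. (1 / r) * (T r (T t u) x - T t u x) + (- 1) * T t h x) = sqnorm2 M (T t ?q)"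
    proof (rule sqnorm2_cong_AE)
      show "(\<lambda>x. (1 / r) * (T r (T t u) x - T t u x) + (- 1) * T t h x) \<in> borel_measurable M"
        by (intro L2_measurable L2_lin L2.V_diff L)
      show "T t ?q \<in> borel_measurable M" using q t by (intro L2_measurable T_L2)
      show "AE x in M. (1 / r) * (T r (T t u) x - T t u x) + (- 1) * T t h x = T t ?q x"
        using T_lin[OF t L2.V_diff[OF L(1) u] h, of "1 / r" "- 1"] T_diff[OF t L(1) u] T_commute[of r t u] r t u
        by auto
    qed
    also have "\<dots> \<le> sqnorm2 M ?q" by (rule T_contr[OF t q])
    finally show "sqnorm2 M (\<lambda>x. (T r (T t u) x - T t u x) / r - T t h x) \<le>
      sqnorm2 M (\<lambda>x. (T r u x - u x) / r - h x)" by simp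
  qed
qed auto

text \<open>
  For \<open>u\<close> in the domain of the generator let \<open>w t\<close> be the commutator of \<open>T t\<close> with the indicator, applied
  to \<open>u\<close>.  Then \<open>w (t + r)\<close> is \<open>T r (w t)\<close> up to an error that is \<open>o(r)\<close> in norm, since the indicator
  commutes with the generator; so the norm of \<open>w t\<close> does not grow.
\<close>

lemma indicator_commutes_core:
  assumes A: "A \<in> sets M"
    and comm: "\<And>u h. u \<in> L2 M \<Longrightarrow> h \<in> L2 M \<Longrightarrow> generates M T u h \<Longrightarrow>
      generates M T (\<lambda>x. indicator A x * u x) (\<lambda>x. indicator A x * h x)"
    and u: "u \<in> L2 M" and h: "h \<in> L2 M" and g: "generates M T u h" and t: "0 \<le> t"
  shows "nrm M (\<lambda>x. indicator A x * T t u x - T t (\<lambda>y. indicator A y * u y) x) = 0"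
proof -
  let ?P = "\<lambda>f x. indicator A x * f x :: real"
  have [measurable]: "(indicator A :: 'b \<Rightarrow> real) \<in> borel_measurable M" using A by simp
  have P: "?P f \<in> L2 M" "nrm M (?P f) \<le> nrm M f" if "f \<in> L2 M" for f
    using L2_bounded_mult[OF that, of "indicator A" 1] by auto
  define w where "w t x = ?P (T t u) x - T t (?P u) x" for t x
  define \<psi> where "\<psi> t = nrm M (w t)" for t
  have wL: "w t \<in> L2 M" if "0 \<le> t" for t unfolding w_def using that u by (intro L2.V_diff P T_L2) auto
  have "\<psi> t \<le> 0"
  proof (rule Dini_nonpos[OF _ _ _ t])
    show "continuous_on {0..} \<psi>"
      unfolding continuous_on_iff
    proof (intro ballI allI impI)
      fix s e :: real assume s: "s \<in> {0..}" and e: "0 < e"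
      obtain d1 where d1: "d1 > 0" "\<And>s t. 0 \<le> s \<Longrightarrow> 0 \<le> t \<Longrightarrow> \<bar>s - t\<bar> < d1 \<Longrightarrow> nrm M (\<lambda>x. T s u x - T t u x) < e / 2"
        using T_nrm_continuous[OF u, of "e / 2"] e by auto
      obtain d2 where d2: "d2 > 0" "\<And>s t. 0 \<le> s \<Longrightarrow> 0 \<le> t \<Longrightarrow> \<bar>s - t\<bar> < d2 \<Longrightarrow> nrm M (\<lambda>x. T s (?P u) x - T t (?P u) x) < e / 2"
        using T_nrm_continuous[OF P(1)[OF u], of "e / 2"] e by auto
      show "\<exists>d>0. \<forall>t\<in>{0..}. dist t s < d \<longrightarrow> dist (\<psi> t) (\<psi> s) < e"
      proof (intro exI[of _ "min d1 d2"] conjI ballI impI)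
        fix t :: real assume t: "t \<in> {0..}" "dist t s < min d1 d2"
        have L: "T t u \<in> L2 M" "T s u \<in> L2 M" "T t (?P u) \<in> L2 M" "T s (?P u) \<in> L2 M"
          using t s P(1)[OF u] u by (auto intro: T_L2)
        have "dist (\<psi> t) (\<psi> s) \<le> nrm M (\<lambda>x. w t x - w s x)"
          unfolding \<psi>_def dist_real_def by (intro nrm_reverse_triangle wL) (use t s in auto)
        also have "(\<lambda>x. w t x - w s x) = (\<lambda>x. ?P (\<lambda>x. T t u x - T s u x) x - (T t (?P u) x - T s (?P u) x))"
          by (auto simp: w_def algebra_simps)
        also have "nrm M \<dots> \<le> nrm M (?P (\<lambda>x. T t u x - T s u x)) + nrm M (\<lambda>x. T t (?P u) x - T s (?P u) x)"
          by (intro nrm_diff_le P L2.V_diff L)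
        also have "\<dots> \<le> nrm M (\<lambda>x. T t u x - T s u x) + nrm M (\<lambda>x. T t (?P u) x - T s (?P u) x)"
          by (intro add_right_mono P L2.V_diff L)
        also have "\<dots> < e"
          using d1(2)[of t s] d2(2)[of t s] t s by (simp add: dist_real_def)
        finally show "dist (\<psi> t) (\<psi> s) < e" .
      qed (use d1 d2 in auto)
    qed
    have "nrm M (w 0) = nrm M (\<lambda>x. 0)"
      using T_0[OF u] T_0[OF P(1)[OF u]] L2.V_zero[OF u]
      by (intro nrm_cong_AE wL) (auto simp: w_def)
    then show "\<psi> 0 \<le> 0" by (simp add: \<psi>_def sqnorm2_def)
    fix t e :: real assume t: "0 \<le> t" and e: "0 < e"
    define y where "y = T t u"
    define k where "k = T t h"
    have y: "y \<in> L2 M" "k \<in> L2 M" unfolding y_def k_def using u h t by (auto intro: T_L2)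
    have gy: "generates M T y k" unfolding y_def k_def by (rule generates_T[OF u h g t])
    have gPy: "generates M T (?P y) (?P k)" by (rule comm[OF y gy])
    have "\<forall>\<^sub>F r in at_right 0. 0 < r \<and> nrm M (\<lambda>x. (T r y x - y x) / r - k x) < e / 2 \<and>
        nrm M (\<lambda>x. (T r (?P y) x - ?P y x) / r - ?P k x) < e / 2"
      using e by (intro eventually_conj eventually_at_right_less order_tendstoD(2)[OF generates_nrm[OF gy]]
        order_tendstoD(2)[OF generates_nrm[OF gPy]]) auto
    then obtain d where d: "d > 0" "\<And>r. 0 < r \<Longrightarrow> r < d \<Longrightarrow> nrm M (\<lambda>x. (T r y x - y x) / r - k x) < e / 2 \<and>
        nrm M (\<lambda>x. (T r (?P y) x - ?P y x) / r - ?P k x) < e / 2"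
      by (auto simp: eventually_at_right_field)
    have "\<psi> (t + r) \<le> \<psi> t + e * r" if r: "0 < r" "r < d" for r
    proof -
      have L: "T r y \<in> L2 M" "T r (?P y) \<in> L2 M" "?P y \<in> L2 M" "?P k \<in> L2 M" "?P (T r y) \<in> L2 M"
        "T t (?P u) \<in> L2 M" "T (t + r) (?P u) \<in> L2 M" "T (t + r) u \<in> L2 M" "T r (w t) \<in> L2 M"
        "T r (T t (?P u)) \<in> L2 M" "?P u \<in> L2 M"
        using r y u t wL[OF t] by (auto intro!: T_L2 P)
      let ?a = "\<lambda>x. (T r y x - y x) / r - k x"
      let ?b = "\<lambda>x. (T r (?P y) x - ?P y x) / r - ?P k x"
      have ab: "?a \<in> L2 M" "?b \<in> L2 M"
        using L2_lin[OF L2.V_diff[OF L(1) y(1)] y(2), of "1 / r" "- 1"]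
          L2_lin[OF L2.V_diff[OF L(2,3)] L(4), of "1 / r" "- 1"] by auto
      have "r * (i * ((a - y) / r - c) - ((b - i * y) / r - i * c)) = i * a - b" for i a b c y :: real
        using r by (simp add: field_simps)
      then have z: "(\<lambda>x. ?P (T r y) x - T r (?P y) x) = (\<lambda>x. r * (?P ?a x - ?b x))"
        by (simp only:)
      have zL: "(\<lambda>x. ?P (T r y) x - T r (?P y) x) \<in> L2 M" by (intro L2.V_diff L)
      have "nrm M (\<lambda>x. ?P (T r y) x - T r (?P y) x) = r * nrm M (\<lambda>x. ?P ?a x - ?b x)"
        unfolding z nrm_scale using r by simp
      also have "\<dots> \<le> r * (nrm M (?P ?a) + nrm M ?b)"
        using r by (intro mult_left_mono nrm_diff_le P ab) auto
      also have "\<dots> \<le> r * (nrm M ?a + nrm M ?b)"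
        using r by (intro mult_left_mono add_right_mono P ab) auto
      also have "\<dots> \<le> r * e" using d(2)[OF r] r by (intro mult_left_mono) auto
      finally have 1: "nrm M (\<lambda>x. ?P (T r y) x - T r (?P y) x) \<le> r * e" .
      have "AE x in M. T (t + r) u x = T r y x"
        unfolding y_def using T_add[of r t u] r t u by (simp add: add.commute)
      moreover have "AE x in M. T (t + r) (?P u) x = T r (T t (?P u)) x"
        using T_add[of r t "?P u"] r t L by (simp add: add.commute)
      moreover have "AE x in M. T r (w t) x = T r (?P y) x - T r (T t (?P u)) x"
        unfolding w_def y_def[symmetric] using r L by (intro T_diff) auto
      ultimately have "AE x in M. w (t + r) x = (?P (T r y) x - T r (?P y) x) + T r (w t) x"
      proof eventually_elim
        case (elim x)
        then show ?case by (simp only: w_def)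
      qed
      then have "\<psi> (t + r) = nrm M (\<lambda>x. (?P (T r y) x - T r (?P y) x) + T r (w t) x)"
        unfolding \<psi>_def using r t by (intro nrm_cong_AE wL L2.V_add zL L) auto
      also have "\<dots> \<le> nrm M (\<lambda>x. ?P (T r y) x - T r (?P y) x) + nrm M (T r (w t))"
        by (intro nrm_add_le zL L)
      also have "\<dots> \<le> r * e + \<psi> t" unfolding \<psi>_def using 1 r t by (intro add_mono T_contr_nrm wL) auto
      finally show ?thesis by (simp add: mult.commute)
    qed
    then show "\<exists>d>0. \<forall>r. 0 < r \<and> r < d \<longrightarrow> \<psi> (t + r) \<le> \<psi> t + e * r" using d(1) by blast
  qed
  then have "nrm M (w t) = 0" using sqnorm2_nonneg[of M "w t"] by (simp add: \<psi>_def)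
  then show ?thesis by (simp add: w_def[abs_def])
qed

theorem indicator_commutes:
  assumes A: "A \<in> sets M"
    and comm: "\<And>u h. u \<in> L2 M \<Longrightarrow> h \<in> L2 M \<Longrightarrow> generates M T u h \<Longrightarrow>
      generates M T (\<lambda>x. indicator A x * u x) (\<lambda>x. indicator A x * h x)"
    and f: "f \<in> L2 M" and t: "0 \<le> t"
  shows "AE x in M. indicator A x * T t f x = T t (\<lambda>y. indicator A y * f y) x"
proof -
  let ?P = "\<lambda>f x. indicator A x * f x :: real"
  have [measurable]: "(indicator A :: 'b \<Rightarrow> real) \<in> borel_measurable M" using A by simp
  have P: "?P f \<in> L2 M" "nrm M (?P f) \<le> nrm M f" if "f \<in> L2 M" for f
    using L2_bounded_mult[OF that, of "indicator A" 1] by auto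
  have L: "?P (T t f) \<in> L2 M" "T t (?P f) \<in> L2 M" using f t by (auto intro!: P T_L2)
  have "nrm M (\<lambda>x. ?P (T t f) x - T t (?P f) x) \<le> 0 + e" if e: "0 < e" for e
  proof -
    obtain u h where u: "u \<in> L2 M" "h \<in> L2 M" "generates M T u h" "nrm M (\<lambda>x. f x - u x) < e / 2"
      using generator_domain_dense[OF f, of "e / 2"] e by auto
    have L': "?P (T t u) \<in> L2 M" "T t (?P u) \<in> L2 M" "T t u \<in> L2 M" "T t f \<in> L2 M"
      using u f t by (auto intro!: P T_L2)
    have "nrm M (\<lambda>x. ?P (T t f) x - T t (?P f) x) \<le> nrm M (\<lambda>x. ?P (T t f) x - ?P (T t u) x) +
       (nrm M (\<lambda>x. ?P (T t u) x - T t (?P u) x) + nrm M (\<lambda>x. T t (?P u) x - T t (?P f) x))"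
      using nrm_diff_triangle[OF L(1) L'(1) L(2)] nrm_diff_triangle[OF L'(1) L'(2) L(2)] by linarith
    also have "nrm M (\<lambda>x. ?P (T t u) x - T t (?P u) x) = 0"
      by (rule indicator_commutes_core[OF A comm u(1-3) t])
    also have "nrm M (\<lambda>x. ?P (T t f) x - ?P (T t u) x) \<le> nrm M (\<lambda>x. T t f x - T t u x)"
      using P(2)[OF L2.V_diff[OF L'(4,3)]] by (simp add: right_diff_distrib)
    also have "\<dots> \<le> nrm M (\<lambda>x. f x - u x)" by (rule T_diff_nrm[OF t f u(1)])
    also have "nrm M (\<lambda>x. T t (?P u) x - T t (?P f) x) \<le> nrm M (\<lambda>x. ?P u x - ?P f x)"
      by (intro T_diff_nrm t P u f)
    also have "\<dots> \<le> nrm M (\<lambda>x. u x - f x)"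
      using P(2)[OF L2.V_diff[OF u(1) f]] by (simp add: right_diff_distrib)
    also have "\<dots> = nrm M (\<lambda>x. f x - u x)" by (rule nrm_diff_sym)
    finally show ?thesis using u(4) by simp
  qed
  then have "nrm M (\<lambda>x. ?P (T t f) x - T t (?P f) x) \<le> 0" by (rule field_le_epsilon)
  then have "sqnorm2 M (\<lambda>x. ?P (T t f) x - T t (?P f) x) = 0"
    using sqnorm2_nonneg[of M "\<lambda>x. ?P (T t f) x - T t (?P f) x"] by simp
  then show ?thesis using sqnorm2_eq_0_iff[OF L2.V_diff[OF L]] by simp
qed

end

section \<open>Configurations at finite transport distance\<close>

lemma configs_sets: "\<gamma> \<in> configs m \<Longrightarrow> sets \<gamma> = sets m"
  by (simp add: configs_def)

lemma config_finite: "\<gamma> \<in> configs m \<Longrightarrow> E \<in> bounded_sets m \<Longrightarrow> emeasure \<gamma> E < \<infinity>"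
  by (simp add: configs_def)

text \<open>
  A \<open>\<sigma>\<close>-algebra on a Polish space that contains the Borel sets; the measure itself plays no role here.
\<close>

locale borel_extension =
  fixes m :: "'a::polish_space measure"
  assumes space_UNIV: "space m = UNIV" and borel_subset: "sets borel \<subseteq> sets m"
begin

lemma config_space: "\<gamma> \<in> configs m \<Longrightarrow> space \<gamma> = UNIV"
  using configs_sets[of \<gamma> m] sets_eq_imp_space_eq space_UNIV by blast

lemma id_borel: "(\<lambda>x. x) \<in> m \<rightarrow>\<^sub>M borel"
  using borel_subset space_UNIV by (intro measurableI) auto

lemma closed_sets_m: "closed S \<Longrightarrow> S \<in> sets m"
  using borel_subset by auto

lemma continuous_measurable: "continuous_on UNIV f \<Longrightarrow> f \<in> borel_measurable m"
  using measurable_compose[OF id_borel borel_measurable_continuous_onI] by simp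

lemma cball_bounded_sets: "cball x r \<in> bounded_sets m"
  by (simp add: bounded_sets_def closed_sets_m)

lemma dist_measurable: "(\<lambda>p. dist (fst p) (snd p)) \<in> borel_measurable (m \<Otimes>\<^sub>M m)"
  by (intro borel_measurable_dist measurable_compose[OF measurable_fst id_borel]
      measurable_compose[OF measurable_snd id_borel])

lemma config_sigma_finite:
  assumes "\<gamma> \<in> configs m"
  shows "sigma_finite_measure \<gamma>"
proof
  let ?A = "range (\<lambda>n. cball (undefined :: 'a) (real n))"
  have "\<Union> ?A = UNIV" using real_arch_simple by (auto simp: mem_cball)
  moreover have "\<forall>a\<in>?A. emeasure \<gamma> a \<noteq> \<infinity>"
    using config_finite[OF assms cball_bounded_sets] by (auto simp: less_top)
  ultimately show "\<exists>A. countable A \<and> A \<subseteq> sets \<gamma> \<and> \<Union> A = space \<gamma> \<and> (\<forall>a\<in>A. emeasure \<gamma> a \<noteq> \<infinity>)"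
    using closed_sets_m config_space[OF assms] configs_sets[OF assms] by (intro exI[of _ ?A]) auto
qed

text \<open>
  A configuration is carried by its atoms, which have finite mass.
\<close>

lemma config_AE_atom:
  assumes "\<eta> \<in> configs m"
  shows "AE y in \<eta>. 0 < emeasure \<eta> {y} \<and> emeasure \<eta> {y} < \<infinity>"
proof -
  obtain N :: enat and x :: "nat \<Rightarrow> 'a" where x: "\<And>A. A \<in> sets m \<Longrightarrow>
      emeasure \<eta> A = (\<Sum>i. if enat i < N then indicator A (x i) else 0)"
    using assms by (auto simp: configs_def)
  let ?S = "x ` {i. enat i < N}"
  have S: "?S \<in> sets m"
    by (rule sets.countable) (auto intro: closed_sets_m)
  then have S': "UNIV - ?S \<in> sets m" using sets.compl_sets[of ?S m] space_UNIV by simp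
  have "(if enat i < N then indicator (UNIV - ?S) (x i) else 0 :: ennreal) = 0" for i by auto
  then have 0: "emeasure \<eta> (UNIV - ?S) = 0" unfolding x[OF S'] by simp
  have pos: "0 < emeasure \<eta> {y}" if y: "y \<in> ?S" for y
  proof -
    obtain i where i: "enat i < N" "y = x i" using y by blast
    have "(1::ennreal) = (\<Sum>j\<in>{i}. if enat j < N then indicator {y} (x j) else 0)" using i by simp
    also have "\<dots> \<le> emeasure \<eta> {y}"
      unfolding x[OF closed_sets_m[OF closed_singleton]] by (rule sum_le_suminf) auto
    finally show ?thesis using less_le_trans zero_less_one by blast
  qed
  have fin: "emeasure \<eta> {y} < \<infinity>" for y
    using assms by (auto simp: configs_def bounded_sets_def intro: closed_sets_m)
  show ?thesis
  proof (rule AE_I[OF _ 0])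
    show "{y \<in> space \<eta>. \<not> (0 < emeasure \<eta> {y} \<and> emeasure \<eta> {y} < \<infinity>)} \<subseteq> UNIV - ?S"
    proof
      fix y assume "y \<in> {y \<in> space \<eta>. \<not> (0 < emeasure \<eta> {y} \<and> emeasure \<eta> {y} < \<infinity>)}"
      then show "y \<in> UNIV - ?S" using pos[of y] fin[of y] by (cases "y \<in> ?S") simp_all
    qed
    show "UNIV - ?S \<in> sets \<eta>" using S' configs_sets[OF assms] by simp
  qed
qed

text \<open>
  Finiteness of the quadratic transport cost of a coupling.
\<close>

definition finite_cost :: "('a \<times> 'a) measure \<Rightarrow> bool" where
  "finite_cost q \<longleftrightarrow> (\<integral>\<^sup>+p. ennreal ((dist (fst p) (snd p))\<^sup>2) \<partial>q) < \<infinity>"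

lemma dU_finite_iff: "dU \<gamma> \<eta> < \<infinity> \<longleftrightarrow> (\<exists>q\<in>couplings \<gamma> \<eta>. finite_cost q)"
proof -
  have "ennreal_sqrt r < \<infinity> \<longleftrightarrow> r < \<infinity>" for r
    by (auto simp: ennreal_sqrt_def less_top)
  then show ?thesis by (simp add: dU_def INF_less_iff finite_cost_def)
qed

lemma coupling_sets:
  assumes "\<gamma> \<in> configs m" "\<eta> \<in> configs m" "q \<in> couplings \<gamma> \<eta>"
  shows "sets q = sets (m \<Otimes>\<^sub>M m)"
  using assms configs_sets by (auto simp: couplings_def intro!: sets_pair_measure_cong)

lemma coupling_fst:
  assumes "\<gamma> \<in> configs m" "\<eta> \<in> configs m" "q \<in> couplings \<gamma> \<eta>" "f \<in> borel_measurable m"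
  shows "(\<integral>\<^sup>+p. f (fst p) \<partial>q) = (\<integral>\<^sup>+x. f x \<partial>\<gamma>)"
proof -
  have "distr q \<gamma> fst = \<gamma>" using assms by (simp add: couplings_def)
  moreover have "fst \<in> q \<rightarrow>\<^sub>M \<gamma>"
    using coupling_sets[OF assms(1-3)] configs_sets[OF assms(1)]
    by (subst measurable_cong_sets[of q "m \<Otimes>\<^sub>M m" \<gamma> m]) auto
  moreover have "f \<in> borel_measurable \<gamma>"
    using assms(4) configs_sets[OF assms(1)] measurable_cong_sets by blast
  ultimately show ?thesis by (metis nn_integral_distr)
qed

lemma coupling_snd:
  assumes "\<gamma> \<in> configs m" "\<eta> \<in> configs m" "q \<in> couplings \<gamma> \<eta>" "f \<in> borel_measurable m"
  shows "(\<integral>\<^sup>+p. f (snd p) \<partial>q) = (\<integral>\<^sup>+x. f x \<partial>\<eta>)"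
proof -
  have "distr q \<eta> snd = \<eta>" using assms by (simp add: couplings_def)
  moreover have "snd \<in> q \<rightarrow>\<^sub>M \<eta>"
    using coupling_sets[OF assms(1-3)] configs_sets[OF assms(2)]
    by (subst measurable_cong_sets[of q "m \<Otimes>\<^sub>M m" \<eta> m]) auto
  moreover have "f \<in> borel_measurable \<eta>"
    using assms(4) configs_sets[OF assms(2)] measurable_cong_sets by blast
  ultimately show ?thesis by (metis nn_integral_distr)
qed

text \<open>
  A coupling is recognized by the integrals of functions of one variable.
\<close>

lemma couplingI:
  assumes \<gamma>: "\<gamma> \<in> configs m" and \<eta>: "\<eta> \<in> configs m" and q: "sets q = sets (m \<Otimes>\<^sub>M m)"
    and f: "\<And>f. f \<in> borel_measurable m \<Longrightarrow> (\<integral>\<^sup>+p. f (fst p) \<partial>q) = (\<integral>\<^sup>+x. f x \<partial>\<gamma>)"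
    and s: "\<And>f. f \<in> borel_measurable m \<Longrightarrow> (\<integral>\<^sup>+p. f (snd p) \<partial>q) = (\<integral>\<^sup>+x. f x \<partial>\<eta>)"
  shows "q \<in> couplings \<gamma> \<eta>"
proof -
  note c = configs_sets[OF \<gamma>] configs_sets[OF \<eta>]
  have ms: "fst \<in> q \<rightarrow>\<^sub>M \<gamma>" "snd \<in> q \<rightarrow>\<^sub>M \<eta>"
    using c q measurable_cong_sets[of q "m \<Otimes>\<^sub>M m" \<gamma> m] measurable_cong_sets[of q "m \<Otimes>\<^sub>M m" \<eta> m] by auto
  have "distr q \<gamma> fst = \<gamma>"
  proof (rule measure_eqI)
    fix A assume "A \<in> sets (distr q \<gamma> fst)"
    then have A: "A \<in> sets \<gamma>" by simp
    have "emeasure (distr q \<gamma> fst) A = (\<integral>\<^sup>+x. indicator A x \<partial>distr q \<gamma> fst)" using A by simp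
    also have "\<dots> = (\<integral>\<^sup>+p. indicator A (fst p) \<partial>q)" using ms A by (subst nn_integral_distr) auto
    also have "\<dots> = (\<integral>\<^sup>+x. indicator A x \<partial>\<gamma>)" using A c by (intro f) auto
    finally show "emeasure (distr q \<gamma> fst) A = emeasure \<gamma> A" using A by simp
  qed simp
  moreover have "distr q \<eta> snd = \<eta>"
  proof (rule measure_eqI)
    fix A assume "A \<in> sets (distr q \<eta> snd)"
    then have A: "A \<in> sets \<eta>" by simp
    have "emeasure (distr q \<eta> snd) A = (\<integral>\<^sup>+x. indicator A x \<partial>distr q \<eta> snd)" using A by simp
    also have "\<dots> = (\<integral>\<^sup>+p. indicator A (snd p) \<partial>q)" using ms A by (subst nn_integral_distr) auto
    also have "\<dots> = (\<integral>\<^sup>+x. indicator A x \<partial>\<eta>)" using A c by (intro s) auto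
    finally show "emeasure (distr q \<eta> snd) A = emeasure \<eta> A" using A by simp
  qed simp
  moreover have "sets q = sets (\<gamma> \<Otimes>\<^sub>M \<eta>)" using q c sets_pair_measure_cong by metis
  ultimately show ?thesis by (simp add: couplings_def)
qed

lemma dU_finite_refl:
  assumes \<gamma>: "\<gamma> \<in> configs m"
  shows "dU \<gamma> \<gamma> < \<infinity>"
  unfolding dU_finite_iff
proof
  let ?q = "distr \<gamma> (m \<Otimes>\<^sub>M m) (\<lambda>x. (x, x))"
  have d: "(\<lambda>x. (x, x)) \<in> \<gamma> \<rightarrow>\<^sub>M m \<Otimes>\<^sub>M m"
    unfolding measurable_cong_sets[OF configs_sets[OF \<gamma>] refl] by measurable
  have "(\<integral>\<^sup>+p. ennreal ((dist (fst p) (snd p))\<^sup>2) \<partial>?q) = 0"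
    using dist_measurable by (subst nn_integral_distr[OF d]) auto
  then show "finite_cost ?q" by (simp add: finite_cost_def)
  show "?q \<in> couplings \<gamma> \<gamma>"
    by (rule couplingI[OF \<gamma> \<gamma>]) (auto simp: nn_integral_distr[OF d])
qed

lemma dU_finite_sym:
  assumes \<gamma>: "\<gamma> \<in> configs m" and \<eta>: "\<eta> \<in> configs m" and fin: "dU \<gamma> \<eta> < \<infinity>"
  shows "dU \<eta> \<gamma> < \<infinity>"
proof -
  obtain q where q: "q \<in> couplings \<gamma> \<eta>" "finite_cost q" using fin unfolding dU_finite_iff by blast
  let ?q = "distr q (m \<Otimes>\<^sub>M m) (\<lambda>p. (snd p, fst p))"
  have sw: "(\<lambda>p. (snd p, fst p)) \<in> q \<rightarrow>\<^sub>M m \<Otimes>\<^sub>M m"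
    unfolding measurable_cong_sets[OF coupling_sets[OF \<gamma> \<eta> q(1)] refl] by measurable
  have "(\<integral>\<^sup>+p. ennreal ((dist (fst p) (snd p))\<^sup>2) \<partial>?q) = (\<integral>\<^sup>+p. ennreal ((dist (fst p) (snd p))\<^sup>2) \<partial>q)"
    using dist_measurable by (subst nn_integral_distr[OF sw]) (auto simp: dist_commute)
  then have "finite_cost ?q" using q(2) by (simp add: finite_cost_def)
  moreover have "?q \<in> couplings \<eta> \<gamma>"
    using coupling_fst[OF \<gamma> \<eta> q(1)] coupling_snd[OF \<gamma> \<eta> q(1)]
    by (intro couplingI[OF \<eta> \<gamma>]) (auto simp: nn_integral_distr[OF sw])
  ultimately show ?thesis unfolding dU_finite_iff by blast
qed

lemma coupling_sigma_finite:
  assumes \<gamma>: "\<gamma> \<in> configs m" and \<eta>: "\<eta> \<in> configs m" and q: "q \<in> couplings \<gamma> \<eta>"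
  shows "sigma_finite_measure q"
proof
  let ?A = "range (\<lambda>n. cball (undefined :: 'a) (real n) \<times> (UNIV :: 'a set))"
  have sp: "space q = UNIV"
    using sets_eq_imp_space_eq[OF coupling_sets[OF assms]] by (simp add: space_pair_measure space_UNIV)
  have "\<Union> ?A = UNIV" using real_arch_simple by (auto simp: mem_cball)
  moreover have A: "cball (undefined :: 'a) (real n) \<times> (UNIV :: 'a set) \<in> sets q" for n
    using coupling_sets[OF assms] closed_sets_m closed_cball sets.top[of m] space_UNIV by auto
  moreover have "emeasure q (cball (undefined :: 'a) (real n) \<times> UNIV) \<noteq> \<infinity>" for n
  proof -
    have "emeasure q (cball (undefined :: 'a) (real n) \<times> UNIV) =
        (\<integral>\<^sup>+p. indicator (cball (undefined :: 'a) (real n) \<times> UNIV) p \<partial>q)"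
      using A[of n] by simp
    also have "\<dots> = (\<integral>\<^sup>+p. indicator (cball (undefined :: 'a) (real n)) (fst p) \<partial>q)"
      by (intro nn_integral_cong) (auto simp: indicator_def)
    also have "\<dots> = (\<integral>\<^sup>+x. indicator (cball (undefined :: 'a) (real n)) x \<partial>\<gamma>)"
      by (intro coupling_fst[OF assms] borel_measurable_indicator closed_sets_m closed_cball)
    also have "\<dots> = emeasure \<gamma> (cball (undefined :: 'a) (real n))"
      using closed_sets_m configs_sets[OF \<gamma>] by simp
    finally show ?thesis using config_finite[OF \<gamma> cball_bounded_sets] by (auto simp: less_top)
  qed
  ultimately show "\<exists>A. countable A \<and> A \<subseteq> sets q \<and> \<Union> A = space q \<and> (\<forall>a\<in>A. emeasure q a \<noteq> \<infinity>)"
    using sp by (intro exI[of _ ?A]) auto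
qed

text \<open>
  Gluing.  Given couplings \<open>q\<close> of \<open>\<gamma>\<close>, \<open>\<eta>\<close> and \<open>q'\<close> of \<open>\<eta>\<close>, \<open>\<xi>\<close>, the product \<open>q \<otimes> q'\<close> is restricted to the
  pairs \<open>((x, y), (y', z))\<close> with \<open>y = y'\<close> and weighted by \<open>1 / \<eta>{y}\<close>.  As \<open>\<eta>\<close> is carried by its atoms,
  the projections of the weighted measure to \<open>(x, y)\<close> and \<open>(y', z)\<close> are \<open>q\<close> and \<open>q'\<close>, and its image
  under \<open>(x, z)\<close> couples \<open>\<gamma>\<close> and \<open>\<xi>\<close> at finite cost.
\<close>

lemma dU_finite_trans:
  assumes \<gamma>: "\<gamma> \<in> configs m" and \<eta>: "\<eta> \<in> configs m" and \<xi>: "\<xi> \<in> configs m"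
    and fin: "dU \<gamma> \<eta> < \<infinity>" "dU \<eta> \<xi> < \<infinity>"
  shows "dU \<gamma> \<xi> < \<infinity>"
proof -
  obtain q where q: "q \<in> couplings \<gamma> \<eta>" "finite_cost q" using fin unfolding dU_finite_iff by blast
  obtain q' where q': "q' \<in> couplings \<eta> \<xi>" "finite_cost q'" using fin unfolding dU_finite_iff by blast
  interpret q: sigma_finite_measure q by (rule coupling_sigma_finite[OF \<gamma> \<eta> q(1)])
  interpret q': sigma_finite_measure q' by (rule coupling_sigma_finite[OF \<eta> \<xi> q'(1)])
  interpret \<eta>: sigma_finite_measure \<eta> by (rule config_sigma_finite[OF \<eta>])
  interpret Q: pair_sigma_finite q q' ..
  note [measurable_cong] = coupling_sets[OF \<gamma> \<eta> q(1)] coupling_sets[OF \<eta> \<xi> q'(1)]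
  define a where "a y = emeasure \<eta> {y}" for y
  have "{p \<in> space (m \<Otimes>\<^sub>M m). dist (fst p) (snd p) = 0} \<in> sets (m \<Otimes>\<^sub>M m)"
    using dist_measurable by measurable
  then have diag: "{p \<in> space (m \<Otimes>\<^sub>M m). fst p = snd p} \<in> sets (m \<Otimes>\<^sub>M m)" by simp
  have a[measurable]: "a \<in> borel_measurable m"
  proof -
    have "sets (m \<Otimes>\<^sub>M \<eta>) = sets (m \<Otimes>\<^sub>M m)"
      by (intro sets_pair_measure_cong refl configs_sets[OF \<eta>])
    with diag have "{p \<in> space (m \<Otimes>\<^sub>M m). fst p = snd p} \<in> sets (m \<Otimes>\<^sub>M \<eta>)" by (simp only:)
    from \<eta>.measurable_emeasure_Pair[OF this]
    have "(\<lambda>x. emeasure \<eta> (Pair x -` {p \<in> space (m \<Otimes>\<^sub>M m). fst p = snd p})) \<in> borel_measurable m" .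
    moreover have "Pair x -` {p \<in> space (m \<Otimes>\<^sub>M m). fst p = snd p} = {x}" for x
      by (auto simp: space_pair_measure space_UNIV)
    ultimately show ?thesis by (simp add: a_def[abs_def])
  qed
  define W where "W p = (if snd (fst p) = fst (snd p) then inverse (a (snd (fst p))) else 0)"
    for p :: "('a \<times> 'a) \<times> ('a \<times> 'a)"
  have W[measurable]: "W \<in> borel_measurable (q \<Otimes>\<^sub>M q')"
  proof -
    have c: "(\<lambda>p. (snd (fst p), fst (snd p))) \<in> q \<Otimes>\<^sub>M q' \<rightarrow>\<^sub>M m \<Otimes>\<^sub>M m" by measurable
    have "{p \<in> space (q \<Otimes>\<^sub>M q'). snd (fst p) = fst (snd p)} =
        (\<lambda>p. (snd (fst p), fst (snd p))) -` {p \<in> space (m \<Otimes>\<^sub>M m). fst p = snd p} \<inter> space (q \<Otimes>\<^sub>M q')"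
      using measurable_space[OF c] by auto
    then have [measurable]: "Measurable.pred (q \<Otimes>\<^sub>M q') (\<lambda>p. snd (fst p) = fst (snd p))"
      using measurable_sets[OF c diag] by (simp add: pred_def)
    show ?thesis unfolding W_def[abs_def] by measurable
  qed
  have inv: "inverse (a y) * a y = 1" if "0 < a y \<and> a y < \<infinity>" for y
    using that ennreal_divide_self[of "a y"] by (auto simp: divide_ennreal_def mult.commute)
  have sing: "{y} \<in> sets m" for y by (rule closed_sets_m) simp
  have AE1: "AE p in q. 0 < a (snd p) \<and> a (snd p) < \<infinity>"
  proof -
    have eq: "distr q \<eta> snd = \<eta>" using q(1) by (simp add: couplings_def)
    have *: "AE y in distr q \<eta> snd. 0 < a y \<and> a y < \<infinity>"
      unfolding eq a_def by (rule config_AE_atom[OF \<eta>])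
    have "snd \<in> q \<rightarrow>\<^sub>M \<eta>"
      unfolding measurable_cong_sets[OF refl configs_sets[OF \<eta>]] by measurable
    from AE_distrD[OF this *] show ?thesis .
  qed
  have AE2: "AE p in q'. 0 < a (fst p) \<and> a (fst p) < \<infinity>"
  proof -
    have eq: "distr q' \<eta> fst = \<eta>" using q'(1) by (simp add: couplings_def)
    have *: "AE y in distr q' \<eta> fst. 0 < a y \<and> a y < \<infinity>"
      unfolding eq a_def by (rule config_AE_atom[OF \<eta>])
    have "fst \<in> q' \<rightarrow>\<^sub>M \<eta>"
      unfolding measurable_cong_sets[OF refl configs_sets[OF \<eta>]] by measurable
    from AE_distrD[OF this *] show ?thesis .
  qed
  have first: "(\<integral>\<^sup>+r. W r * F (fst r) \<partial>(q \<Otimes>\<^sub>M q')) = (\<integral>\<^sup>+p. F p \<partial>q)"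
    if [measurable]: "F \<in> borel_measurable (m \<Otimes>\<^sub>M m)" for F
  proof -
    have "(\<integral>\<^sup>+r. W r * F (fst r) \<partial>(q \<Otimes>\<^sub>M q')) = (\<integral>\<^sup>+p. \<integral>\<^sup>+p'. W (p, p') * F p \<partial>q' \<partial>q)"
      by (subst q'.nn_integral_fst[symmetric]) auto
    also have "\<dots> = (\<integral>\<^sup>+p. F p \<partial>q)"
    proof (rule nn_integral_cong_AE, use AE1 in eventually_elim)
      fix p :: "'a \<times> 'a" assume p: "0 < a (snd p) \<and> a (snd p) < \<infinity>"
      have "(\<integral>\<^sup>+p'. W (p, p') * F p \<partial>q') = (\<integral>\<^sup>+p'. (inverse (a (snd p)) * F p) * indicator {snd p} (fst p') \<partial>q')"
        by (intro nn_integral_cong) (auto simp: W_def indicator_def)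
      also have "\<dots> = (inverse (a (snd p)) * F p) * (\<integral>\<^sup>+p'. indicator {snd p} (fst p') \<partial>q')"
        using sing by (intro nn_integral_cmult) auto
      also have "(\<integral>\<^sup>+p'. indicator {snd p} (fst p') \<partial>q') = a (snd p)"
        using coupling_fst[OF \<eta> \<xi> q'(1), of "indicator {snd p}"] sing[of "snd p"] configs_sets[OF \<eta>] by (simp add: a_def)
      finally show "(\<integral>\<^sup>+p'. W (p, p') * F p \<partial>q') = F p"
        using inv[OF p] by (metis mult.assoc mult.commute mult.left_neutral)
    qed
    finally show ?thesis .
  qed
  have second: "(\<integral>\<^sup>+r. W r * F (snd r) \<partial>(q \<Otimes>\<^sub>M q')) = (\<integral>\<^sup>+p. F p \<partial>q')"
    if [measurable]: "F \<in> borel_measurable (m \<Otimes>\<^sub>M m)" for F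
  proof -
    have "(\<integral>\<^sup>+r. W r * F (snd r) \<partial>(q \<Otimes>\<^sub>M q')) = (\<integral>\<^sup>+p'. \<integral>\<^sup>+p. W (p, p') * F p' \<partial>q \<partial>q')"
      using Q.nn_integral_snd[of "\<lambda>r. W r * F (snd r)"] by simp
    also have "\<dots> = (\<integral>\<^sup>+p. F p \<partial>q')"
    proof (rule nn_integral_cong_AE, use AE2 in eventually_elim)
      fix p' :: "'a \<times> 'a" assume p: "0 < a (fst p') \<and> a (fst p') < \<infinity>"
      have "(\<integral>\<^sup>+p. W (p, p') * F p' \<partial>q) = (\<integral>\<^sup>+p. (inverse (a (fst p')) * F p') * indicator {fst p'} (snd p) \<partial>q)"
        by (intro nn_integral_cong) (auto simp: W_def indicator_def)
      also have "\<dots> = (inverse (a (fst p')) * F p') * (\<integral>\<^sup>+p. indicator {fst p'} (snd p) \<partial>q)"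
        using sing by (intro nn_integral_cmult) auto
      also have "(\<integral>\<^sup>+p. indicator {fst p'} (snd p) \<partial>q) = a (fst p')"
        using coupling_snd[OF \<gamma> \<eta> q(1), of "indicator {fst p'}"] sing[of "fst p'"] configs_sets[OF \<eta>] by (simp add: a_def)
      finally show "(\<integral>\<^sup>+p. W (p, p') * F p' \<partial>q) = F p'"
        using inv[OF p] by (metis mult.assoc mult.commute mult.left_neutral)
    qed
    finally show ?thesis .
  qed
  define \<rho> where "\<rho> = density (q \<Otimes>\<^sub>M q') W"
  define G where "G = distr \<rho> (m \<Otimes>\<^sub>M m) (\<lambda>r. (fst (fst r), snd (snd r)))"
  have c: "(\<lambda>r. (fst (fst r), snd (snd r))) \<in> \<rho> \<rightarrow>\<^sub>M m \<Otimes>\<^sub>M m" unfolding \<rho>_def by measurable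
  have G: "(\<integral>\<^sup>+p. F p \<partial>G) = (\<integral>\<^sup>+r. W r * F (fst (fst r), snd (snd r)) \<partial>(q \<Otimes>\<^sub>M q'))"
    if [measurable]: "F \<in> borel_measurable (m \<Otimes>\<^sub>M m)" for F
    unfolding G_def by (subst nn_integral_distr[OF c]) (auto simp: \<rho>_def nn_integral_density)
  have "G \<in> couplings \<gamma> \<xi>"
  proof (rule couplingI[OF \<gamma> \<xi>])
    show "sets G = sets (m \<Otimes>\<^sub>M m)" by (simp add: G_def)
    fix f :: "'a \<Rightarrow> ennreal" assume [measurable]: "f \<in> borel_measurable m"
    show "(\<integral>\<^sup>+p. f (fst p) \<partial>G) = (\<integral>\<^sup>+x. f x \<partial>\<gamma>)"
      using G[of "\<lambda>p. f (fst p)"] first[of "\<lambda>p. f (fst p)"] coupling_fst[OF \<gamma> \<eta> q(1), of f] by simp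
    show "(\<integral>\<^sup>+p. f (snd p) \<partial>G) = (\<integral>\<^sup>+x. f x \<partial>\<xi>)"
      using G[of "\<lambda>p. f (snd p)"] second[of "\<lambda>p. f (snd p)"] coupling_snd[OF \<eta> \<xi> q'(1), of f] by simp
  qed
  moreover have "finite_cost G"
  proof -
    let ?c = "\<lambda>p :: 'a \<times> 'a. ennreal ((dist (fst p) (snd p))\<^sup>2)"
    have cm[measurable]: "?c \<in> borel_measurable (m \<Otimes>\<^sub>M m)" 
      by (rule measurable_compose[OF borel_measurable_power[OF dist_measurable] measurable_ennreal])
    have "(\<integral>\<^sup>+p. ?c p \<partial>G) = (\<integral>\<^sup>+r. W r * ?c (fst (fst r), snd (snd r)) \<partial>(q \<Otimes>\<^sub>M q'))" by (rule G[OF cm])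
    also have "\<dots> \<le> (\<integral>\<^sup>+r. W r * (2 * ?c (fst r)) + W r * (2 * ?c (snd r)) \<partial>(q \<Otimes>\<^sub>M q'))"
    proof (rule nn_integral_mono)
      fix r :: "('a \<times> 'a) \<times> ('a \<times> 'a)"
      show "W r * ?c (fst (fst r), snd (snd r)) \<le> W r * (2 * ?c (fst r)) + W r * (2 * ?c (snd r))"
      proof (cases "snd (fst r) = fst (snd r)")
        case True
        let ?x = "dist (fst (fst r)) (snd (fst r))" and ?y = "dist (fst (snd r)) (snd (snd r))"
        have "dist (fst (fst r)) (snd (snd r)) \<le> ?x + ?y"
          using True by (metis dist_triangle)
        then have "(dist (fst (fst r)) (snd (snd r)))\<^sup>2 \<le> (?x + ?y)\<^sup>2" by (intro power_mono) auto
        also have "\<dots> \<le> 2 * ?x\<^sup>2 + 2 * ?y\<^sup>2"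
          using sum_squares_bound[of ?x ?y] by (simp add: power2_sum)
        finally have "?c (fst (fst r), snd (snd r)) \<le> ennreal (2 * ?x\<^sup>2 + 2 * ?y\<^sup>2)"
          unfolding fst_conv snd_conv by (rule ennreal_leI)
        also have "\<dots> = 2 * ?c (fst r) + 2 * ?c (snd r)" by (subst ennreal_plus) (simp_all add: ennreal_mult)
        finally show ?thesis 
          unfolding distrib_left[symmetric] by (intro mult_left_mono) auto
      qed (simp add: W_def)
    qed
    also have "\<dots> = (\<integral>\<^sup>+r. W r * (2 * ?c (fst r)) \<partial>(q \<Otimes>\<^sub>M q')) + (\<integral>\<^sup>+r. W r * (2 * ?c (snd r)) \<partial>(q \<Otimes>\<^sub>M q'))"
      by (rule nn_integral_add) measurable
    also have "\<dots> = (\<integral>\<^sup>+p. 2 * ?c p \<partial>q) + (\<integral>\<^sup>+p. 2 * ?c p \<partial>q')"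
      by (intro arg_cong2[where f = "(+)"] first[of "\<lambda>p. 2 * ?c p"] second[of "\<lambda>p. 2 * ?c p"]) measurable
    also have "\<dots> = 2 * (\<integral>\<^sup>+p. ?c p \<partial>q) + 2 * (\<integral>\<^sup>+p. ?c p \<partial>q')"
      by (intro arg_cong2[where f = "(+)"] nn_integral_cmult) measurable
    also have "\<dots> < \<infinity>" using q(2) q'(2) by (auto simp: finite_cost_def ennreal_mult_less_top)
    finally show ?thesis by (simp add: finite_cost_def)
  qed
  ultimately show ?thesis unfolding dU_finite_iff by blast
qed

end

section \<open>Operations on bounded smooth functions\<close>

text \<open>
  Bounded continuous functions of the first \<open>k\<close> coordinates with partial derivatives; the derivatives
  themselves are not required to be bounded or continuous.  \<open>Cb_smooth k\<close> is the largest set of such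
  functions that is closed under \<open>pd i\<close> for \<open>i < k\<close> (\<open>Cb_smooth_coinduct\<close>).
\<close>

definition bounded_diff :: "nat \<Rightarrow> ((nat \<Rightarrow> real) \<Rightarrow> real) \<Rightarrow> bool" where
  "bounded_diff k \<phi> \<longleftrightarrow> (\<forall>x y. (\<forall>i<k. x i = y i) \<longrightarrow> \<phi> x = \<phi> y) \<and> bounded (range \<phi>) \<and>
     continuous_on UNIV \<phi> \<and> (\<forall>i<k. \<forall>x. (\<lambda>t. \<phi> (x(i := t))) differentiable (at (x i)))"

lemma bounded_diff_cong: "bounded_diff k \<phi> \<Longrightarrow> (\<And>i. i < k \<Longrightarrow> x i = y i) \<Longrightarrow> \<phi> x = \<phi> y"
  by (auto simp: bounded_diff_def)

lemma bounded_diffI: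
  assumes "\<And>x y. (\<And>i. i < k \<Longrightarrow> x i = y i) \<Longrightarrow> \<phi> x = \<phi> y" "\<And>x. \<bar>\<phi> x\<bar> \<le> K" "continuous_on UNIV \<phi>"
    "\<And>i x. i < k \<Longrightarrow> ((\<lambda>t. \<phi> (x(i := t))) has_real_derivative d i x) (at (x i))"
  shows "bounded_diff k \<phi>"
  unfolding bounded_diff_def
proof (intro conjI allI impI)
  fix x y :: "nat \<Rightarrow> real" assume "\<forall>i<k. x i = y i" then show "\<phi> x = \<phi> y" by (intro assms(1)) simp
next
  show "bounded (range \<phi>)" unfolding bounded_iff using assms(2) by (intro exI[of _ K]) simp
next
  fix i :: nat and x :: "nat \<Rightarrow> real" assume "i < k"
  from assms(4)[OF this, of x] show "(\<lambda>t. \<phi> (x(i := t))) differentiable at (x i)"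
    unfolding real_differentiable_def by (rule exI)
qed (rule assms(3))

lemma bounded_diff_bounded: "bounded_diff k \<phi> \<Longrightarrow> \<exists>K. \<forall>x. \<bar>\<phi> x\<bar> \<le> K"
  by (auto simp: bounded_diff_def bounded_iff)

lemma bounded_diff_DERIV:
  assumes "bounded_diff k \<phi>" "i < k"
  shows "((\<lambda>t. \<phi> (x(i := t))) has_real_derivative pd i \<phi> x) (at (x i))"
proof -
  have "(\<lambda>t. \<phi> (x(i := t))) differentiable (at (x i))" using assms by (simp add: bounded_diff_def)
  then obtain d where d: "((\<lambda>t. \<phi> (x(i := t))) has_real_derivative d) (at (x i))"
    by (auto simp: real_differentiable_def)
  then show ?thesis using DERIV_imp_deriv[OF d] by (simp add: pd_def)
qed

lemma pd_eqI:
  assumes "\<And>x. ((\<lambda>t. \<phi> (x(i := t))) has_real_derivative d x) (at (x i))"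
  shows "pd i \<phi> = d"
  using DERIV_imp_deriv[OF assms] by (auto simp: pd_def)

lemma Cb_smooth_iff: "\<phi> \<in> Cb_smooth k \<longleftrightarrow>
    (\<forall>x y. (\<forall>i<k. x i = y i) \<longrightarrow> \<phi> x = \<phi> y) \<and> (\<forall>js. set js \<subseteq> {..<k} \<longrightarrow>
       bounded (range (foldr pd js \<phi>)) \<and> continuous_on UNIV (foldr pd js \<phi>) \<and>
       (\<forall>i<k. \<forall>x. (\<lambda>t. foldr pd js \<phi> (x(i := t))) differentiable (at (x i))))"
  unfolding Cb_smooth_def mem_Collect_eq ..

lemma Cb_smooth_bounded_diff:
  assumes "\<phi> \<in> Cb_smooth k"
  shows "bounded_diff k \<phi>"
proof -
  have d: "\<forall>x y. (\<forall>i<k. x i = y i) \<longrightarrow> \<phi> x = \<phi> y" using assms[unfolded Cb_smooth_iff] by (rule conjunct1)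
  show ?thesis
    unfolding bounded_diff_def
    using d assms[unfolded Cb_smooth_iff, THEN conjunct2, rule_format, of "[]", unfolded foldr.simps id_apply]
    by simp
qed

lemma Cb_smooth_coinduct:
  assumes "\<phi> \<in> S" and bounded_diff: "\<And>\<phi>. \<phi> \<in> S \<Longrightarrow> bounded_diff k \<phi>"
    and pd: "\<And>\<phi> i. \<phi> \<in> S \<Longrightarrow> i < k \<Longrightarrow> pd i \<phi> \<in> S"
  shows "\<phi> \<in> Cb_smooth k"
proof -
  have "foldr pd js \<phi> \<in> S" if "set js \<subseteq> {..<k}" for js
    using that by (induction js) (auto intro: assms)
  then have "bounded_diff k (foldr pd js \<phi>)" if "set js \<subseteq> {..<k}" for js using bounded_diff that by blast
  moreover have "bounded_diff k \<phi>" using assms by blast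
  ultimately show ?thesis unfolding Cb_smooth_iff bounded_diff_def by simp
qed

lemma Cb_smooth_pd:
  assumes \<phi>: "\<phi> \<in> Cb_smooth k" and i: "i < k"
  shows "pd i \<phi> \<in> Cb_smooth k"
proof -
  have "pd i \<phi> x = pd i \<phi> y" if "\<forall>j<k. x j = y j" for x y
  proof -
    have "(\<lambda>t. \<phi> (x(i := t))) = (\<lambda>t. \<phi> (y(i := t)))"
      using that by (intro ext bounded_diff_cong[OF Cb_smooth_bounded_diff[OF \<phi>]]) auto
    then show ?thesis using that i by (simp add: pd_def)
  qed
  moreover have "foldr pd js (pd i \<phi>) = foldr pd (js @ [i]) \<phi>" for js by simp
  moreover have "set (js @ [i]) \<subseteq> {..<k}" if "set js \<subseteq> {..<k}" for js using that i by simp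
  ultimately show ?thesis
    using \<phi>[unfolded Cb_smooth_iff, THEN conjunct2, rule_format, of "_ @ [i]"]
    unfolding Cb_smooth_iff by (simp only:) simp
qed

text \<open>
  The algebra generated by \<open>Cb_smooth k\<close>, closed also under sine and cosine.  It is closed under partial
  derivatives, hence equal to \<open>Cb_smooth k\<close>; no formula for higher derivatives of products or
  compositions is needed.
\<close>

inductive_set smooth_algebra :: "nat \<Rightarrow> ((nat \<Rightarrow> real) \<Rightarrow> real) set" for k where
  base: "\<phi> \<in> Cb_smooth k \<Longrightarrow> \<phi> \<in> smooth_algebra k"
| const: "(\<lambda>x. c) \<in> smooth_algebra k"
| add: "\<phi> \<in> smooth_algebra k \<Longrightarrow> \<psi> \<in> smooth_algebra k \<Longrightarrow> (\<lambda>x. \<phi> x + \<psi> x) \<in> smooth_algebra k"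
| mult: "\<phi> \<in> smooth_algebra k \<Longrightarrow> \<psi> \<in> smooth_algebra k \<Longrightarrow> (\<lambda>x. \<phi> x * \<psi> x) \<in> smooth_algebra k"
| sin: "\<phi> \<in> smooth_algebra k \<Longrightarrow> (\<lambda>x. sin (\<phi> x)) \<in> smooth_algebra k"
| cos: "\<phi> \<in> smooth_algebra k \<Longrightarrow> (\<lambda>x. cos (\<phi> x)) \<in> smooth_algebra k"

lemma bounded_diff_const: "bounded_diff k (\<lambda>x. c)"
  by (rule bounded_diffI[of _ _ "\<bar>c\<bar>" "\<lambda>i x. 0"]) auto

lemma bounded_diff_add:
  assumes "bounded_diff k \<phi>" "bounded_diff k \<psi>"
  shows "bounded_diff k (\<lambda>x. \<phi> x + \<psi> x)" "i < k \<Longrightarrow> pd i (\<lambda>x. \<phi> x + \<psi> x) = (\<lambda>x. pd i \<phi> x + pd i \<psi> x)"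
proof -
  obtain K K' where K: "\<And>x. \<bar>\<phi> x\<bar> \<le> K" "\<And>x. \<bar>\<psi> x\<bar> \<le> K'" using assms bounded_diff_bounded by meson
  have d: "((\<lambda>t. \<phi> (x(i := t)) + \<psi> (x(i := t))) has_real_derivative pd i \<phi> x + pd i \<psi> x) (at (x i))"
    if "i < k" for i x
    using bounded_diff_DERIV[OF assms(1) that] bounded_diff_DERIV[OF assms(2) that] by (intro DERIV_add)
  show "bounded_diff k (\<lambda>x. \<phi> x + \<psi> x)"
  proof (rule bounded_diffI[OF _ _ _ d])
    show "\<bar>\<phi> x + \<psi> x\<bar> \<le> K + K'" for x using K[of x] by linarith
    show "continuous_on UNIV (\<lambda>x. \<phi> x + \<psi> x)" using assms by (auto simp: bounded_diff_def intro!: continuous_intros)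
    show "\<phi> x + \<psi> x = \<phi> y + \<psi> y" if "\<And>i. i < k \<Longrightarrow> x i = y i" for x y
      using bounded_diff_cong[OF assms(1) that] bounded_diff_cong[OF assms(2) that] by simp
  qed
  show "i < k \<Longrightarrow> pd i (\<lambda>x. \<phi> x + \<psi> x) = (\<lambda>x. pd i \<phi> x + pd i \<psi> x)"
    by (rule pd_eqI[OF d])
qed

lemma bounded_diff_mult:
  assumes "bounded_diff k \<phi>" "bounded_diff k \<psi>"
  shows "bounded_diff k (\<lambda>x. \<phi> x * \<psi> x)" "i < k \<Longrightarrow> pd i (\<lambda>x. \<phi> x * \<psi> x) = (\<lambda>x. pd i \<phi> x * \<psi> x + pd i \<psi> x * \<phi> x)"
proof -
  obtain K K' where K: "\<And>x. \<bar>\<phi> x\<bar> \<le> K" "\<And>x. \<bar>\<psi> x\<bar> \<le> K'" using assms bounded_diff_bounded by meson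
  have d: "((\<lambda>t. \<phi> (x(i := t)) * \<psi> (x(i := t))) has_real_derivative pd i \<phi> x * \<psi> x + pd i \<psi> x * \<phi> x) (at (x i))"
    if "i < k" for i x
    using DERIV_mult[OF bounded_diff_DERIV[OF assms(1) that, of x] bounded_diff_DERIV[OF assms(2) that, of x]] by simp
  show "bounded_diff k (\<lambda>x. \<phi> x * \<psi> x)"
  proof (rule bounded_diffI[OF _ _ _ d])
    show "\<bar>\<phi> x * \<psi> x\<bar> \<le> K * K'" for x
      using mult_mono[OF K(1)[of x] K(2)[of x]] order_trans[OF abs_ge_zero K(1)[of x]] by (simp add: abs_mult)
    show "continuous_on UNIV (\<lambda>x. \<phi> x * \<psi> x)" using assms by (auto simp: bounded_diff_def intro!: continuous_intros)
    show "\<phi> x * \<psi> x = \<phi> y * \<psi> y" if "\<And>i. i < k \<Longrightarrow> x i = y i" for x y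
      using bounded_diff_cong[OF assms(1) that] bounded_diff_cong[OF assms(2) that] by simp
  qed
  show "i < k \<Longrightarrow> pd i (\<lambda>x. \<phi> x * \<psi> x) = (\<lambda>x. pd i \<phi> x * \<psi> x + pd i \<psi> x * \<phi> x)"
    by (rule pd_eqI[OF d])
qed

lemma bounded_diff_sin:
  assumes "bounded_diff k \<phi>"
  shows "bounded_diff k (\<lambda>x. sin (\<phi> x))" "i < k \<Longrightarrow> pd i (\<lambda>x. sin (\<phi> x)) = (\<lambda>x. cos (\<phi> x) * pd i \<phi> x)"
proof -
  have d: "((\<lambda>t. sin (\<phi> (x(i := t)))) has_real_derivative cos (\<phi> x) * pd i \<phi> x) (at (x i))"
    if "i < k" for i x
    using DERIV_fun_sin[OF bounded_diff_DERIV[OF assms that, of x]] by simp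
  show "bounded_diff k (\<lambda>x. sin (\<phi> x))"
  proof (rule bounded_diffI[OF _ _ _ d])
    show "\<bar>sin (\<phi> x)\<bar> \<le> 1" for x by simp
    show "continuous_on UNIV (\<lambda>x. sin (\<phi> x))" using assms by (auto simp: bounded_diff_def intro!: continuous_intros)
    show "sin (\<phi> x) = sin (\<phi> y)" if "\<And>i. i < k \<Longrightarrow> x i = y i" for x y
      using bounded_diff_cong[OF assms(1) that] by simp
  qed
  show "i < k \<Longrightarrow> pd i (\<lambda>x. sin (\<phi> x)) = (\<lambda>x. cos (\<phi> x) * pd i \<phi> x)"
    by (rule pd_eqI[OF d])
qed

lemma bounded_diff_cos:
  assumes "bounded_diff k \<phi>"
  shows "bounded_diff k (\<lambda>x. cos (\<phi> x))" "i < k \<Longrightarrow> pd i (\<lambda>x. cos (\<phi> x)) = (\<lambda>x. - 1 * (sin (\<phi> x) * pd i \<phi> x))"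
proof -
  have d: "((\<lambda>t. cos (\<phi> (x(i := t)))) has_real_derivative - 1 * (sin (\<phi> x) * pd i \<phi> x)) (at (x i))"
    if "i < k" for i x
    using DERIV_fun_cos[OF bounded_diff_DERIV[OF assms that, of x]] by simp
  show "bounded_diff k (\<lambda>x. cos (\<phi> x))"
  proof (rule bounded_diffI[OF _ _ _ d])
    show "\<bar>cos (\<phi> x)\<bar> \<le> 1" for x by simp
    show "continuous_on UNIV (\<lambda>x. cos (\<phi> x))" using assms by (auto simp: bounded_diff_def intro!: continuous_intros)
    show "cos (\<phi> x) = cos (\<phi> y)" if "\<And>i. i < k \<Longrightarrow> x i = y i" for x y
      using bounded_diff_cong[OF assms(1) that] by simp
  qed
  show "i < k \<Longrightarrow> pd i (\<lambda>x. cos (\<phi> x)) = (\<lambda>x. - 1 * (sin (\<phi> x) * pd i \<phi> x))"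
    by (rule pd_eqI[OF d])
qed

lemma smooth_algebra_bounded_diff: "\<phi> \<in> smooth_algebra k \<Longrightarrow> bounded_diff k \<phi>"
  by (induction rule: smooth_algebra.induct)
    (simp_all add: Cb_smooth_bounded_diff bounded_diff_const bounded_diff_add(1) bounded_diff_mult(1) bounded_diff_sin(1) bounded_diff_cos(1))

lemma smooth_algebra_pd: "\<phi> \<in> smooth_algebra k \<Longrightarrow> i < k \<Longrightarrow> pd i \<phi> \<in> smooth_algebra k"
proof (induction rule: smooth_algebra.induct)
  case (const c)
  have "pd i (\<lambda>x. c) = (\<lambda>x. 0)" by (rule pd_eqI) auto
  then show ?case by (simp add: smooth_algebra.const)
next
  case (base \<phi>)
  then show ?case by (intro smooth_algebra.base Cb_smooth_pd)
next
  case (add \<phi> \<psi>)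
  then show ?case
    unfolding bounded_diff_add(2)[OF smooth_algebra_bounded_diff[OF add.hyps(1)] smooth_algebra_bounded_diff[OF add.hyps(2)] add.prems]
    by (intro smooth_algebra.add)
next
  case (mult \<phi> \<psi>)
  then show ?case
    unfolding bounded_diff_mult(2)[OF smooth_algebra_bounded_diff[OF mult.hyps(1)] smooth_algebra_bounded_diff[OF mult.hyps(2)] mult.prems]
    by (intro smooth_algebra.add smooth_algebra.mult)
next
  case (sin \<phi>)
  then show ?case
    unfolding bounded_diff_sin(2)[OF smooth_algebra_bounded_diff[OF sin.hyps] sin.prems]
    by (intro smooth_algebra.mult smooth_algebra.cos)
next
  case (cos \<phi>)
  then show ?case
    unfolding bounded_diff_cos(2)[OF smooth_algebra_bounded_diff[OF cos.hyps] cos.prems]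
    by (intro smooth_algebra.mult smooth_algebra.sin smooth_algebra.const)
qed

lemma smooth_algebra_eq: "smooth_algebra k = Cb_smooth k"
proof
  show "smooth_algebra k \<subseteq> Cb_smooth k"
    using Cb_smooth_coinduct[of _ "smooth_algebra k" k] smooth_algebra_bounded_diff smooth_algebra_pd by blast
qed (auto intro: smooth_algebra.base)

lemma Cb_smooth_const: "(\<lambda>x. c) \<in> Cb_smooth k"
  and Cb_smooth_add: "\<phi> \<in> Cb_smooth k \<Longrightarrow> \<psi> \<in> Cb_smooth k \<Longrightarrow> (\<lambda>x. \<phi> x + \<psi> x) \<in> Cb_smooth k"
  and Cb_smooth_mult: "\<phi> \<in> Cb_smooth k \<Longrightarrow> \<psi> \<in> Cb_smooth k \<Longrightarrow> (\<lambda>x. \<phi> x * \<psi> x) \<in> Cb_smooth k"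
  and Cb_smooth_sin: "\<phi> \<in> Cb_smooth k \<Longrightarrow> (\<lambda>x. sin (\<phi> x)) \<in> Cb_smooth k"
  using smooth_algebra.intros[of _ k] by (simp_all add: smooth_algebra_eq)

lemma Cb_smooth_lin: "\<phi> \<in> Cb_smooth k \<Longrightarrow> \<psi> \<in> Cb_smooth k \<Longrightarrow> (\<lambda>x. a * \<phi> x + b * \<psi> x) \<in> Cb_smooth k"
  by (intro Cb_smooth_add Cb_smooth_mult Cb_smooth_const)

lemma pd_const: "pd i (\<lambda>x. c) = (\<lambda>x. 0)"
  by (rule pd_eqI) auto

lemma pd_lin:
  assumes "\<phi> \<in> Cb_smooth k" "\<psi> \<in> Cb_smooth k" "i < k"
  shows "pd i (\<lambda>x. a * \<phi> x + b * \<psi> x) = (\<lambda>x. a * pd i \<phi> x + b * pd i \<psi> x)"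
  by (rule pd_eqI, intro DERIV_add DERIV_cmult bounded_diff_DERIV[OF Cb_smooth_bounded_diff[OF assms(1)] assms(3)]
      bounded_diff_DERIV[OF Cb_smooth_bounded_diff[OF assms(2)] assms(3)])

text \<open>
  This allows two cylinder functions to be represented with a common tuple of base functions.
\<close>

lemma Cb_smooth_reindex:
  assumes \<phi>: "\<phi> \<in> Cb_smooth l" and e: "inj e" "\<And>j. j < l \<Longrightarrow> e j < n"
  shows "(\<lambda>x. \<phi> (\<lambda>j. x (e j))) \<in> Cb_smooth n"
proof -
  define S where "S = {\<lambda>x. \<phi> (\<lambda>j. x (e j)) | \<phi>. \<phi> \<in> Cb_smooth l} \<union> {\<lambda>x. 0}"
  have upd: "(\<lambda>j'. (x(e j := t)) (e j')) = (\<lambda>j'. x (e j'))(j := t)" for x :: "nat \<Rightarrow> real" and j t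
    using e(1) by (auto simp: fun_eq_iff inj_eq)
  have der: "((\<lambda>t. \<phi> (\<lambda>j. (x(i := t)) (e j))) has_real_derivative
      (if i \<in> e ` {..<l} then pd (inv e i) \<phi> (\<lambda>j. x (e j)) else 0)) (at (x i))"
    if \<phi>: "\<phi> \<in> Cb_smooth l" for i x \<phi>
  proof (cases "i \<in> e ` {..<l}")
    case True
    then obtain j where j: "j < l" "i = e j" by auto
    have "((\<lambda>t. \<phi> (\<lambda>j'. (x(e j := t)) (e j'))) has_real_derivative pd j \<phi> (\<lambda>j. x (e j))) (at (x (e j)))"
      unfolding upd by (rule bounded_diff_DERIV[OF Cb_smooth_bounded_diff[OF \<phi>] j(1)])
    then show ?thesis using e(1) True unfolding j(2) by (simp del: fun_upd_apply)
  next
    case False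
    have "\<phi> (\<lambda>j. (x(i := t)) (e j)) = \<phi> (\<lambda>j. x (e j))" for t
      using False by (intro bounded_diff_cong[OF Cb_smooth_bounded_diff[OF \<phi>]]) auto
    then show ?thesis using False by simp
  qed
  show ?thesis
  proof (rule Cb_smooth_coinduct[of _ S])
    show "(\<lambda>x. \<phi> (\<lambda>j. x (e j))) \<in> S" using \<phi> by (auto simp: S_def)
  next
    fix \<psi> assume "\<psi> \<in> S"
    then consider "\<psi> = (\<lambda>x. 0)" | \<phi> where "\<phi> \<in> Cb_smooth l" "\<psi> = (\<lambda>x. \<phi> (\<lambda>j. x (e j)))"
      by (auto simp: S_def)
    then show "bounded_diff n \<psi>"
    proof cases
      case (2 \<phi>)
      obtain K where K: "\<And>x. \<bar>\<phi> x\<bar> \<le> K" using bounded_diff_bounded[OF Cb_smooth_bounded_diff[OF 2(1)]] by blast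
      show ?thesis unfolding 2(2)
      proof (rule bounded_diffI[OF _ _ _ der[OF 2(1)]])
        show "\<phi> (\<lambda>j. x (e j)) = \<phi> (\<lambda>j. y (e j))" if "\<And>i. i < n \<Longrightarrow> x i = y i" for x y
          using that e(2) by (intro bounded_diff_cong[OF Cb_smooth_bounded_diff[OF 2(1)]]) auto
        show "\<bar>\<phi> (\<lambda>j. x (e j))\<bar> \<le> K" for x by (rule K)
        have c: "continuous_on UNIV \<phi>" using Cb_smooth_bounded_diff[OF 2(1)] by (simp add: bounded_diff_def)
        show "continuous_on UNIV (\<lambda>x. \<phi> (\<lambda>j. x (e j)))"
          by (intro continuous_on_compose2[OF c] continuous_on_coordinatewise_then_product
            continuous_on_product_coordinates) auto
      qed
    qed (simp add: bounded_diff_const)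
    fix i assume "i < n"
    show "pd i \<psi> \<in> S"
      using \<open>\<psi> \<in> S\<close>
    proof (cases rule: UnE[OF \<open>\<psi> \<in> S\<close>[unfolded S_def], case_names 1 2])
      case 1
      then obtain \<phi> where \<phi>: "\<phi> \<in> Cb_smooth l" "\<psi> = (\<lambda>x. \<phi> (\<lambda>j. x (e j)))" by auto
      have p: "pd i \<psi> = (\<lambda>x. if i \<in> e ` {..<l} then pd (inv e i) \<phi> (\<lambda>j. x (e j)) else 0)"
        unfolding \<phi>(2) by (rule pd_eqI[OF der[OF \<phi>(1)]])
      show ?thesis
      proof (cases "i \<in> e ` {..<l}")
        case True
        then have "pd (inv e i) \<phi> \<in> Cb_smooth l" using e(1) by (auto intro!: Cb_smooth_pd \<phi>(1))
        then show ?thesis using True by (auto simp: p S_def)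
      qed (simp add: p S_def)
    qed (simp add: pd_const S_def)
  qed
qed

lemma Cb_smooth_translate:
  assumes \<phi>: "\<phi> \<in> Cb_smooth k"
  shows "(\<lambda>x. \<phi> (\<lambda>j. c j + x j)) \<in> Cb_smooth k"
    "i < k \<Longrightarrow> pd i (\<lambda>x. \<phi> (\<lambda>j. c j + x j)) = (\<lambda>x. pd i \<phi> (\<lambda>j. c j + x j))"
proof -
  define S where "S = {\<lambda>x. \<phi> (\<lambda>j. c j + x j) | \<phi>. \<phi> \<in> Cb_smooth k}"
  have der: "((\<lambda>t. \<phi> (\<lambda>j. c j + (x(i := t)) j)) has_real_derivative pd i \<phi> (\<lambda>j. c j + x j)) (at (x i))"
    if "\<phi> \<in> Cb_smooth k" "i < k" for \<phi> i x
  proof -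
    let ?y = "\<lambda>j. c j + x j"
    have "((\<lambda>t. \<phi> (?y(i := t))) has_real_derivative pd i \<phi> ?y) (at (x i + c i))"
      using bounded_diff_DERIV[OF Cb_smooth_bounded_diff[OF that(1)] that(2), of ?y] by (simp add: add.commute)
    then have "((\<lambda>t. \<phi> (?y(i := t + c i))) has_real_derivative pd i \<phi> ?y) (at (x i))"
      using DERIV_shift[of "\<lambda>t. \<phi> (?y(i := t))" "pd i \<phi> ?y" "x i" "c i"] by simp
    moreover have "?y(i := t + c i) = (\<lambda>j. c j + (x(i := t)) j)" for t by auto
    ultimately show ?thesis by simp
  qed
  have pd: "pd i (\<lambda>x. \<phi> (\<lambda>j. c j + x j)) = (\<lambda>x. pd i \<phi> (\<lambda>j. c j + x j))" if "\<phi> \<in> Cb_smooth k" "i < k" for \<phi> i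
    by (rule pd_eqI[OF der[OF that]])
  then show "i < k \<Longrightarrow> pd i (\<lambda>x. \<phi> (\<lambda>j. c j + x j)) = (\<lambda>x. pd i \<phi> (\<lambda>j. c j + x j))" using \<phi> by blast
  show "(\<lambda>x. \<phi> (\<lambda>j. c j + x j)) \<in> Cb_smooth k"
  proof (rule Cb_smooth_coinduct[of _ S])
    show "(\<lambda>x. \<phi> (\<lambda>j. c j + x j)) \<in> S" using \<phi> by (auto simp: S_def)
  next
    fix \<psi> assume "\<psi> \<in> S"
    then obtain \<phi> where \<phi>: "\<phi> \<in> Cb_smooth k" and \<psi>: "\<psi> = (\<lambda>x. \<phi> (\<lambda>j. c j + x j))" by (auto simp: S_def)
    obtain K where K: "\<And>x. \<bar>\<phi> x\<bar> \<le> K" using bounded_diff_bounded[OF Cb_smooth_bounded_diff[OF \<phi>]] by blast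
    show "bounded_diff k \<psi>" unfolding \<psi>
    proof (rule bounded_diffI[OF _ _ _ der[OF \<phi>]])
      show "\<phi> (\<lambda>j. c j + x j) = \<phi> (\<lambda>j. c j + y j)" if "\<And>i. i < k \<Longrightarrow> x i = y i" for x y
        using that by (intro bounded_diff_cong[OF Cb_smooth_bounded_diff[OF \<phi>]]) auto
      show "\<bar>\<phi> (\<lambda>j. c j + x j)\<bar> \<le> K" for x by (rule K)
      have c: "continuous_on UNIV \<phi>" using Cb_smooth_bounded_diff[OF \<phi>] by (simp add: bounded_diff_def)
      show "continuous_on UNIV (\<lambda>x. \<phi> (\<lambda>j. c j + x j))"
        by (intro continuous_on_compose2[OF c] continuous_on_coordinatewise_then_product continuous_on_add
          continuous_on_const continuous_on_product_coordinates) auto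
    qed
    fix i assume "i < k"
    then show "pd i \<psi> \<in> S" using pd[OF \<phi>] Cb_smooth_pd[OF \<phi>] by (auto simp: \<psi> S_def)
  qed
qed

section \<open>Configurations as countable families of points\<close>

context borel_extension
begin

text \<open>
  The configuration with points \<open>x i\<close>, where \<open>i\<close> runs through \<open>P\<close>.  An arbitrary index set is used
  instead of an initial segment of the naturals, so that deleting a point deletes an index.
\<close>

definition point_config :: "nat set \<Rightarrow> (nat \<Rightarrow> 'a) \<Rightarrow> 'a measure" where
  "point_config P x = distr (count_space P) m x"

text \<open>
  Only finitely many of the points lie in each bounded measurable set.
\<close>

definition locally_finite_points :: "nat set \<Rightarrow> (nat \<Rightarrow> 'a) \<Rightarrow> bool" where
  "locally_finite_points P x \<longleftrightarrow> (\<forall>E\<in>bounded_sets m. finite {i \<in> P. x i \<in> E})"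

lemma x_measurable: "(x :: nat \<Rightarrow> 'a) \<in> count_space P \<rightarrow>\<^sub>M m"
  by (simp add: space_UNIV)

lemma sets_point_config: "sets (point_config P x) = sets m"
  by (simp add: point_config_def)

lemma emeasure_point_config:
  assumes "A \<in> sets m"
  shows "emeasure (point_config P x) A = emeasure (count_space P) {i \<in> P. x i \<in> A}"
    "emeasure (point_config P x) A = (\<integral>\<^sup>+i. indicator A (x i) \<partial>count_space P)"
proof -
  have eq: "x -` A \<inter> P = {i \<in> P. x i \<in> A}" by auto
  show 1: "emeasure (point_config P x) A = emeasure (count_space P) {i \<in> P. x i \<in> A}"
    unfolding point_config_def by (subst emeasure_distr[OF x_measurable assms]) (simp add: eq)
  have "(\<integral>\<^sup>+i. indicator A (x i) \<partial>count_space P) = (\<integral>\<^sup>+i. indicator {i \<in> P. x i \<in> A} i \<partial>count_space P)"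
    by (intro nn_integral_cong) (auto simp: indicator_def)
  then show "emeasure (point_config P x) A = (\<integral>\<^sup>+i. indicator A (x i) \<partial>count_space P)"
    unfolding 1 by simp
qed

lemma point_config_finite_iff:
  "(\<forall>E\<in>bounded_sets m. emeasure (point_config P x) E < \<infinity>) \<longleftrightarrow> locally_finite_points P x"
proof -
  have "emeasure (point_config P x) E < \<infinity> \<longleftrightarrow> finite {i \<in> P. x i \<in> E}" if "E \<in> bounded_sets m" for E
    using that by (auto simp: bounded_sets_def emeasure_point_config(1) emeasure_count_space of_nat_less_top)
  then show ?thesis by (simp add: locally_finite_points_def)
qed

lemma config_as_points:
  assumes \<gamma>: "\<gamma> \<in> configs m"
  obtains P x where "\<gamma> = point_config P x" "locally_finite_points P x"
proof -
  obtain N :: enat and x :: "nat \<Rightarrow> 'a" where x: "\<And>A. A \<in> sets m \<Longrightarrow>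
      emeasure \<gamma> A = (\<Sum>i. if enat i < N then indicator A (x i) else 0)"
    using \<gamma> by (auto simp: configs_def)
  define P where "P = {i. enat i < N}"
  have "\<gamma> = point_config P x"
  proof (rule measure_eqI)
    show "sets \<gamma> = sets (point_config P x)" using configs_sets[OF \<gamma>] by (simp add: sets_point_config)
    fix A assume "A \<in> sets \<gamma>"
    then have A: "A \<in> sets m" using configs_sets[OF \<gamma>] by simp
    have "emeasure (point_config P x) A = (\<integral>\<^sup>+i. indicator A (x i) * indicator P i \<partial>count_space UNIV)"
      unfolding emeasure_point_config(2)[OF A] by (rule nn_integral_count_space_indicator) simp
    also have "\<dots> = (\<Sum>i. indicator A (x i) * indicator P i)" by (rule nn_integral_count_space_nat)
    also have "\<dots> = emeasure \<gamma> A"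
      unfolding x[OF A] by (intro suminf_cong) (auto simp: P_def indicator_def)
    finally show "emeasure \<gamma> A = emeasure (point_config P x) A" by simp
  qed
  moreover from this have "locally_finite_points P x"
    using config_finite[OF \<gamma>] by (subst point_config_finite_iff[symmetric]) simp
  ultimately show ?thesis by (rule that)
qed

lemma point_config_in_configs:
  assumes lf: "locally_finite_points P x"
  shows "point_config P x \<in> configs m"
proof -
  obtain N :: enat and h where h: "bij_betw h {i. enat i < N} P"
  proof (cases "finite P")
    case True
    then obtain h where "bij_betw h {0..<card P} P" using ex_bij_betw_nat_finite by blast
    moreover have "{0..<card P} = {i. enat i < enat (card P)}" by auto
    ultimately show ?thesis using that[of h "enat (card P)"] by simp
  next
    case False
    then have "bij_betw (enumerate P) {i. enat i < \<infinity>} P" using bij_enumerate by simp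
    then show ?thesis by (rule that)
  qed
  have "emeasure (point_config P x) A = (\<Sum>i. if enat i < N then indicator A ((x \<circ> h) i) else 0)"
    if A: "A \<in> sets m" for A
  proof -
    have "emeasure (point_config P x) A = (\<integral>\<^sup>+i. indicator A (x (h i)) \<partial>count_space {i. enat i < N})"
      unfolding emeasure_point_config(2)[OF A] by (rule nn_integral_bij_count_space[OF h, symmetric])
    also have "\<dots> = (\<integral>\<^sup>+i. indicator A (x (h i)) * indicator {i. enat i < N} i \<partial>count_space UNIV)"
      by (rule nn_integral_count_space_indicator) simp
    also have "\<dots> = (\<Sum>i. indicator A (x (h i)) * indicator {i. enat i < N} i)"
      by (rule nn_integral_count_space_nat)
    also have "\<dots> = (\<Sum>i. if enat i < N then indicator A ((x \<circ> h) i) else 0)"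
      by (intro suminf_cong) (auto simp: indicator_def)
    finally show ?thesis .
  qed
  then have 1: "\<forall>A\<in>sets m. emeasure (point_config P x) A = (\<Sum>i. if enat i < N then indicator A ((x \<circ> h) i) else 0)"
    by (rule ballI)
  have 2: "\<forall>E\<in>bounded_sets m. emeasure (point_config P x) E < \<infinity>"
    using lf by (simp only: point_config_finite_iff)
  show ?thesis
    unfolding configs_def mem_Collect_eq
    by (rule conjI[OF sets_point_config], rule conjI[OF _ 2], rule exI[of _ N], rule exI[of _ "x \<circ> h"], rule 1)
qed

lemma locally_finite_remove: "locally_finite_points P x \<Longrightarrow> locally_finite_points (P - {i}) x"
  unfolding locally_finite_points_def
proof
  fix E assume "\<forall>E\<in>bounded_sets m. finite {i \<in> P. x i \<in> E}" "E \<in> bounded_sets m"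
  then have "finite {i \<in> P. x i \<in> E}" by blast
  then show "finite {j \<in> P - {i}. x j \<in> E}" by (rule rev_finite_subset) auto
qed

lemma locally_finite_move: "locally_finite_points P x \<Longrightarrow> locally_finite_points P (x(i := y))"
  unfolding locally_finite_points_def
proof
  fix E assume "\<forall>E\<in>bounded_sets m. finite {i \<in> P. x i \<in> E}" "E \<in> bounded_sets m"
  then have "finite (insert i {i \<in> P. x i \<in> E})" by blast
  then show "finite {j \<in> P. (x(i := y)) j \<in> E}" by (rule rev_finite_subset) auto
qed

text \<open>
  Measurable functions vanishing outside a bounded measurable set.
\<close>

definition bounded_support :: "('a \<Rightarrow> real) \<Rightarrow> bool" where
  "bounded_support f \<longleftrightarrow> f \<in> borel_measurable m \<and> (\<exists>E\<in>bounded_sets m. \<forall>x. x \<notin> E \<longrightarrow> f x = 0)"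

lemma bounded_support_finite:
  assumes "bounded_support f" "locally_finite_points P x"
  shows "finite {i \<in> P. f (x i) \<noteq> 0}"
proof -
  obtain E where E: "E \<in> bounded_sets m" "\<And>x. x \<notin> E \<Longrightarrow> f x = 0" using assms(1) by (auto simp: bounded_support_def)
  then have "finite {i \<in> P. x i \<in> E}" using assms(2) by (simp add: locally_finite_points_def)
  then show ?thesis by (rule rev_finite_subset) (use E(2) in blast)
qed

lemma integrable_count_space_support:
  fixes g :: "nat \<Rightarrow> real"
  assumes "finite {i \<in> P. g i \<noteq> 0}"
  shows "integrable (count_space P) g"
proof -
  have "{i \<in> P. 0 < ennreal (norm (g i))} = {i \<in> P. g i \<noteq> 0}" by auto
  then show ?thesis
    using assms by (auto simp: integrable_iff_bounded nn_integral_count_space)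
qed

lemma star_point_config:
  assumes "bounded_support f"
  shows "star f (point_config P x) = (\<integral>i. f (x i) \<partial>count_space P)"
  using assms unfolding star_def point_config_def bounded_support_def
  by (intro integral_distr x_measurable) auto

lemma star_remove:
  assumes f: "bounded_support f" and lf: "locally_finite_points P x" and i: "i \<in> P"
  shows "star f (point_config P x) = star f (point_config (P - {i}) x) + f (x i)"
proof -
  let ?I = "insert i {j \<in> P. f (x j) \<noteq> 0}"
  have fin: "finite {j \<in> P. f (x j) \<noteq> 0}" by (rule bounded_support_finite[OF f lf])
  have "star f (point_config P x) = (\<Sum>j | j \<in> P \<and> f (x j) \<noteq> 0. f (x j))"
    unfolding star_point_config[OF f] by (rule lebesgue_integral_count_space_finite_support[OF fin])
  also have "\<dots> = (\<Sum>j\<in>?I. f (x j))" using fin i by (intro sum.mono_neutral_left) auto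
  also have "\<dots> = f (x i) + (\<Sum>j\<in>?I - {i}. f (x j))" using fin by (intro sum.remove) auto
  also have "(\<Sum>j\<in>?I - {i}. f (x j)) = (\<Sum>j | j \<in> P - {i} \<and> f (x j) \<noteq> 0. f (x j))"
    by (intro sum.cong) auto
  also have "\<dots> = star f (point_config (P - {i}) x)"
    unfolding star_point_config[OF f]
    by (intro lebesgue_integral_count_space_finite_support[symmetric] bounded_support_finite[OF f] locally_finite_remove lf)
  finally show ?thesis by simp
qed

lemma star_move:
  assumes f: "bounded_support f" and lf: "locally_finite_points P x" and i: "i \<in> P"
  shows "star f (point_config P (x(i := y))) = star f (point_config (P - {i}) x) + f y"
proof -
  have "point_config (P - {i}) (x(i := y)) = point_config (P - {i}) x"
    unfolding point_config_def by (rule distr_cong) auto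
  then show ?thesis using star_remove[OF f locally_finite_move[OF lf] i, of i y] by simp
qed

lemma star_finite:
  assumes f: "bounded_support f" and lf: "locally_finite_points P x"
  shows "integrable (count_space P) (\<lambda>i. f (x i))"
  by (rule integrable_count_space_support[OF bounded_support_finite[OF assms]])

lemma config_integrable:
  assumes f: "bounded_support f" and \<gamma>: "\<gamma> \<in> configs m"
  shows "integrable \<gamma> f"
proof -
  obtain P x where P: "\<gamma> = point_config P x" "locally_finite_points P x" using config_as_points[OF \<gamma>] .
  have "f \<in> borel_measurable m" using f by (simp add: bounded_support_def)
  then show ?thesis
    unfolding P(1) point_config_def using star_finite[OF f P(2)] by (subst integrable_distr_eq[OF x_measurable])
qed

section \<open>Measurability on the configuration space\<close>

lemma space_config_algebra: "space (config_algebra m) = configs m"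
  unfolding config_algebra_def by (rule space_measure_of) auto

lemma emeasure_config_measurable:
  assumes E: "E \<in> bounded_sets m"
  shows "(\<lambda>\<gamma>. emeasure \<gamma> E) \<in> borel_measurable (config_algebra m)"
proof (rule measurableI)
  fix B :: "ennreal set" assume B: "B \<in> sets borel"
  have "(\<lambda>\<gamma>. emeasure \<gamma> E) -` B \<inter> space (config_algebra m) = {\<gamma> \<in> configs m. emeasure \<gamma> E \<in> B}"
    by (auto simp: space_config_algebra)
  also have "\<dots> \<in> sets (config_algebra m)"
    unfolding config_algebra_def using E B by (intro in_measure_of) auto
  finally show "(\<lambda>\<gamma>. emeasure \<gamma> E) -` B \<inter> space (config_algebra m) \<in> sets (config_algebra m)" .
qed auto

lemma bounded_sets_Int: "A \<in> sets m \<Longrightarrow> E \<in> bounded_sets m \<Longrightarrow> A \<inter> E \<in> bounded_sets m"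
  by (auto simp: bounded_sets_def bounded_subset)

lemma nn_integral_config_measurable:
  assumes E: "E \<in> bounded_sets m" and f: "f \<in> borel_measurable m"
  shows "(\<lambda>\<gamma>. \<integral>\<^sup>+x. f x * indicator E x \<partial>\<gamma>) \<in> borel_measurable (config_algebra m)"
  using f
proof (induction f rule: borel_measurable_induct)
  have Em: "E \<in> sets m" using E by (simp add: bounded_sets_def)
  have meas: "g \<in> borel_measurable \<gamma>" if "g \<in> borel_measurable m" "\<gamma> \<in> configs m" for g :: "'a \<Rightarrow> ennreal" and \<gamma>
    using that configs_sets[OF that(2)] measurable_cong_sets by blast
  {
    case (cong f g)
    then have "f = g" using space_UNIV by auto
    then show ?case using cong by simp
  next
    case (set A)
    have "(\<integral>\<^sup>+x. indicator A x * indicator E x \<partial>\<gamma>) = emeasure \<gamma> (A \<inter> E)" if "\<gamma> \<in> configs m" for \<gamma>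
    proof -
      have "(\<integral>\<^sup>+x. indicator A x * indicator E x \<partial>\<gamma>) = (\<integral>\<^sup>+x. indicator (A \<inter> E) x \<partial>\<gamma>)"
        by (intro nn_integral_cong) (auto simp: indicator_def)
      also have "\<dots> = emeasure \<gamma> (A \<inter> E)" using set Em configs_sets[OF that] by simp
      finally show ?thesis .
    qed
    then show ?case
      using emeasure_config_measurable[OF bounded_sets_Int[OF set E]]
      by (subst measurable_cong[where g = "\<lambda>\<gamma>. emeasure \<gamma> (A \<inter> E)"]) (auto simp: space_config_algebra)
  next
    case (mult u c)
    have "(\<integral>\<^sup>+x. (c * u x) * indicator E x \<partial>\<gamma>) = c * (\<integral>\<^sup>+x. u x * indicator E x \<partial>\<gamma>)" if "\<gamma> \<in> configs m" for \<gamma>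
      unfolding mult.assoc
      by (intro nn_integral_cmult borel_measurable_times_ennreal meas[OF _ that] mult.hyps borel_measurable_indicator Em)
    then show ?case
      using mult.IH by (subst measurable_cong[where g = "\<lambda>\<gamma>. c * (\<integral>\<^sup>+x. u x * indicator E x \<partial>\<gamma>)"])
        (auto simp: space_config_algebra)
  next
    case (add u v)
    have "(\<integral>\<^sup>+x. (v x + u x) * indicator E x \<partial>\<gamma>) =
        (\<integral>\<^sup>+x. v x * indicator E x \<partial>\<gamma>) + (\<integral>\<^sup>+x. u x * indicator E x \<partial>\<gamma>)" if "\<gamma> \<in> configs m" for \<gamma>
      unfolding distrib_right
      by (intro nn_integral_add borel_measurable_times_ennreal meas[OF _ that] add.hyps borel_measurable_indicator Em)
    then show ?case
      using add.IH by (subst measurable_cong[where g = "\<lambda>\<gamma>. (\<integral>\<^sup>+x. v x * indicator E x \<partial>\<gamma>) + (\<integral>\<^sup>+x. u x * indicator E x \<partial>\<gamma>)"])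
        (auto simp: space_config_algebra)
  next
    case (seq U)
    have "(\<integral>\<^sup>+x. (Sup (range U)) x * indicator E x \<partial>\<gamma>) = (SUP i. \<integral>\<^sup>+x. U i x * indicator E x \<partial>\<gamma>)" if "\<gamma> \<in> configs m" for \<gamma>
    proof -
      have "(\<integral>\<^sup>+x. (Sup (range U)) x * indicator E x \<partial>\<gamma>) = (\<integral>\<^sup>+x. (SUP i. U i x * indicator E x) \<partial>\<gamma>)"
        by (intro nn_integral_cong) (simp add: SUP_mult_right_ennreal image_comp)
      also have "\<dots> = (SUP i. \<integral>\<^sup>+x. U i x * indicator E x \<partial>\<gamma>)"
      proof (rule nn_integral_monotone_convergence_SUP)
        show "incseq (\<lambda>i x. U i x * indicator E x)"
          using seq(3) by (auto simp: incseq_def le_fun_def intro!: mult_right_mono)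
        show "(\<lambda>x. U i x * indicator E x) \<in> borel_measurable \<gamma>" for i
          by (intro borel_measurable_times_ennreal meas[OF _ that] seq.hyps borel_measurable_indicator Em)
      qed
      finally show ?thesis .
    qed
    then show ?case
      using seq.IH by (subst measurable_cong[where g = "\<lambda>\<gamma>. SUP i. \<integral>\<^sup>+x. U i x * indicator E x \<partial>\<gamma>"])
        (auto simp: space_config_algebra)
  }
qed

lemma star_measurable:
  assumes f: "bounded_support f"
  shows "star f \<in> borel_measurable (config_algebra m)"
proof -
  obtain E where E: "E \<in> bounded_sets m" "\<And>x. x \<notin> E \<Longrightarrow> f x = 0"
    and [measurable]: "f \<in> borel_measurable m" using f by (auto simp: bounded_support_def)
  have "star f \<gamma> = enn2real (\<integral>\<^sup>+x. ennreal (f x) * indicator E x \<partial>\<gamma>) -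
      enn2real (\<integral>\<^sup>+x. ennreal (- f x) * indicator E x \<partial>\<gamma>)" if \<gamma>: "\<gamma> \<in> configs m" for \<gamma>
  proof -
    have "integrable \<gamma> f" by (rule config_integrable[OF f \<gamma>])
    then have "star f \<gamma> = enn2real (\<integral>\<^sup>+x. ennreal (f x) \<partial>\<gamma>) - enn2real (\<integral>\<^sup>+x. ennreal (- f x) \<partial>\<gamma>)"
      unfolding star_def by (rule real_lebesgue_integral_def)
    moreover have "(\<integral>\<^sup>+x. ennreal (f x) \<partial>\<gamma>) = (\<integral>\<^sup>+x. ennreal (f x) * indicator E x \<partial>\<gamma>)"
      "(\<integral>\<^sup>+x. ennreal (- f x) \<partial>\<gamma>) = (\<integral>\<^sup>+x. ennreal (- f x) * indicator E x \<partial>\<gamma>)"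
      using E(2) by (auto intro!: nn_integral_cong simp: indicator_def)
    ultimately show ?thesis by simp
  qed
  moreover have "(\<lambda>\<gamma>. enn2real (\<integral>\<^sup>+x. ennreal (f x) * indicator E x \<partial>\<gamma>) -
      enn2real (\<integral>\<^sup>+x. ennreal (- f x) * indicator E x \<partial>\<gamma>)) \<in> borel_measurable (config_algebra m)"
    by (intro borel_measurable_diff borel_measurable_enn2real nn_integral_config_measurable[OF E(1)]) auto
  ultimately show ?thesis by (subst measurable_cong) (auto simp: space_config_algebra)
qed

lemma star_bound:
  assumes f: "bounded_support f" and E: "E \<in> bounded_sets m" "\<And>x. x \<notin> E \<Longrightarrow> f x = 0" "\<And>x. \<bar>f x\<bar> \<le> K"
    and \<gamma>: "\<gamma> \<in> configs m"
  shows "ennreal \<bar>star f \<gamma>\<bar> \<le> ennreal K * emeasure \<gamma> E"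
proof -
  have Em: "E \<in> sets \<gamma>" using E(1) configs_sets[OF \<gamma>] by (simp add: bounded_sets_def)
  have "ennreal \<bar>star f \<gamma>\<bar> \<le> (\<integral>\<^sup>+x. ennreal \<bar>f x\<bar> \<partial>\<gamma>)"
    unfolding star_def using integral_norm_bound_ennreal[OF config_integrable[OF f \<gamma>]] by simp
  also have "\<dots> \<le> (\<integral>\<^sup>+x. ennreal K * indicator E x \<partial>\<gamma>)"
    using E(2,3) by (intro nn_integral_mono) (auto simp: indicator_def intro!: ennreal_leI)
  also have "\<dots> = ennreal K * emeasure \<gamma> E" using Em by (simp add: nn_integral_cmult)
  finally show ?thesis .
qed

end

section \<open>The square field operator on cylinder functions\<close>

text \<open>
  A metric local diffusion space with a fixed strong lifting.
\<close>

locale lifted_diffusion_space = metric_local_diffusion_space m D \<Gamma>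
  for m :: "'a::polish_space measure" and D \<Gamma> +
  fixes lft :: "('a \<Rightarrow> real) \<Rightarrow> ('a \<Rightarrow> real)"
  assumes lifting: "strong_lifting m lft"
begin

sublocale borel_extension m
  by standard (rule space_m borel_le)+

lemma lft_cong: "f \<in> Linf m \<Longrightarrow> g \<in> Linf m \<Longrightarrow> AE x in m. f x = g x \<Longrightarrow> lft f = lft g"
  by (rule lifting[unfolded strong_lifting_def, THEN conjunct1, rule_format])

lemma lft_Linf: "f \<in> Linf m \<Longrightarrow> lft f \<in> Linf m"
  by (rule lifting[unfolded strong_lifting_def, THEN conjunct2, THEN conjunct1, rule_format])

lemma lft_lin: "f \<in> Linf m \<Longrightarrow> g \<in> Linf m \<Longrightarrow>
    lft (\<lambda>y. a * f y + b * g y) x = a * lft f x + b * lft g x"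
  by (rule lifting[unfolded strong_lifting_def, THEN conjunct2, THEN conjunct2, THEN conjunct2, THEN conjunct1, rule_format])

lemma lft_mult: "f \<in> Linf m \<Longrightarrow> g \<in> Linf m \<Longrightarrow> lft (\<lambda>y. f y * g y) x = lft f x * lft g x"
  by (rule lifting[unfolded strong_lifting_def, THEN conjunct2, THEN conjunct2, THEN conjunct2, THEN conjunct2, THEN conjunct1, rule_format])

lemma lft_mono: "f \<in> Linf m \<Longrightarrow> g \<in> Linf m \<Longrightarrow> AE x in m. f x \<le> g x \<Longrightarrow> lft f x \<le> lft g x"
  by (rule lifting[unfolded strong_lifting_def, THEN conjunct2, THEN conjunct2, THEN conjunct2, THEN conjunct2, THEN conjunct2, THEN conjunct1, rule_format])

lemma lft_continuous: "continuous_on UNIV \<phi> \<Longrightarrow> bounded (range \<phi>) \<Longrightarrow> lft \<phi> = \<phi>"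
  by (rule lifting[unfolded strong_lifting_def, THEN conjunct2, THEN conjunct2, THEN conjunct2, THEN conjunct2, THEN conjunct2, THEN conjunct2, THEN conjunct2, rule_format, OF conjI])

lemma Linf_iff: "f \<in> Linf m \<longleftrightarrow> f \<in> borel_measurable m \<and> (\<exists>K. \<forall>x. \<bar>f x\<bar> \<le> K)"
  by (auto simp: Linf_def bounded_iff space_UNIV)

lemma LinfI: "f \<in> borel_measurable m \<Longrightarrow> (\<And>x. \<bar>f x\<bar> \<le> K) \<Longrightarrow> f \<in> Linf m"
  unfolding Linf_iff by (intro conjI exI[of _ K] allI)

lemma LinfE:
  assumes "f \<in> Linf m"
  obtains K where "f \<in> borel_measurable m" "\<forall>x. \<bar>f x\<bar> \<le> K" "0 \<le> K"
proof -
  obtain K where K: "f \<in> borel_measurable m" "\<forall>x. \<bar>f x\<bar> \<le> K" using assms unfolding Linf_iff by auto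
  show ?thesis using K order_trans[OF abs_ge_zero K(2)[rule_format, of undefined]] by (intro that[of K]) auto
qed

lemma Linf_lin:
  assumes "f \<in> Linf m" "g \<in> Linf m"
  shows "(\<lambda>x. a * f x + b * g x) \<in> Linf m"
proof -
  obtain K where K: "f \<in> borel_measurable m" "\<forall>x. \<bar>f x\<bar> \<le> K" "0 \<le> K" by (rule LinfE[OF assms(1)])
  obtain K' where K': "g \<in> borel_measurable m" "\<forall>x. \<bar>g x\<bar> \<le> K'" "0 \<le> K'" by (rule LinfE[OF assms(2)])
  show ?thesis
  proof (rule LinfI)
    show "(\<lambda>x. a * f x + b * g x) \<in> borel_measurable m" using K(1) K'(1) by measurable
    fix x
    have "\<bar>a * f x + b * g x\<bar> \<le> \<bar>a\<bar> * \<bar>f x\<bar> + \<bar>b\<bar> * \<bar>g x\<bar>" by (metis abs_mult abs_triangle_ineq)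
    also have "\<dots> \<le> \<bar>a\<bar> * K + \<bar>b\<bar> * K'" using K(2) K'(2) by (intro add_mono mult_left_mono) auto
    finally show "\<bar>a * f x + b * g x\<bar> \<le> \<bar>a\<bar> * K + \<bar>b\<bar> * K'" .
  qed
qed

lemma Linf_mult:
  assumes "f \<in> Linf m" "g \<in> Linf m"
  shows "(\<lambda>x. f x * g x) \<in> Linf m"
proof -
  obtain K where K: "f \<in> borel_measurable m" "\<forall>x. \<bar>f x\<bar> \<le> K" "0 \<le> K" by (rule LinfE[OF assms(1)])
  obtain K' where K': "g \<in> borel_measurable m" "\<forall>x. \<bar>g x\<bar> \<le> K'" "0 \<le> K'" by (rule LinfE[OF assms(2)])
  show ?thesis
  proof (rule LinfI)
    show "(\<lambda>x. f x * g x) \<in> borel_measurable m" using K(1) K'(1) by measurable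
    show "\<bar>f x * g x\<bar> \<le> K * K'" for x
      unfolding abs_mult by (intro mult_mono K(2)[rule_format] K'(2)[rule_format] K(3) K'(3) abs_ge_zero)
  qed
qed

lemma Linf_continuous: "continuous_on UNIV \<phi> \<Longrightarrow> bounded (range \<phi>) \<Longrightarrow> \<phi> \<in> Linf m"
  by (simp add: Linf_def continuous_measurable space_UNIV)

lemma Linf_const: "(\<lambda>x. c) \<in> Linf m"
  by (rule Linf_continuous) auto

lemma lft_const: "lft (\<lambda>x. c) = (\<lambda>x. c)"
  by (rule lft_continuous) auto

lemma Linf_sum:
  "finite I \<Longrightarrow> (\<And>i. i \<in> I \<Longrightarrow> h i \<in> Linf m) \<Longrightarrow> (\<lambda>y. \<Sum>i\<in>I. h i y) \<in> Linf m"
proof (induction I rule: finite_induct)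
  case (insert i I)
  then have "(\<lambda>y. 1 * h i y + 1 * (\<Sum>i\<in>I. h i y)) \<in> Linf m" by (intro Linf_lin) auto
  then show ?case using insert by simp
qed (simp add: Linf_const)

lemma lft_sum:
  "finite I \<Longrightarrow> (\<And>i. i \<in> I \<Longrightarrow> h i \<in> Linf m) \<Longrightarrow> lft (\<lambda>y. \<Sum>i\<in>I. h i y) x = (\<Sum>i\<in>I. lft (h i) x)"
proof (induction I rule: finite_induct)
  case (insert i I)
  have "lft (\<lambda>y. 1 * h i y + 1 * (\<Sum>i\<in>I. h i y)) x = 1 * lft (h i) x + 1 * lft (\<lambda>y. \<Sum>i\<in>I. h i y) x"
    by (intro lft_lin Linf_sum insert) (use insert in auto)
  then show ?case using insert by simp
qed (simp add: lft_const)

lemma D_imp_bounded_support: "f \<in> D \<Longrightarrow> bounded_support f"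
proof -
  assume f: "f \<in> D"
  then obtain B where B: "bounded B" "\<And>x. x \<notin> B \<Longrightarrow> f x = 0" using D_bounded_support by blast
  have "closure B \<in> bounded_sets m" using bounded_closure[OF B(1)] by (simp add: bounded_sets_def closed_sets_m)
  moreover have "f x = 0" if "x \<notin> closure B" for x using B(2) that closure_subset by blast
  moreover have "f \<in> borel_measurable m" using D_bounded_continuous[OF f] continuous_measurable by blast
  ultimately show "bounded_support f" unfolding bounded_support_def by blast
qed

text \<open>
  The lifting need not preserve supports, but it fixes the continuous function
  \<open>K max 0 (min 1 (r + 1 - d(a, \<cdot>)))\<close>,
  which dominates \<open>\<bar>\<Gamma> f g\<bar>\<close> and has bounded support.
\<close>

lemma lft_\<Gamma>_bounded_support:
  assumes "f \<in> D" "g \<in> D"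
  obtains E K where "E \<in> bounded_sets m" "\<And>x. x \<notin> E \<Longrightarrow> lft (\<Gamma> f g) x = 0" "\<And>x. \<bar>lft (\<Gamma> f g) x\<bar> \<le> K"
    "bounded_support (lft (\<Gamma> f g))"
proof -
  have L: "\<Gamma> f g \<in> Linf m" by (rule \<Gamma>_Linf[OF assms])
  obtain K where "\<Gamma> f g \<in> borel_measurable m" and K: "\<forall>x. \<bar>\<Gamma> f g x\<bar> \<le> K" "0 \<le> K" by (rule LinfE[OF L])
  obtain E0 where E0: "E0 \<in> bounded_sets m" "\<And>x. x \<notin> E0 \<Longrightarrow> \<Gamma> f g x = 0"
    using \<Gamma>_bounded_support[OF assms] by blast
  obtain a r where ar: "E0 \<subseteq> cball a r" using E0(1) unfolding bounded_sets_def by (auto simp: bounded_subset_cball)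
  define \<phi> where "\<phi> x = K * max 0 (min 1 (r + 1 - dist a x))" for x
  have \<phi>c: "continuous_on UNIV \<phi>" unfolding \<phi>_def by (intro continuous_intros)
  have \<phi>b: "\<bar>\<phi> x\<bar> \<le> K" for x using K(2) by (auto simp: \<phi>_def abs_mult intro!: mult_left_le)
  then have \<phi>bd: "bounded (range \<phi>)" unfolding bounded_iff by (intro exI[of _ K]) auto
  note \<phi>L = Linf_continuous[OF \<phi>c \<phi>bd]
  have le: "\<bar>\<Gamma> f g x\<bar> \<le> \<phi> x" for x
  proof (cases "x \<in> E0")
    case True
    then have "\<phi> x = K" using ar by (auto simp: \<phi>_def)
    then show ?thesis using K by simp
  qed (use E0(2) K(2) in \<open>auto simp: \<phi>_def\<close>)
  have "lft (\<Gamma> f g) x \<le> lft \<phi> x" for x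
    by (intro lft_mono L \<phi>L AE_I2) (rule order_trans[OF abs_ge_self le])
  then have upper: "lft (\<Gamma> f g) x \<le> \<phi> x" for x
    unfolding lft_continuous[OF \<phi>c \<phi>bd] .
  have "lft (\<lambda>y. (- 1) * \<phi> y + 0 * \<phi> y) x \<le> lft (\<Gamma> f g) x" for x
  proof (intro lft_mono L \<phi>L Linf_lin AE_I2)
    fix y show "- 1 * \<phi> y + 0 * \<phi> y \<le> \<Gamma> f g y" using le[of y] by linarith
  qed
  then have lower: "(- 1) * \<phi> x + 0 * \<phi> x \<le> lft (\<Gamma> f g) x" for x
    unfolding lft_lin[OF \<phi>L \<phi>L] lft_continuous[OF \<phi>c \<phi>bd] .
  have ab: "\<bar>lft (\<Gamma> f g) x\<bar> \<le> \<phi> x" for x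
    using upper[of x] lower[of x] by linarith
  have E: "cball a (r + 1) \<in> bounded_sets m" by (rule cball_bounded_sets)
  have z: "lft (\<Gamma> f g) x = 0" if "x \<notin> cball a (r + 1)" for x
    using ab[of x] that by (simp add: \<phi>_def)
  have b: "\<bar>lft (\<Gamma> f g) x\<bar> \<le> K" for x using ab[of x] \<phi>b[of x] by linarith
  have "lft (\<Gamma> f g) \<in> borel_measurable m" using lft_Linf[OF L] by (simp add: Linf_def)
  then have "bounded_support (lft (\<Gamma> f g))" unfolding bounded_support_def using E z by blast
  with E z b show ?thesis by (rule that)
qed

lemma smooth_continuous:
  assumes \<psi>: "\<psi> \<in> Cb_smooth k" and f: "\<And>j. j < k \<Longrightarrow> f j \<in> D"
  shows "continuous_on UNIV (\<lambda>y. \<psi> (\<lambda>j. f j y))" "bounded (range (\<lambda>y. \<psi> (\<lambda>j. f j y)))"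
proof -
  note n = Cb_smooth_bounded_diff[OF \<psi>]
  have eq: "(\<lambda>y. \<psi> (\<lambda>j. f j y)) = (\<lambda>y. \<psi> (\<lambda>j. if j < k then f j y else 0))"
    by (intro ext bounded_diff_cong[OF n]) auto
  have c: "continuous_on UNIV \<psi>" using n by (simp add: bounded_diff_def)
  have "continuous_on UNIV (\<lambda>y. (if j < k then f j y else 0))" for j
    using D_bounded_continuous[OF f, of j] by (cases "j < k") auto
  then show "continuous_on UNIV (\<lambda>y. \<psi> (\<lambda>j. f j y))"
    unfolding eq by (intro continuous_on_compose2[OF c] continuous_on_coordinatewise_then_product) auto
  have "bounded (range \<psi>)" using n by (simp add: bounded_diff_def)
  then show "bounded (range (\<lambda>y. \<psi> (\<lambda>j. f j y)))" by (rule bounded_subset) auto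
qed

text \<open>
  The cylinder function \<open>u\<close> as a function of the position \<open>y\<close> of the \<open>i\<close>-th point.  Subtracting the
  value at the configuration without that point, rather than at some base point, yields an
  element of \<open>D\<close>, which consists of functions with bounded support.
\<close>

definition move :: "('a measure \<Rightarrow> real) \<Rightarrow> nat set \<Rightarrow> (nat \<Rightarrow> 'a) \<Rightarrow> nat \<Rightarrow> 'a \<Rightarrow> real" where
  "move u P x i y = u (point_config P (x(i := y))) - u (point_config (P - {i}) x)"

abbreviation "cyl \<equiv> cyl_rep m D"

lemma cylD:
  assumes "cyl k F f u"
  shows "F \<in> Cb_smooth k" "j < k \<Longrightarrow> f j \<in> D" "\<gamma> \<in> configs m \<Longrightarrow> u \<gamma> = F (\<lambda>i. star (f i) \<gamma>)"
  using assms by (auto simp: cyl_rep_def)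

lemma move_eq:
  assumes u: "cyl k F f u" and lf: "locally_finite_points P x" and i: "i \<in> P"
  defines "\<phi> \<equiv> \<lambda>z. F (\<lambda>j. star (f j) (point_config (P - {i}) x) + z j)"
  shows "move u P x i = (\<lambda>y. \<phi> (\<lambda>j. f j y) - \<phi> (\<lambda>j. 0))" "\<phi> \<in> Cb_smooth k" "move u P x i \<in> D"
    "a < k \<Longrightarrow> pd a \<phi> (\<lambda>j. f j (x i)) = pd a F (\<lambda>j. star (f j) (point_config P x))"
proof -
  note c = cylD[OF u]
  note n = Cb_smooth_bounded_diff[OF c(1)]
  have bs: "j < k \<Longrightarrow> bounded_support (f j)" for j using c(2) D_imp_bounded_support by blast
  have c1: "point_config P (x(i := y)) \<in> configs m" for y
    by (intro point_config_in_configs locally_finite_move lf)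
  have c2: "point_config (P - {i}) x \<in> configs m"
    by (intro point_config_in_configs locally_finite_remove lf)
  show eq: "move u P x i = (\<lambda>y. \<phi> (\<lambda>j. f j y) - \<phi> (\<lambda>j. 0))"
  proof
    fix y
    have "u (point_config P (x(i := y))) = \<phi> (\<lambda>j. f j y)"
      unfolding c(3)[OF c1] \<phi>_def by (intro bounded_diff_cong[OF n] star_move bs lf i)
    moreover have "u (point_config (P - {i}) x) = \<phi> (\<lambda>j. 0)"
      unfolding c(3)[OF c2] \<phi>_def by simp
    ultimately show "move u P x i y = \<phi> (\<lambda>j. f j y) - \<phi> (\<lambda>j. 0)" by (simp add: move_def)
  qed
  show \<phi>: "\<phi> \<in> Cb_smooth k" unfolding \<phi>_def by (rule Cb_smooth_translate(1)[OF c(1)])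
  show "move u P x i \<in> D" unfolding eq by (rule D_comp[OF \<phi> c(2)])
  assume a: "a < k"
  have "pd a \<phi> (\<lambda>j. f j (x i)) = pd a F (\<lambda>j. star (f j) (point_config (P - {i}) x) + f j (x i))"
    unfolding \<phi>_def Cb_smooth_translate(2)[OF c(1) a] ..
  also have "\<dots> = pd a F (\<lambda>j. star (f j) (point_config P x))"
    by (rule bounded_diff_cong[OF Cb_smooth_bounded_diff[OF Cb_smooth_pd[OF c(1) a]]]) (rule star_remove[OF bs lf i, symmetric])
  finally show "pd a \<phi> (\<lambda>j. f j (x i)) = pd a F (\<lambda>j. star (f j) (point_config P x))" .
qed

text \<open>
  The diffusion property of \<open>\<Gamma>\<close> holds almost everywhere.  The lifting turns it into an identity at the
  point \<open>x i\<close> itself, because it is multiplicative and fixes the continuous coefficients.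
\<close>

lemma lft_\<Gamma>_move:
  assumes u: "cyl k F f u" and v: "cyl l G g v" and lf: "locally_finite_points P x" and i: "i \<in> P"
  shows "lft (\<Gamma> (move u P x i) (move v P x i)) (x i) =
    (\<Sum>a<k. \<Sum>b<l. pd a F (\<lambda>j. star (f j) (point_config P x)) * pd b G (\<lambda>j. star (g j) (point_config P x)) *
       lft (\<Gamma> (f a) (g b)) (x i))"
proof -
  define \<phi> where "\<phi> = (\<lambda>z. F (\<lambda>j. star (f j) (point_config (P - {i}) x) + z j))"
  define \<psi> where "\<psi> = (\<lambda>z. G (\<lambda>j. star (g j) (point_config (P - {i}) x) + z j))"
  note mu = move_eq[OF u lf i, folded \<phi>_def] and mv = move_eq[OF v lf i, folded \<psi>_def]
  have moves: "move u P x i = (\<lambda>y. \<phi> (\<lambda>j. f j y) - \<phi> (\<lambda>j. 0))"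
    "move v P x i = (\<lambda>y. \<psi> (\<lambda>j. g j y) - \<psi> (\<lambda>j. 0))"
    unfolding \<phi>_def \<psi>_def by (rule move_eq(1)[OF u lf i], rule move_eq(1)[OF v lf i])
  note cu = cylD[OF u] and cv = cylD[OF v]
  define t where "t a b y = pd a \<phi> (\<lambda>j. f j y) * pd b \<psi> (\<lambda>j. g j y) * \<Gamma> (f a) (g b) y" for a b y
  have cont: "(\<lambda>y. pd a \<phi> (\<lambda>j. f j y)) \<in> Linf m" "lft (\<lambda>y. pd a \<phi> (\<lambda>j. f j y)) = (\<lambda>y. pd a \<phi> (\<lambda>j. f j y))"
    if "a < k" for a
    using Linf_continuous[OF smooth_continuous[OF Cb_smooth_pd[OF mu(2) that] cu(2)]]
      lft_continuous[OF smooth_continuous[OF Cb_smooth_pd[OF mu(2) that] cu(2)]] by auto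
  have cont': "(\<lambda>y. pd b \<psi> (\<lambda>j. g j y)) \<in> Linf m" "lft (\<lambda>y. pd b \<psi> (\<lambda>j. g j y)) = (\<lambda>y. pd b \<psi> (\<lambda>j. g j y))"
    if "b < l" for b
    using Linf_continuous[OF smooth_continuous[OF Cb_smooth_pd[OF mv(2) that] cv(2)]]
      lft_continuous[OF smooth_continuous[OF Cb_smooth_pd[OF mv(2) that] cv(2)]] by auto
  have tL: "t a b \<in> Linf m" if "a < k" "b < l" for a b
    unfolding t_def by (intro Linf_mult cont cont' that \<Gamma>_Linf cu(2) cv(2))
  have sL: "(\<lambda>y. \<Sum>b<l. t a b y) \<in> Linf m" if "a < k" for a
    by (rule Linf_sum) (use tL[OF that] in auto)
  have tlft: "lft (t a b) (x i) = pd a F (\<lambda>j. star (f j) (point_config P x)) *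
      pd b G (\<lambda>j. star (g j) (point_config P x)) * lft (\<Gamma> (f a) (g b)) (x i)" if ab: "a < k" "b < l" for a b
  proof -
    have "lft (t a b) (x i) = lft (\<lambda>y. pd a \<phi> (\<lambda>j. f j y)) (x i) * lft (\<lambda>y. pd b \<psi> (\<lambda>j. g j y)) (x i) *
        lft (\<Gamma> (f a) (g b)) (x i)"
      unfolding t_def using cont(1)[OF ab(1)] cont'(1)[OF ab(2)] \<Gamma>_Linf[OF cu(2)[OF ab(1)] cv(2)[OF ab(2)]]
      by (simp only: lft_mult Linf_mult)
    then show ?thesis unfolding cont(2)[OF ab(1)] cont'(2)[OF ab(2)] mu(4)[OF ab(1)] mv(4)[OF ab(2)] .
  qed
  have dL: "(\<lambda>y. \<Sum>a<k. \<Sum>b<l. t a b y) \<in> Linf m"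
    by (rule Linf_sum) (use sL in auto)
  have AE_eq: "AE y in m. \<Gamma> (move u P x i) (move v P x i) y = (\<Sum>a<k. \<Sum>b<l. t a b y)"
    unfolding moves t_def by (rule \<Gamma>_diffusion[OF mu(2) mv(2) cu(2) cv(2)])
  have "lft (\<Gamma> (move u P x i) (move v P x i)) = lft (\<lambda>y. \<Sum>a<k. \<Sum>b<l. t a b y)"
    by (rule lft_cong[OF \<Gamma>_Linf[OF mu(3) mv(3)] dL AE_eq])
  then have "lft (\<Gamma> (move u P x i) (move v P x i)) (x i) = lft (\<lambda>y. \<Sum>a<k. \<Sum>b<l. t a b y) (x i)" by simp
  also have "\<dots> = (\<Sum>a<k. lft (\<lambda>y. \<Sum>b<l. t a b y) (x i))"
    by (rule lft_sum) (use sL in auto)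
  also have "\<dots> = (\<Sum>a<k. \<Sum>b<l. lft (t a b) (x i))"
    by (intro sum.cong refl lft_sum) (use tL in auto)
  also have "\<dots> = (\<Sum>a<k. \<Sum>b<l. pd a F (\<lambda>j. star (f j) (point_config P x)) *
      pd b G (\<lambda>j. star (g j) (point_config P x)) * lft (\<Gamma> (f a) (g b)) (x i))"
    by (intro sum.cong refl tlft) auto
  finally show ?thesis .
qed

abbreviation square_field :: "('a measure \<Rightarrow> real) \<Rightarrow> ('a measure \<Rightarrow> real) \<Rightarrow> 'a measure \<Rightarrow> real" where
  "square_field \<equiv> config_square_field m D \<Gamma> lft"

text \<open>
  The value of the square field computed from given representations.
\<close>

abbreviation (input) square_field_sum where
  "square_field_sum k F f l G g \<gamma> \<equiv> (\<Sum>a<k. \<Sum>b<l. pd a F (\<lambda>j. star (f j) \<gamma>) *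
     pd b G (\<lambda>j. star (g j) \<gamma>) * star (lft (\<Gamma> (f a) (g b))) \<gamma>)"

lemma square_field_intrinsic:
  assumes u: "cyl k F f u" and v: "cyl l G g v" and lf: "locally_finite_points P x"
  shows "square_field_sum k F f l G g (point_config P x) =
     (\<integral>i. lft (\<Gamma> (move u P x i) (move v P x i)) (x i) \<partial>count_space P)"
proof -
  let ?c = "\<lambda>a b. pd a F (\<lambda>j. star (f j) (point_config P x)) * pd b G (\<lambda>j. star (g j) (point_config P x))"
  have bs: "bounded_support (lft (\<Gamma> (f a) (g b)))" if "a < k" "b < l" for a b
    using lft_\<Gamma>_bounded_support[OF cylD(2)[OF u that(1)] cylD(2)[OF v that(2)]] by blast
  have int: "integrable (count_space P) (\<lambda>i. lft (\<Gamma> (f a) (g b)) (x i))" if "a < k" "b < l" for a b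
    by (rule star_finite[OF bs[OF that] lf])
  have "(\<integral>i. lft (\<Gamma> (move u P x i) (move v P x i)) (x i) \<partial>count_space P) =
      (\<integral>i. (\<Sum>a<k. \<Sum>b<l. ?c a b * lft (\<Gamma> (f a) (g b)) (x i)) \<partial>count_space P)"
    by (intro Bochner_Integration.integral_cong refl lft_\<Gamma>_move[OF u v lf]) simp
  also have "\<dots> = (\<Sum>a<k. \<integral>i. (\<Sum>b<l. ?c a b * lft (\<Gamma> (f a) (g b)) (x i)) \<partial>count_space P)"
    by (intro Bochner_Integration.integral_sum Bochner_Integration.integrable_sum integrable_mult_right int) auto
  also have "\<dots> = (\<Sum>a<k. \<Sum>b<l. \<integral>i. ?c a b * lft (\<Gamma> (f a) (g b)) (x i) \<partial>count_space P)"
    by (intro sum.cong refl Bochner_Integration.integral_sum integrable_mult_right int) auto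
  also have "\<dots> = (\<Sum>a<k. \<Sum>b<l. ?c a b * star (lft (\<Gamma> (f a) (g b))) (point_config P x))"
    by (intro sum.cong refl) (simp add: star_point_config[OF bs])
  finally show ?thesis by simp
qed

text \<open>
  The right-hand side does not mention the representations, so the definite description in
  \<open>config_square_field\<close> is well defined.
\<close>

lemma square_field_eq_moves:
  assumes u: "cyl k F f u" and v: "cyl l G g v" and lf: "locally_finite_points P x"
  shows "square_field u v (point_config P x) =
    (\<integral>i. lft (\<Gamma> (move u P x i) (move v P x i)) (x i) \<partial>count_space P)"
  unfolding config_square_field_def
proof (rule the_equality)
  show "\<exists>k F f l G g. cyl k F f u \<and> cyl l G g v \<and>
      (\<integral>i. lft (\<Gamma> (move u P x i) (move v P x i)) (x i) \<partial>count_space P) =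
      square_field_sum k F f l G g (point_config P x)"
    by (rule exI[of _ k], rule exI[of _ F], rule exI[of _ f], rule exI[of _ l], rule exI[of _ G], rule exI[of _ g])
      (use u v square_field_intrinsic[OF u v lf, symmetric] in simp)
  fix r
  assume "\<exists>k F f l G g. cyl k F f u \<and> cyl l G g v \<and> r =
      square_field_sum k F f l G g (point_config P x)"
  then obtain k F f l G g where u': "cyl k F f u" and v': "cyl l G g v" and r: "r =
      square_field_sum k F f l G g (point_config P x)" by (elim exE conjE)
  show "r = (\<integral>i. lft (\<Gamma> (move u P x i) (move v P x i)) (x i) \<partial>count_space P)"
    unfolding r by (rule square_field_intrinsic[OF u' v' lf])
qed

lemma square_field_eq:
  assumes u: "cyl k F f u" and v: "cyl l G g v" and \<gamma>: "\<gamma> \<in> configs m"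
  shows "square_field u v \<gamma> = square_field_sum k F f l G g \<gamma>"
proof -
  obtain P x where P: "\<gamma> = point_config P x" "locally_finite_points P x" using config_as_points[OF \<gamma>] .
  show ?thesis
    unfolding P(1) square_field_eq_moves[OF u v P(2)] by (rule square_field_intrinsic[OF u v P(2), symmetric])
qed

abbreviation Cyl :: "('a measure \<Rightarrow> real) set" where "Cyl \<equiv> cylinder_functions m D"

lemma CylE:
  assumes "u \<in> Cyl"
  obtains k F f where "cyl k F f u"
  using assms unfolding cylinder_functions_def by blast

lemma CylI: "cyl k F f u \<Longrightarrow> u \<in> Cyl"
  unfolding cylinder_functions_def by blast

lemma cyl_common:
  assumes u: "cyl k F f u" and v: "cyl l G g v"
  obtains F' G' h where "cyl (k + l) F' h u" "cyl (k + l) G' h v"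
proof -
  define h where "h i = (if i < k then f i else g (i - k))" for i
  have hD: "h i \<in> D" if "i < k + l" for i using cylD(2)[OF u, of i] cylD(2)[OF v, of "i - k"] that by (auto simp: h_def)
  have "cyl (k + l) (\<lambda>x. F (\<lambda>j. x (id j))) h u"
    unfolding cyl_rep_def
  proof (intro conjI allI impI ballI hD)
    show "(\<lambda>x. F (\<lambda>j. x (id j))) \<in> Cb_smooth (k + l)" by (rule Cb_smooth_reindex[OF cylD(1)[OF u]]) auto
    fix \<gamma> assume \<gamma>: "\<gamma> \<in> configs m"
    show "u \<gamma> = F (\<lambda>j. star (h (id j)) \<gamma>)"
      unfolding cylD(3)[OF u \<gamma>] by (rule bounded_diff_cong[OF Cb_smooth_bounded_diff[OF cylD(1)[OF u]]]) (simp add: h_def)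
  qed
  moreover have "cyl (k + l) (\<lambda>x. G (\<lambda>j. x (k + j))) h v"
    unfolding cyl_rep_def
  proof (intro conjI allI impI ballI hD)
    show "(\<lambda>x. G (\<lambda>j. x (k + j))) \<in> Cb_smooth (k + l)" by (rule Cb_smooth_reindex[OF cylD(1)[OF v]]) auto
    fix \<gamma> assume \<gamma>: "\<gamma> \<in> configs m"
    show "v \<gamma> = G (\<lambda>j. star (h (k + j)) \<gamma>)"
      unfolding cylD(3)[OF v \<gamma>] by (rule bounded_diff_cong[OF Cb_smooth_bounded_diff[OF cylD(1)[OF v]]]) (simp add: h_def)
  qed
  ultimately show ?thesis by (rule that)
qed

lemma cyl_operations:
  assumes u: "cyl k F f u" and v: "cyl k G f v"
  shows "cyl k (\<lambda>x. a * F x + b * G x) f (\<lambda>\<gamma>. a * u \<gamma> + b * v \<gamma>)"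
    "cyl k (\<lambda>x. F x * G x) f (\<lambda>\<gamma>. u \<gamma> * v \<gamma>)"
    "cyl k (\<lambda>x. sin (F x)) f (\<lambda>\<gamma>. sin (u \<gamma>))"
  unfolding cyl_rep_def using cylD[OF u] cylD[OF v]
  by (simp_all add: Cb_smooth_lin Cb_smooth_mult Cb_smooth_sin)

lemma Cyl_zero: "(\<lambda>\<gamma>. 0) \<in> Cyl"
  by (rule CylI[of 0 "\<lambda>x. 0" "\<lambda>i x. 0"]) (simp add: cyl_rep_def Cb_smooth_const)

lemma Cyl_operations:
  assumes "u \<in> Cyl" "v \<in> Cyl"
  shows "(\<lambda>\<gamma>. a * u \<gamma> + b * v \<gamma>) \<in> Cyl" "(\<lambda>\<gamma>. u \<gamma> * v \<gamma>) \<in> Cyl" "(\<lambda>\<gamma>. sin (u \<gamma>)) \<in> Cyl"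
proof -
  obtain k F f where "cyl k F f u" by (rule CylE[OF assms(1)])
  moreover obtain l G g where "cyl l G g v" by (rule CylE[OF assms(2)])
  ultimately obtain n F' G' h where *: "cyl n F' h u" "cyl n G' h v" using cyl_common by metis
  show "(\<lambda>\<gamma>. a * u \<gamma> + b * v \<gamma>) \<in> Cyl" "(\<lambda>\<gamma>. u \<gamma> * v \<gamma>) \<in> Cyl" "(\<lambda>\<gamma>. sin (u \<gamma>)) \<in> Cyl"
    by (rule CylI, rule cyl_operations[OF *])+
qed

lemma Cyl_bounded: "u \<in> Cyl \<Longrightarrow> \<exists>K. \<forall>\<gamma>\<in>configs m. \<bar>u \<gamma>\<bar> \<le> K"
proof -
  assume "u \<in> Cyl"
  then obtain k F f where c: "cyl k F f u" by (rule CylE)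
  obtain K where "\<And>x. \<bar>F x\<bar> \<le> K" using bounded_diff_bounded[OF Cb_smooth_bounded_diff[OF cylD(1)[OF c]]] by blast
  then show ?thesis using cylD(3)[OF c] by (intro exI[of _ K]) simp
qed

lemma smooth_star_measurable:
  assumes \<psi>: "\<psi> \<in> Cb_smooth k" and f: "\<And>j. j < k \<Longrightarrow> f j \<in> D"
  shows "(\<lambda>\<gamma>. \<psi> (\<lambda>j. star (f j) \<gamma>)) \<in> borel_measurable (config_algebra m)"
proof -
  note n = Cb_smooth_bounded_diff[OF \<psi>]
  have eq: "(\<lambda>\<gamma>. \<psi> (\<lambda>j. star (f j) \<gamma>)) = (\<lambda>\<gamma>. \<psi> (\<lambda>j. if j < k then star (f j) \<gamma> else 0))"
    by (intro ext bounded_diff_cong[OF n]) auto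
  have c: "\<psi> \<in> borel_measurable borel" using n by (simp add: bounded_diff_def borel_measurable_continuous_onI)
  have "(\<lambda>\<gamma>. if j < k then star (f j) \<gamma> else 0) \<in> borel_measurable (config_algebra m)" for j
    using star_measurable[OF D_imp_bounded_support[OF f], of j] by (cases "j < k") auto
  then have "(\<lambda>\<gamma> j. if j < k then star (f j) \<gamma> else 0) \<in> borel_measurable (config_algebra m)"
    by (rule measurable_coordinatewise_then_product)
  from measurable_compose[OF this c] show ?thesis unfolding eq .
qed

lemma Cyl_measurable:
  assumes "u \<in> Cyl"
  shows "u \<in> borel_measurable (config_algebra m)"
proof -
  obtain k F f where c: "cyl k F f u" by (rule CylE[OF assms])
  have "(\<lambda>\<gamma>. F (\<lambda>j. star (f j) \<gamma>)) \<in> borel_measurable (config_algebra m)"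
    by (rule smooth_star_measurable[OF cylD(1,2)[OF c]])
  then show ?thesis
    using cylD(3)[OF c] by (subst measurable_cong[where g = "\<lambda>\<gamma>. F (\<lambda>j. star (f j) \<gamma>)"]) (auto simp: space_config_algebra)
qed

lemma square_field_rules:
  assumes "u \<in> Cyl" "v \<in> Cyl" "w \<in> Cyl" and \<gamma>: "\<gamma> \<in> configs m"
  shows "square_field (\<lambda>\<eta>. a * u \<eta> + b * v \<eta>) w \<gamma> = a * square_field u w \<gamma> + b * square_field v w \<gamma>"
    "square_field (\<lambda>\<eta>. u \<eta> * v \<eta>) w \<gamma> = u \<gamma> * square_field v w \<gamma> + v \<gamma> * square_field u w \<gamma>"
    "square_field (\<lambda>\<eta>. sin (u \<eta>)) w \<gamma> = cos (u \<gamma>) * square_field u w \<gamma>"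
proof -
  obtain k0 F0 f0 where "cyl k0 F0 f0 u" by (rule CylE[OF assms(1)])
  moreover obtain l0 G0 g0 where "cyl l0 G0 g0 v" by (rule CylE[OF assms(2)])
  ultimately obtain k F G f where u: "cyl k F f u" and v: "cyl k G f v" using cyl_common by metis
  obtain l W g where w: "cyl l W g w" by (rule CylE[OF assms(3)])
  note F = cylD(1)[OF u] and G = cylD(1)[OF v]
  note nF = Cb_smooth_bounded_diff[OF F] and nG = Cb_smooth_bounded_diff[OF G]
  note e = square_field_eq[OF u w \<gamma>] square_field_eq[OF v w \<gamma>]
  show "square_field (\<lambda>\<eta>. a * u \<eta> + b * v \<eta>) w \<gamma> = a * square_field u w \<gamma> + b * square_field v w \<gamma>"
    unfolding e square_field_eq[OF cyl_operations(1)[OF u v] w \<gamma>] sum_distrib_left sum.distrib[symmetric]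
    by (intro sum.cong refl) (simp add: pd_lin[OF F G] algebra_simps)
  show "square_field (\<lambda>\<eta>. u \<eta> * v \<eta>) w \<gamma> = u \<gamma> * square_field v w \<gamma> + v \<gamma> * square_field u w \<gamma>"
    unfolding e square_field_eq[OF cyl_operations(2)[OF u v] w \<gamma>] sum_distrib_left sum.distrib[symmetric]
      cylD(3)[OF u \<gamma>] cylD(3)[OF v \<gamma>]
    by (intro sum.cong refl) (simp add: bounded_diff_mult(2)[OF nF nG] algebra_simps)
  show "square_field (\<lambda>\<eta>. sin (u \<eta>)) w \<gamma> = cos (u \<gamma>) * square_field u w \<gamma>"
    unfolding e square_field_eq[OF cyl_operations(3)[OF u v] w \<gamma>] sum_distrib_left cylD(3)[OF u \<gamma>]
    by (intro sum.cong refl) (simp add: bounded_diff_sin(2)[OF nF] algebra_simps)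
qed

lemma square_field_sym:
  assumes "u \<in> Cyl" "v \<in> Cyl" and \<gamma>: "\<gamma> \<in> configs m"
  shows "square_field u v \<gamma> = square_field v u \<gamma>"
proof -
  obtain k F f where u: "cyl k F f u" by (rule CylE[OF assms(1)])
  obtain l G g where v: "cyl l G g v" by (rule CylE[OF assms(2)])
  have s: "lft (\<Gamma> (f a) (g b)) = lft (\<Gamma> (g b) (f a))" if "a < k" "b < l" for a b
    by (intro lft_cong \<Gamma>_Linf \<Gamma>_sym cylD(2)[OF u] cylD(2)[OF v] that)
  show ?thesis
    unfolding square_field_eq[OF u v \<gamma>] square_field_eq[OF v u \<gamma>]
    by (subst sum.swap) (intro sum.cong refl, simp add: s)
qed

lemma square_field_nonneg:
  assumes "u \<in> Cyl" and \<gamma>: "\<gamma> \<in> configs m"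
  shows "0 \<le> square_field u u \<gamma>"
proof -
  obtain k F f where u: "cyl k F f u" by (rule CylE[OF assms(1)])
  obtain P x where P: "\<gamma> = point_config P x" "locally_finite_points P x" using config_as_points[OF \<gamma>] .
  show ?thesis
    unfolding P(1) square_field_eq_moves[OF u u P(2)]
  proof (intro integral_nonneg_AE AE_I2)
    fix i assume "i \<in> space (count_space P)"
    then have mD: "move u P x i \<in> D" by (intro move_eq(3)[OF u P(2)]) simp
    have "lft (\<lambda>y. 0) (x i) \<le> lft (\<Gamma> (move u P x i) (move u P x i)) (x i)"
      by (intro lft_mono Linf_const \<Gamma>_Linf \<Gamma>_nonneg mD)
    then show "0 \<le> lft (\<Gamma> (move u P x i) (move u P x i)) (x i)" by (simp add: lft_const)
  qed
qed

lemma square_field_integrable: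
  assumes "u \<in> Cyl" "v \<in> Cyl"
    and \<mu>: "space \<mu> = configs m" "sets \<mu> = sets (config_algebra m)"
    and fin: "\<And>E. E \<in> bounded_sets m \<Longrightarrow> (\<integral>\<^sup>+\<gamma>. emeasure \<gamma> E \<partial>\<mu>) < \<infinity>"
  shows "integrable \<mu> (square_field u v)"
proof -
  obtain k F f where u: "cyl k F f u" by (rule CylE[OF assms(1)])
  obtain l G g where v: "cyl l G g v" by (rule CylE[OF assms(2)])
  have meas: "h \<in> borel_measurable \<mu>" if "h \<in> borel_measurable (config_algebra m)"
    for h :: "'a measure \<Rightarrow> real"
    using that by (subst measurable_cong_sets[OF \<mu>(2) refl])
  have emeas: "(\<lambda>\<gamma>. emeasure \<gamma> E) \<in> borel_measurable \<mu>" if "E \<in> bounded_sets m" for E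
    using emeasure_config_measurable[OF that] by (subst measurable_cong_sets[OF \<mu>(2) refl])
  have star_int: "integrable \<mu> (star (lft (\<Gamma> (f a) (g b))))" if ab: "a < k" "b < l" for a b
  proof -
    obtain E K where E: "E \<in> bounded_sets m" "\<And>x. x \<notin> E \<Longrightarrow> lft (\<Gamma> (f a) (g b)) x = 0"
      "\<And>x. \<bar>lft (\<Gamma> (f a) (g b)) x\<bar> \<le> K" "bounded_support (lft (\<Gamma> (f a) (g b)))"
      using lft_\<Gamma>_bounded_support[OF cylD(2)[OF u ab(1)] cylD(2)[OF v ab(2)]] by blast
    have "(\<integral>\<^sup>+\<gamma>. ennreal (norm (star (lft (\<Gamma> (f a) (g b))) \<gamma>)) \<partial>\<mu>) \<le> (\<integral>\<^sup>+\<gamma>. ennreal K * emeasure \<gamma> E \<partial>\<mu>)"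
      using star_bound[OF E(4,1,2,3)] by (intro nn_integral_mono) (simp add: \<mu>(1))
    also have "\<dots> = ennreal K * (\<integral>\<^sup>+\<gamma>. emeasure \<gamma> E \<partial>\<mu>)" by (rule nn_integral_cmult[OF emeas[OF E(1)]])
    also have "\<dots> < \<infinity>" using fin[OF E(1)] by (simp add: ennreal_mult_less_top)
    finally show ?thesis by (intro integrableI_bounded meas star_measurable E(4))
  qed
  have term_int: "integrable \<mu> (\<lambda>\<gamma>. pd a F (\<lambda>j. star (f j) \<gamma>) * pd b G (\<lambda>j. star (g j) \<gamma>) *
      star (lft (\<Gamma> (f a) (g b))) \<gamma>)" if ab: "a < k" "b < l" for a b
  proof -
    obtain K where K: "\<And>x. \<bar>pd a F x\<bar> \<le> K"
      using bounded_diff_bounded[OF Cb_smooth_bounded_diff[OF Cb_smooth_pd[OF cylD(1)[OF u] ab(1)]]] by blast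
    obtain K' where K': "\<And>x. \<bar>pd b G x\<bar> \<le> K'"
      using bounded_diff_bounded[OF Cb_smooth_bounded_diff[OF Cb_smooth_pd[OF cylD(1)[OF v] ab(2)]]] by blast
    have m: "(\<lambda>\<gamma>. pd a F (\<lambda>j. star (f j) \<gamma>) * pd b G (\<lambda>j. star (g j) \<gamma>)) \<in> borel_measurable \<mu>"
      by (intro borel_measurable_times meas smooth_star_measurable[OF Cb_smooth_pd[OF cylD(1)[OF u] ab(1)] cylD(2)[OF u]]
        smooth_star_measurable[OF Cb_smooth_pd[OF cylD(1)[OF v] ab(2)] cylD(2)[OF v]])
    have b: "norm (pd a F (\<lambda>j. star (f j) \<gamma>) * pd b G (\<lambda>j. star (g j) \<gamma>) * star (lft (\<Gamma> (f a) (g b))) \<gamma>) \<le>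
        norm (K * K' * star (lft (\<Gamma> (f a) (g b))) \<gamma>)" for \<gamma>
    proof -
      let ?A = "pd a F (\<lambda>j. star (f j) \<gamma>)" and ?B = "pd b G (\<lambda>j. star (g j) \<gamma>)"
      have "\<bar>?A\<bar> * \<bar>?B\<bar> \<le> K * K'"
        using order_trans[OF abs_ge_zero K] by (intro mult_mono K K') auto
      also have "\<dots> \<le> \<bar>K * K'\<bar>" by simp
      finally have "\<bar>?A * ?B\<bar> \<le> \<bar>K * K'\<bar>" by (simp only: abs_mult)
      then show ?thesis unfolding real_norm_def abs_mult[of "?A * ?B"] abs_mult[of "K * K'"]
        by (rule mult_right_mono) simp
    qed
    show ?thesis
    proof (rule Bochner_Integration.integrable_bound)
      show "integrable \<mu> (\<lambda>\<gamma>. K * K' * star (lft (\<Gamma> (f a) (g b))) \<gamma>)"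
        by (intro integrable_mult_right star_int ab)
      show "(\<lambda>\<gamma>. pd a F (\<lambda>j. star (f j) \<gamma>) * pd b G (\<lambda>j. star (g j) \<gamma>) * star (lft (\<Gamma> (f a) (g b))) \<gamma>) \<in> borel_measurable \<mu>"
        by (intro borel_measurable_times[OF m] borel_measurable_integrable star_int ab)
    qed (intro AE_I2 b)
  qed
  have "integrable \<mu> (\<lambda>\<gamma>. \<Sum>a<k. \<Sum>b<l. pd a F (\<lambda>j. star (f j) \<gamma>) * pd b G (\<lambda>j. star (g j) \<gamma>) *
      star (lft (\<Gamma> (f a) (g b))) \<gamma>)"
    by (intro Bochner_Integration.integrable_sum term_int) auto
  then show ?thesis
    by (subst Bochner_Integration.integrable_cong[OF refl square_field_eq[OF u v]]) (auto simp: \<mu>(1))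
qed

end

section \<open>The set of configurations at finite distance from a given set\<close>

text \<open>
  The configurations at finite distance from \<open>\<Xi>\<close>.
\<close>

definition finite_distance_set :: "'a::metric_space measure \<Rightarrow> 'a measure set \<Rightarrow> 'a measure set" where
  "finite_distance_set m \<Xi> = {\<gamma> \<in> configs m. dU_point_set \<gamma> \<Xi> < \<infinity>}"

lemma dU_point_set_finite_iff: "dU_point_set \<gamma> \<Xi> < \<infinity> \<longleftrightarrow> (\<exists>\<eta>\<in>\<Xi>. dU \<gamma> \<eta> < \<infinity>)"
  by (simp add: dU_point_set_def INF_less_iff)

context borel_extension
begin

lemma finite_distance_set_closed:
  assumes \<Xi>: "\<Xi> \<subseteq> configs m" and \<eta>: "\<eta> \<in> finite_distance_set m \<Xi>"
    and \<gamma>: "\<gamma> \<in> configs m" and fin: "dU \<gamma> \<eta> < \<infinity>"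
  shows "\<gamma> \<in> finite_distance_set m \<Xi>"
proof -
  obtain \<xi> where \<xi>: "\<xi> \<in> \<Xi>" "dU \<eta> \<xi> < \<infinity>" "\<eta> \<in> configs m"
    using \<eta> unfolding finite_distance_set_def dU_point_set_finite_iff mem_Collect_eq by blast
  have "\<xi> \<in> configs m" using \<xi>(1) \<Xi> by blast
  then have "dU \<gamma> \<xi> < \<infinity>" by (rule dU_finite_trans[OF \<gamma> \<xi>(3) _ fin \<xi>(2)])
  then show ?thesis using \<xi>(1) \<gamma> unfolding finite_distance_set_def dU_point_set_finite_iff by blast
qed

lemma indicator_Lipschitz:
  assumes \<Xi>: "\<Xi> \<subseteq> configs m" and L: "0 < L" and \<gamma>: "\<gamma> \<in> configs m" and \<eta>: "\<eta> \<in> configs m"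
  shows "ennreal \<bar>indicator (finite_distance_set m \<Xi>) \<gamma> - indicator (finite_distance_set m \<Xi>) \<eta>\<bar> \<le>
    ennreal L * dU \<gamma> \<eta>"
proof (cases "dU \<gamma> \<eta> < \<infinity>")
  case True
  have "\<gamma> \<in> finite_distance_set m \<Xi> \<longleftrightarrow> \<eta> \<in> finite_distance_set m \<Xi>"
    using finite_distance_set_closed[OF \<Xi> _ \<gamma> True]
      finite_distance_set_closed[OF \<Xi> _ \<eta> dU_finite_sym[OF \<gamma> \<eta> True]] by blast
  then have "\<bar>indicator (finite_distance_set m \<Xi>) \<gamma> - indicator (finite_distance_set m \<Xi>) \<eta>\<bar> = (0::real)"
    by (simp add: indicator_def)
  then show ?thesis by simp
next
  case False
  then have "dU \<gamma> \<eta> = \<top>" by (simp add: not_less top_unique)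
  then have "ennreal L * dU \<gamma> \<eta> = \<top>" using L by (simp add: ennreal_mult_top)
  then show ?thesis by simp
qed

end

context lifted_diffusion_space
begin

lemma finite_distance:
  fixes T :: "real \<Rightarrow> ('a measure \<Rightarrow> real) \<Rightarrow> ('a measure \<Rightarrow> real)"
  assumes prob: "prob_space \<mu>"
    and space_\<mu>: "space \<mu> = configs m"
    and sets_\<mu>: "sets \<mu> = sets (config_algebra m)"
    and clos: "closability_assumption m D \<Gamma> lft \<mu>"
    and rad: "rademacher m D \<Gamma> lft \<mu>"
    and semi: "semigroup_of_form \<mu> (config_dom m D \<Gamma> lft \<mu>) (config_closed_form m D \<Gamma> lft \<mu>) T"
    and irr: "irreducible_semigroup \<mu> T"
    and \<Xi>: "\<Xi> \<in> sets (config_algebra m)" "0 < emeasure \<mu> \<Xi>"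
    and \<Lambda>: "\<Lambda> \<in> sets (config_algebra m)" "0 < emeasure \<mu> \<Lambda>"
    and meas: "(\<lambda>\<gamma>. dU_point_set \<gamma> \<Xi>) \<in> borel_measurable (config_algebra m)"
  shows "dU_set_set \<Lambda> \<Xi> < \<infinity>"
proof (rule ccontr)
  assume inf: "\<not> dU_set_set \<Lambda> \<Xi> < \<infinity>"
  have form_eq: "config_form m D \<Gamma> lft \<mu> = (\<lambda>u v. \<integral>\<gamma>. square_field u v \<gamma> \<partial>\<mu>)"
    by (intro ext) (simp add: config_form_def)
  interpret prob_space \<mu> by (rule prob)
  interpret diffusion_form \<mu> Cyl square_field
  proof
    show "u \<in> borel_measurable \<mu>" if "u \<in> Cyl" for u
      using Cyl_measurable[OF that] by (subst measurable_cong_sets[OF sets_\<mu> refl])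
    show "integrable \<mu> (square_field u v)" if "u \<in> Cyl" "v \<in> Cyl" for u v
      by (rule square_field_integrable[OF that space_\<mu> sets_\<mu>]) (use clos in \<open>simp add: closability_assumption_def\<close>)
    show "closable \<mu> Cyl (\<lambda>u v. \<integral>\<gamma>. square_field u v \<gamma> \<partial>\<mu>)"
      using clos by (simp add: closability_assumption_def form_eq)
  qed (simp_all add: space_\<mu> Cyl_bounded Cyl_zero Cyl_operations square_field_rules square_field_sym square_field_nonneg)
  have dom_eq: "config_dom m D \<Gamma> lft \<mu> = Dom" and cform_eq: "config_closed_form m D \<Gamma> lft \<mu> = Form"
    unfolding config_dom_def config_closed_form_def form_eq by (rule refl)+
  define A where "A = finite_distance_set m \<Xi>"
  have \<Xi>c: "\<Xi> \<subseteq> configs m" and \<Lambda>c: "\<Lambda> \<subseteq> configs m"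
    using sets.sets_into_space[OF \<Xi>(1)] sets.sets_into_space[OF \<Lambda>(1)] by (simp_all add: space_config_algebra)
  have "{\<gamma> \<in> space (config_algebra m). dU_point_set \<gamma> \<Xi> < \<infinity>} \<in> sets (config_algebra m)"
    using meas by measurable
  then have A: "A \<in> sets \<mu>" unfolding A_def finite_distance_set_def sets_\<mu> space_config_algebra .
  have e_meas: "(indicator A :: _ \<Rightarrow> real) \<in> borel_measurable (completion \<mu>)"
    using A by (intro measurable_completion) simp
  have e_bdd: "bounded ((indicator A :: _ \<Rightarrow> real) ` configs m)"
    unfolding bounded_iff by (intro exI[of _ 1]) (auto simp: indicator_def)
  have rad_A: "\<exists>u h. u \<in> Dom \<and> (AE \<gamma> in \<mu>. indicator A \<gamma> = u \<gamma>) \<and>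
      square_field_version \<mu> Cyl En square_field u u h \<and> (AE \<gamma> in \<mu>. h \<gamma> \<le> L\<^sup>2)" if L: "0 < L" for L
  proof -
    have "\<forall>\<gamma>\<in>configs m. \<forall>\<eta>\<in>configs m. ennreal \<bar>indicator A \<gamma> - indicator A \<eta>\<bar> \<le> ennreal L * dU \<gamma> \<eta>"
      unfolding A_def by (intro ballI indicator_Lipschitz[OF \<Xi>c L])
    with rad[unfolded rademacher_def, rule_format, of "indicator A" L] e_meas e_bdd L
    show ?thesis unfolding dom_eq form_eq by simp
  qed
  obtain s where s: "\<And>n::nat. s n \<in> Cyl" "\<And>n \<gamma>. \<bar>s n \<gamma>\<bar> \<le> 1"
    "AE \<gamma> in \<mu>. (\<lambda>n. s n \<gamma>) \<longlonglongrightarrow> indicator A \<gamma>" "(\<lambda>n. En (s n) (s n)) \<longlonglongrightarrow> 0"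
    using zero_energy_bounded_approximation[OF A rad_A] by blast
  interpret zero_energy_set \<mu> Cyl square_field A s
    by standard (rule A s)+
  note S = semi[unfolded semigroup_of_form_def dom_eq cform_eq]
  interpret L2_semigroup \<mu> T
    by standard (use S in simp_all)
  have gen: "generates \<mu> T u h \<longleftrightarrow> u \<in> Dom \<and> (\<forall>v\<in>Dom. Form u v = - (\<integral>x. h x * v x \<partial>\<mu>))"
    if "u \<in> L2 \<mu>" "h \<in> L2 \<mu>" for u h
    using S that by simp
  have "generates \<mu> T (\<lambda>x. indicator A x * u x) (\<lambda>x. indicator A x * h x)"
    if u: "u \<in> L2 \<mu>" and h: "h \<in> L2 \<mu>" and g: "generates \<mu> T u h" for u h
  proof -
    have uD: "u \<in> Dom" and uf: "\<And>v. v \<in> Dom \<Longrightarrow> Form u v = - (\<integral>x. h x * v x \<partial>\<mu>)"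
      using g gen[OF u h] by auto
    have "Form (\<lambda>x. indicator A x * u x) v = - (\<integral>x. (indicator A x * h x) * v x \<partial>\<mu>)" if v: "v \<in> Dom" for v
      unfolding Form_indicator[OF uD v] uf[OF indicator_Dom[OF v]] by (simp add: mult.assoc mult.left_commute)
    then show ?thesis
      using gen[OF indicator_L2[OF u] indicator_L2[OF h]] indicator_Dom[OF uD] by simp
  qed
  note comm = indicator_commutes[OF A this]
  have "\<forall>f\<in>L2 \<mu>. \<forall>t>0. AE x in \<mu>. indicator A x * T t f x = T t (\<lambda>y. indicator A y * f y) x"
    by (intro ballI allI impI comm less_imp_le)
  with irr A have cases: "emeasure \<mu> A = 0 \<or> emeasure \<mu> (space \<mu> - A) = 0"
    unfolding irreducible_semigroup_def by blast
  have "\<Xi> \<subseteq> A"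
  proof
    fix \<xi> assume \<xi>: "\<xi> \<in> \<Xi>"
    then have "\<xi> \<in> configs m" using \<Xi>c by blast
    then show "\<xi> \<in> A"
      using \<xi> dU_finite_refl unfolding A_def finite_distance_set_def dU_point_set_finite_iff by blast
  qed
  then have "emeasure \<mu> \<Xi> \<le> emeasure \<mu> A" using A by (rule emeasure_mono)
  moreover have "\<Lambda> \<subseteq> space \<mu> - A"
  proof
    fix \<gamma> assume \<gamma>: "\<gamma> \<in> \<Lambda>"
    have "dU_set_set \<Lambda> \<Xi> \<le> dU_point_set \<gamma> \<Xi>" unfolding dU_set_set_def by (rule INF_lower[OF \<gamma>])
    then have "\<not> dU_point_set \<gamma> \<Xi> < \<infinity>" using inf le_less_trans by blast
    then show "\<gamma> \<in> space \<mu> - A" using \<gamma> \<Lambda>c by (auto simp: A_def finite_distance_set_def space_\<mu>)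
  qed
  then have "emeasure \<mu> \<Lambda> \<le> emeasure \<mu> (space \<mu> - A)" using A by (intro emeasure_mono) auto
  ultimately show False using cases \<Xi>(2) \<Lambda>(2) by auto
qed

end

theorem corollary6p6:
  fixes m :: "'a::polish_space measure"
    and D :: "('a \<Rightarrow> real) set"
    and \<Gamma> :: "('a \<Rightarrow> real) \<Rightarrow> ('a \<Rightarrow> real) \<Rightarrow> ('a \<Rightarrow> real)"
    and lft :: "('a \<Rightarrow> real) \<Rightarrow> ('a \<Rightarrow> real)"
    and \<mu> :: "'a measure measure"
    and T :: "real \<Rightarrow> ('a measure \<Rightarrow> real) \<Rightarrow> ('a measure \<Rightarrow> real)"
  assumes "metric_local_diffusion_space m D \<Gamma>"
    and "strong_lifting m lft"
    and "prob_space \<mu>"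
    and "space \<mu> = configs m"
    and "sets \<mu> = sets (config_algebra m)"
    and "closability_assumption m D \<Gamma> lft \<mu>"
    and "rademacher m D \<Gamma> lft \<mu>"
    and "semigroup_of_form \<mu> (config_dom m D \<Gamma> lft \<mu>) (config_closed_form m D \<Gamma> lft \<mu>) T"
    and "irreducible_semigroup \<mu> T"
  shows "\<forall>\<Xi>\<in>sets (config_algebra m). \<forall>\<Lambda>\<in>sets (config_algebra m).
           0 < emeasure \<mu> \<Xi> \<longrightarrow> 0 < emeasure \<mu> \<Lambda> \<longrightarrow>
           (\<lambda>\<gamma>. dU_point_set \<gamma> \<Xi>) \<in> borel_measurable (config_algebra m) \<longrightarrow>
           dU_set_set \<Lambda> \<Xi> < \<infinity>"
proof (intro ballI impI)
  interpret metric_local_diffusion_space m D \<Gamma> by (rule assms(1))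
  interpret lifted_diffusion_space m D \<Gamma> lft by standard (rule assms(2))
  fix \<Xi> \<Lambda> assume "\<Xi> \<in> sets (config_algebra m)" "\<Lambda> \<in> sets (config_algebra m)"
    "0 < emeasure \<mu> \<Xi>" "0 < emeasure \<mu> \<Lambda>"
    "(\<lambda>\<gamma>. dU_point_set \<gamma> \<Xi>) \<in> borel_measurable (config_algebra m)"
  then show "dU_set_set \<Lambda> \<Xi> < \<infinity>"
    by (intro finite_distance[OF assms(3-9)])
qed

end
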